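(* Let $k\in(0,1)$, let $q$ be the elliptic nome associated with the modulus $k$, let $p=\sqrt{\frac{1-k}{1+k}}$ and $r=\frac{k}{1+\sqrt{1-k^2}}$. Then the following three formulas hold. (1) $$\frac{\mathrm{Li}_2(k)-\mathrm{Li}_2(-k)}{8}=\sum_{n=0}^\infty\frac{1}{(2n+1)^2}\frac{q^{n+1/2}}{1+q^{2n+1}}+4\sum_{n=0}^\infty\sum_{m=1}^\infty\frac{1}{(2n+1)^2-(2m)^2}\frac{q^{m+n+1/2}}{(1+q^{2m})(1+q^{2n+1})}.$$ (2) $$\frac{\mathrm{Li}_2(r)-\mathrm{Li}_2(-r)}{4}=\sum_{n=0}^\infty\frac{1}{(2n+1)^2}\frac{q^{n+1/2}}{1+q^{2n+1}}+4\sum_{n=0}^\infty\sum_{m=1}^\infty\frac{(-1)^m}{(2n+1)^2-(2m)^2}\frac{q^{m+n+1/2}}{(1+q^{2m})(1+q^{2n+1})}.$$ (3) $$\begin{aligned}\frac{\mathrm{Li}_2(ip)-\mathrm{Li}_2(-ip)}{8i}=\;&\frac G4+\frac{\pi}{16}\log(p)+\sum_{n=0}^\infty\frac{(-1)^n}{(2n+1)^2}\frac{q^{2n+1}}{1-q^{4n+2}}\\&+4\sum_{n=0}^\infty\sum_{m=1}^\infty\frac{(-1)^{n+m}}{(2n+1)^2-(2m)^2}\frac{q^{m+2n+1}}{(1+q^{2m})(1-q^{4n+2})}.\end{aligned}$$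
   Context: $\mathrm{Li}_2(z)=\sum_{n\ge1}z^n/n^2$ for $|z|\le1$. With $K=K(k)=\int_0^1\frac{dz}{\sqrt{(1-z^2)(1-k^2z^2)}}$ and $K'=K(\sqrt{1-k^2})$, the elliptic nome is $q=e^{-\pi K'/K}\in(0,1)$. $G=\sum_{n=0}^\infty\frac{(-1)^n}{(2n+1)^2}$ is Catalan's constant. *)

theory Defs
  imports "HOL-Analysis.Analysis"
begin

text \<open>The series defining the dilogarithm converges only for \<open>norm z \<le> 1\<close>; outside the
  closed unit disc the value below is meaningless.\<close>

definition Li2 :: "complex \<Rightarrow> complex" where
  "Li2 z = (\<Sum>n. z ^ Suc n / of_nat (Suc n) ^ 2)"

text \<open>The argument is the modulus \<open>k\<close>, not the parameter \<open>k\<^sup>2\<close>. At the endpoint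
  \<open>z = 1\<close> the integrand takes the value \<open>1 / 0 = 0\<close>, which does not affect the integral.\<close>

definition elliptic_K :: "real \<Rightarrow> real" where
  "elliptic_K k = integral {0..1} (\<lambda>z. 1 / sqrt ((1 - z\<^sup>2) * (1 - k\<^sup>2 * z\<^sup>2)))"

definition elliptic_nome :: "real \<Rightarrow> real" where
  "elliptic_nome k = exp (- pi * elliptic_K (sqrt (1 - k\<^sup>2)) / elliptic_K k)"

definition catalan_G :: real where
  "catalan_G = (\<Sum>n. (-1) ^ n / real (2 * n + 1) ^ 2)"

end

theory Submission
  imports Defs "HOL-Library.Nat_Bijection"
begin

text \<open>Write \<open>q = exp (- s)\<close>. The series \<open>C\<close>, \<open>D\<close>, \<open>S\<close> with the coefficients \<open>sech (j s / 2)\<close> (\<open>j\<close> odd),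
  \<open>sech (j s / 2)\<close> (\<open>j\<close> even) and \<open>- \<i> csch (j s / 2)\<close> (\<open>j\<close> odd) are, up to scaling, the Jacobi functions
  cn, dn and sn. Evaluating the convolutions of their coefficients gives the system \<open>S' = C D\<close>,
  \<open>C' = - S D\<close>, \<open>D' = - S C\<close> in the strip \<open>\<bar>Im x\<bar> < s / 2\<close>, hence \<open>S\<^sup>2 + C\<^sup>2\<close> and \<open>S\<^sup>2 + D\<^sup>2\<close> are constant. With
  \<open>M = D 0\<close> and \<open>\<kappa> = C 0 / M\<close>, the amplitude \<open>\<phi> = \<integral> D\<close> satisfies \<open>\<phi>' = M sqrt (1 - \<kappa>\<^sup>2 sin\<^sup>2 \<phi>)\<close>;
  on the real axis it runs from \<open>0\<close> to \<open>\<pi> / 2\<close> in time \<open>\<pi> / 2\<close>, so \<open>K(\<kappa>) = M \<pi> / 2\<close>. Along the imaginary axis the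
  solution blows up at \<open>s / 2\<close>, so \<open>K(sqrt (1 - \<kappa>\<^sup>2)) = M s / 2\<close>. Thus \<open>\<kappa>\<close> has nome \<open>q\<close>, and
  since \<open>K\<close> is strictly increasing \<open>\<kappa> = k\<close>.

  Up to a constant factor and elementary terms, each right-hand side is the integral over \<open>[0, \<pi> / 2]\<close> of a sine series (an antiderivative of \<open>C\<close>, or of \<open>S\<close> at \<open>2 s\<close>
  shifted by \<open>\<pi> / 2\<close>) against \<open>D(x)\<close> or \<open>D(\<pi> / 2 - x)\<close>, because
  \<open>\<integral> sin (N x) cos (M x) = N / (N\<^sup>2 - M\<^sup>2)\<close> for odd \<open>N\<close> and even \<open>M\<close>. Substituting \<open>t = \<phi>(x)\<close> leaves
  \<open>\<integral> arcsin (k sin t)\<close>, \<open>\<integral> arctan (2 r / (1 - r\<^sup>2) cos t)\<close> and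
  \<open>\<integral> ln ((sqrt (1 - k\<^sup>2 sin\<^sup>2 t) + cos t) / (sqrt (1 - k\<^sup>2) (1 + cos t)))\<close>, which are evaluated by differentiating with respect to the parameter.\<close>

section \<open>Fourier series with exponentially decaying coefficients\<close>

text \<open>The elementary identity \<open>D_s(x) = D_2s(2 x) + C_2s(2 x)\<close>, visible on the
  coefficients, is a Landen transformation between the nomes \<open>q\<close> and
  \<open>q\<^sup>2\<close>. Combined with the differential system at \<open>2 s\<close> it gives
  \<open>D' / D = - 2 S_2s(2 x)\<close>, and this linear equation carries much of the proof. It
  makes \<open>D\<close> positive on the real axis, hence \<open>\<kappa> < 1\<close> and the square
  root in the amplitude equation has the right sign. It makes \<open>D(x) D(x + \<pi> / 2)\<close>
  constant, which controls \<open>D(\<pi> / 2 - x)\<close> and so the alternating signs in the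
  second and third formulas. It also exhibits \<open>ln D\<close> as an antiderivative of
  \<open>S\<close> at \<open>2 s\<close>, which is where the hyperbolic sines of the third formula
  come from. The price is that the third formula involves \<open>D\<close> at half the argument,
  while the substitution uses the amplitude at the full argument; the duplication formula for the
  amplitude bridges this.\<close>

lemma summable_on_intI:
  fixes g :: "int \<Rightarrow> 'a :: banach"
  assumes "(\<lambda>n. g (int n)) summable_on UNIV" "(\<lambda>n. g (- int (Suc n))) summable_on UNIV"
  shows "g summable_on UNIV"
proof -
  have U: "(UNIV :: int set) = range int \<union> range (\<lambda>n. - int (Suc n))"
  proof (intro set_eqI iffI UNIV_I)
    fix j :: int
    show "j \<in> range int \<union> range (\<lambda>n. - int (Suc n))"
    proof (cases "j \<ge> 0")
      case True
      then have "j = int (nat j)" by simp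
      then show ?thesis by blast
    next
      case False
      then have "j = - int (Suc (nat (- j - 1)))" by simp
      then show ?thesis by blast
    qed
  qed
  have "g summable_on range int"
    by (subst summable_on_reindex) (use assms in \<open>auto simp: o_def inj_on_def\<close>)
  moreover have "g summable_on range (\<lambda>n. - int (Suc n))"
    by (subst summable_on_reindex) (use assms in \<open>auto simp: o_def inj_on_def\<close>)
  ultimately show ?thesis
    unfolding U by (rule summable_on_Un_disjoint) auto
qed

text \<open>Pairing \<open>j\<close> with \<open>- j\<close> turns the unordered sum into an
  ordinary series; the index 0 has no partner and is split off. Symmetric and antisymmetric
  coefficients then give cosine and sine series.\<close>

lemma infsum_int_sums:
  fixes g :: "int \<Rightarrow> 'a :: banach"
  assumes "g summable_on UNIV"
  shows "(\<lambda>n. g (int (Suc n)) + g (- int (Suc n))) sums (infsum g UNIV - g 0)"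
proof -
  let ?P = "range (\<lambda>n. int (Suc n))" and ?N = "range (\<lambda>n. - int (Suc n))"
  have U: "UNIV - {0} = ?P \<union> ?N"
  proof (intro set_eqI iffI)
    fix j :: int
    assume "j \<in> UNIV - {0}"
    then have "j = int (Suc (nat (j - 1))) \<or> j = - int (Suc (nat (- j - 1)))"
      by (cases "j > 0") auto
    then consider "j = int (Suc (nat (j - 1)))" | "j = - int (Suc (nat (- j - 1)))" by blast
    then show "j \<in> ?P \<union> ?N" by cases blast+
  qed auto
  have s: "g summable_on A" for A
    using assms summable_on_subset_banach by blast
  have "((\<lambda>n. g (int (Suc n))) has_sum infsum g ?P) UNIV"
    using has_sum_infsum[OF s[of ?P]] by (subst (asm) has_sum_reindex) (auto simp: inj_on_def o_def)
  moreover have "((\<lambda>n. g (- int (Suc n))) has_sum infsum g ?N) UNIV"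
    using has_sum_infsum[OF s[of ?N]] by (subst (asm) has_sum_reindex) (auto simp: inj_on_def o_def)
  ultimately have "(\<lambda>n. g (int (Suc n)) + g (- int (Suc n))) sums (infsum g ?P + infsum g ?N)"
    by (intro has_sum_imp_sums has_sum_add)
  moreover have "infsum g ?P + infsum g ?N = infsum g (UNIV - {0})"
    unfolding U by (rule infsum_Un_disjoint[symmetric]) (auto intro: s)
  moreover have "infsum g (UNIV - {0}) = infsum g UNIV - g 0"
    by (subst infsum_Diff) (auto intro: s)
  ultimately show ?thesis by simp
qed

lemma infsum_odd_int_sums:
  fixes g :: "int \<Rightarrow> 'a :: banach"
  assumes "g summable_on UNIV" "\<And>j. even j \<Longrightarrow> g j = 0"
  shows "(\<lambda>n. g (int (2 * n + 1)) + g (- int (2 * n + 1))) sums infsum g UNIV"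
proof -
  let ?h = "\<lambda>n. g (int (Suc n)) + g (- int (Suc n))"
  have "?h sums infsum g UNIV"
    using infsum_int_sums[OF assms(1)] assms(2)[of 0] by simp
  moreover have "strict_mono (\<lambda>n::nat. 2 * n)" by (simp add: strict_mono_def)
  moreover have "?h n = 0" if "n \<notin> range (\<lambda>n::nat. 2 * n)" for n
  proof -
    have "odd n" using that by (auto elim: evenE)
    then have "even (int (Suc n))" by simp
    then show ?thesis using assms(2)[of "int (Suc n)"] assms(2)[of "- int (Suc n)"] by simp
  qed
  ultimately have "(\<lambda>n. ?h (2 * n)) sums infsum g UNIV"
    using sums_mono_reindex[of "\<lambda>n::nat. 2 * n" ?h] by blast
  then show ?thesis by simp
qed

text \<open>Reindexing by the involution gives \<open>infsum g A = - infsum g A\<close>. For a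
  family that is not summable, the default value 0 of \<open>infsum\<close> agrees with the
  claim.\<close>

lemma infsum_anti_involution:
  fixes g :: "'a \<Rightarrow> real"
  assumes "\<And>x. x \<in> A \<Longrightarrow> \<sigma> x \<in> A" "\<And>x. x \<in> A \<Longrightarrow> \<sigma> (\<sigma> x) = x" "\<And>x. x \<in> A \<Longrightarrow> g (\<sigma> x) = - g x"
  shows "infsum g A = 0"
proof -
  have "infsum g A = infsum (\<lambda>x. - g x) A"
    by (rule infsum_reindex_bij_witness[of A \<sigma> \<sigma>]) (use assms in auto)
  then show ?thesis by (simp add: infsum_uminus)
qed

lemma summable_on_exp_int:
  assumes "c > 0"
  shows "(\<lambda>j::int. exp (- c * \<bar>real_of_int j\<bar>)) summable_on UNIV"
proof (rule summable_on_intI)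
  have g: "summable (\<lambda>n. exp (- c) ^ n)" using assms by (intro summable_geometric) auto
  have 1: "exp (- c * \<bar>real_of_int (int n)\<bar>) = exp (- c) ^ n" for n
    by (simp add: exp_of_nat_mult[symmetric] mult.commute)
  have 2: "exp (- c * \<bar>real_of_int (- int (Suc n))\<bar>) = exp (- c) ^ Suc n" for n
    by (subst exp_of_nat_mult[symmetric]) (simp add: algebra_simps)
  show "(\<lambda>n. exp (- c * \<bar>real_of_int (int n)\<bar>)) summable_on UNIV"
    unfolding 1 by (subst summable_on_UNIV_nonneg_real_iff) (use g in auto)
  show "(\<lambda>n. exp (- c * \<bar>real_of_int (- int (Suc n))\<bar>)) summable_on UNIV"
    unfolding 2 by (subst summable_on_UNIV_nonneg_real_iff) (use g in \<open>auto simp del: power_Suc simp: summable_Suc_iff\<close>)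
qed

text \<open>Asking for every rate below \<open>\<rho>\<close> instead of \<open>\<rho>\<close>
  itself keeps the class closed under multiplication by the index, that is, under differentiation of
  the series. The series still converges on the whole open strip of half-width
  \<open>\<rho>\<close>.\<close>

definition exp_decay :: "real \<Rightarrow> (int \<Rightarrow> complex) \<Rightarrow> bool" where
  "exp_decay \<rho> u \<longleftrightarrow> (\<forall>\<sigma><\<rho>. \<exists>B. \<forall>j. norm (u j) \<le> B * exp (- \<sigma> * \<bar>real_of_int j\<bar>))"

definition fourier_series :: "(int \<Rightarrow> complex) \<Rightarrow> complex \<Rightarrow> complex" where
  "fourier_series u x = (\<Sum>\<^sub>\<infinity>j. u j * exp (\<i> * of_int j * x))"

lemma exp_decayI:
  assumes "\<And>j. norm (u j) \<le> B * exp (- \<rho> * \<bar>real_of_int j\<bar>)"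
  shows "exp_decay \<rho> u"
  unfolding exp_decay_def
proof (intro allI impI)
  fix \<sigma> assume "\<sigma> < \<rho>"
  have "0 \<le> norm (u 0)" by simp
  also have "\<dots> \<le> B" using assms[of 0] by simp
  finally have "B \<ge> 0" .
  have "norm (u j) \<le> B * exp (- \<sigma> * \<bar>real_of_int j\<bar>)" for j
  proof -
    have "exp (- \<rho> * \<bar>real_of_int j\<bar>) \<le> exp (- \<sigma> * \<bar>real_of_int j\<bar>)"
      using \<open>\<sigma> < \<rho>\<close> by (simp add: mult_right_mono)
    then show ?thesis
      using assms[of j] \<open>B \<ge> 0\<close> by (meson mult_left_mono order_trans)
  qed
  then show "\<exists>B. \<forall>j. norm (u j) \<le> B * exp (- \<sigma> * \<bar>real_of_int j\<bar>)" by blast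
qed

lemma exp_decay_of_int_mult:
  assumes "exp_decay \<rho> u"
  shows "exp_decay \<rho> (\<lambda>j. of_int j * u j)"
  unfolding exp_decay_def
proof (intro allI impI)
  fix \<sigma> assume "\<sigma> < \<rho>"
  \<comment> \<open>Half of the gap between \<open>\<sigma>\<close> and \<open>\<rho>\<close> pays
    for the factor \<open>j\<close>, because
    \<open>d * \<bar>j\<bar> \<le> exp (d * \<bar>j\<bar>)\<close>.\<close>
  define d where "d = (\<rho> - \<sigma>) / 2"
  have d: "d > 0" "\<sigma> + d < \<rho>" using \<open>\<sigma> < \<rho>\<close> by (auto simp: d_def field_simps)
  obtain B where B: "\<And>j. norm (u j) \<le> B * exp (- (\<sigma> + d) * \<bar>real_of_int j\<bar>)"
    using assms d(2) unfolding exp_decay_def by blast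
  have "norm (of_int j * u j) \<le> (B / d) * exp (- \<sigma> * \<bar>real_of_int j\<bar>)" for j
  proof -
    have "d * \<bar>real_of_int j\<bar> \<le> exp (d * \<bar>real_of_int j\<bar>)"
      using exp_ge_add_one_self[of "d * \<bar>real_of_int j\<bar>"] by linarith
    then have 1: "\<bar>real_of_int j\<bar> \<le> exp (d * \<bar>real_of_int j\<bar>) / d"
      using d by (simp add: field_simps)
    have "norm (of_int j * u j) = \<bar>real_of_int j\<bar> * norm (u j)" by (simp add: norm_mult)
    also have "\<dots> \<le> exp (d * \<bar>real_of_int j\<bar>) / d * (B * exp (- (\<sigma> + d) * \<bar>real_of_int j\<bar>))"
      by (rule mult_mono) (use 1 B d in auto)
    also have "\<dots> = (B / d) * exp (- \<sigma> * \<bar>real_of_int j\<bar>)"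
      by (simp add: mult_exp_exp algebra_simps)
    finally show ?thesis .
  qed
  then show "\<exists>B. \<forall>j. norm (of_int j * u j) \<le> B * exp (- \<sigma> * \<bar>real_of_int j\<bar>)" by blast
qed

text \<open>On the closed strip the exponential grows at most like
  \<open>exp (\<tau> * \<bar>j\<bar>)\<close>, and half of the gap to \<open>\<rho>\<close> survives
  as decay. The majorant is independent of \<open>x\<close>, as termwise differentiation
  requires.\<close>

lemma fourier_series_bound:
  assumes "exp_decay \<rho> u" "\<tau> < \<rho>"
  obtains M where "M summable_on UNIV"
    "\<And>j x. \<bar>Im x\<bar> \<le> \<tau> \<Longrightarrow> norm (u j * exp (\<i> * of_int j * x)) \<le> M j"
proof -
  define d where "d = (\<rho> - \<tau>) / 2"
  have d: "d > 0" "\<tau> + d < \<rho>" using assms by (auto simp: d_def field_simps)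
  obtain B where B: "\<And>j. norm (u j) \<le> B * exp (- (\<tau> + d) * \<bar>real_of_int j\<bar>)"
    using assms(1) d(2) unfolding exp_decay_def by blast
  show ?thesis
  proof (rule that)
    show "(\<lambda>j::int. B * exp (- d * \<bar>real_of_int j\<bar>)) summable_on UNIV"
      by (intro summable_on_cmult_right summable_on_exp_int d)
    fix j :: int and x :: complex
    assume x: "\<bar>Im x\<bar> \<le> \<tau>"
    have "- (of_int j * Im x) \<le> \<bar>real_of_int j\<bar> * \<bar>Im x\<bar>"
      by (metis abs_ge_minus_self abs_mult)
    also have "\<dots> \<le> \<tau> * \<bar>real_of_int j\<bar>"
      using mult_right_mono[OF x, of "\<bar>real_of_int j\<bar>"] by (simp add: mult.commute)
    finally have 1: "norm (exp (\<i> * of_int j * x)) \<le> exp (\<tau> * \<bar>real_of_int j\<bar>)" by simp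
    have "norm (u j * exp (\<i> * of_int j * x)) = norm (u j) * norm (exp (\<i> * of_int j * x))"
      by (simp add: norm_mult)
    also have "\<dots> \<le> (B * exp (- (\<tau> + d) * \<bar>real_of_int j\<bar>)) * exp (\<tau> * \<bar>real_of_int j\<bar>)"
      by (rule mult_mono[OF B 1]) (use B[of j] order_trans[OF norm_ge_zero B[of j]] in auto)
    also have "\<dots> = B * exp (- d * \<bar>real_of_int j\<bar>)"
      by (simp add: mult_exp_exp algebra_simps)
    finally show "norm (u j * exp (\<i> * of_int j * x)) \<le> B * exp (- d * \<bar>real_of_int j\<bar>)" .
  qed
qed

lemma fourier_series_abs_summable:
  assumes "exp_decay \<rho> u" "\<bar>Im x\<bar> < \<rho>"
  shows "(\<lambda>j. norm (u j * exp (\<i> * of_int j * x))) summable_on UNIV"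
proof -
  obtain M where M: "M summable_on UNIV"
    "\<And>j y. \<bar>Im y\<bar> \<le> \<bar>Im x\<bar> \<Longrightarrow> norm (u j * exp (\<i> * of_int j * y)) \<le> M j"
    using fourier_series_bound[OF assms] by blast
  show ?thesis
    by (rule summable_on_comparison_test[OF M(1)]) (use M(2) in auto)
qed

lemma fourier_series_summable:
  assumes "exp_decay \<rho> u" "\<bar>Im x\<bar> < \<rho>"
  shows "(\<lambda>j. u j * exp (\<i> * of_int j * x)) summable_on UNIV"
  using fourier_series_abs_summable[OF assms] by (rule abs_summable_summable)

lemma has_field_derivative_fourier_series:
  assumes u: "exp_decay \<rho> u" and x: "\<bar>Im x\<bar> < \<rho>"
  shows "(fourier_series u has_field_derivative \<i> * fourier_series (\<lambda>j. of_int j * u j) x) (at x)"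
proof -
  have u': "exp_decay \<rho> (\<lambda>j. of_int j * u j)" by (rule exp_decay_of_int_mult[OF u])
  define \<tau> where "\<tau> = (\<bar>Im x\<bar> + \<rho>) / 2"
  have \<tau>: "\<bar>Im x\<bar> < \<tau>" "\<tau> < \<rho>" using x by (auto simp: \<tau>_def)
  define S where "S = {y. \<bar>Im y\<bar> < \<tau>}"
  have S_alt: "S = {y. Im y < \<tau>} \<inter> {y. Im y > - \<tau>}" by (auto simp: S_def)
  have S: "convex S" "open S" "x \<in> S"
    unfolding S_alt using \<tau>
    by (auto intro!: convex_Int convex_halfspace_Im_lt convex_halfspace_Im_gt open_Int
          open_halfspace_Im_lt open_halfspace_Im_gt)
  obtain M where M: "M summable_on UNIV"
    "\<And>j y. \<bar>Im y\<bar> \<le> \<tau> \<Longrightarrow> norm ((of_int j * u j) * exp (\<i> * of_int j * y)) \<le> M j"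
    using fourier_series_bound[OF u' \<tau>(2)] by blast
  \<comment> \<open>The differentiation theorem for series runs over the naturals. Unordered
    summability allows \<open>int_decode\<close> to enumerate the integers.\<close>
  define f where "f n y = u (int_decode n) * exp (\<i> * of_int (int_decode n) * y)" for n y
  define f' where "f' n y = \<i> * ((of_int (int_decode n) * u (int_decode n)) * exp (\<i> * of_int (int_decode n) * y))" for n y
  have bij: "bij int_decode" by (rule bij_int_decode)
  have s: "(\<lambda>n. f n y) sums fourier_series u y" if "\<bar>Im y\<bar> < \<rho>" for y
  proof -
    have "((\<lambda>j. u j * exp (\<i> * of_int j * y)) has_sum fourier_series u y) UNIV"
      unfolding fourier_series_def by (intro has_sum_infsum fourier_series_summable[OF u that])
    then have "((\<lambda>n. f n y) has_sum fourier_series u y) UNIV"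
      unfolding f_def by (subst has_sum_reindex_bij_betw[OF bij])
    then show ?thesis by (rule has_sum_imp_sums)
  qed
  have s': "(\<lambda>n. f' n x) sums (\<i> * fourier_series (\<lambda>j. of_int j * u j) x)"
  proof -
    have "((\<lambda>j. (of_int j * u j) * exp (\<i> * of_int j * x)) has_sum fourier_series (\<lambda>j. of_int j * u j) x) UNIV"
      unfolding fourier_series_def by (intro has_sum_infsum fourier_series_summable[OF u' x])
    then have "((\<lambda>j. \<i> * ((of_int j * u j) * exp (\<i> * of_int j * x))) has_sum \<i> * fourier_series (\<lambda>j. of_int j * u j) x) UNIV"
      by (rule has_sum_cmult_right)
    then have "((\<lambda>n. f' n x) has_sum \<i> * fourier_series (\<lambda>j. of_int j * u j) x) UNIV"
      unfolding f'_def by (subst has_sum_reindex_bij_betw[OF bij])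
    then show ?thesis by (rule has_sum_imp_sums)
  qed
  have "((\<lambda>y. \<Sum>n. f n y) has_field_derivative (\<Sum>n. f' n x)) (at x)"
  proof (rule has_field_derivative_series'(2)[of S])
    show "(f n has_field_derivative f' n y) (at y within S)" for n y
      unfolding f_def f'_def by (auto intro!: derivative_eq_intros simp: algebra_simps)
    show "uniformly_convergent_on S (\<lambda>n y. \<Sum>i<n. f' i y)"
    proof (rule Weierstrass_m_test')
      show "summable (\<lambda>n. M (int_decode n))"
        by (intro summable_on_imp_summable) (use M(1) summable_on_reindex_bij_betw[OF bij] in blast)
      show "norm (f' n y) \<le> M (int_decode n)" if "y \<in> S" for n y
        using M(2)[of y "int_decode n"] that by (simp add: f'_def S_def norm_mult)
    qed
    show "x \<in> interior S" using S by (simp add: interior_open)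
    show "summable (\<lambda>n. f n x)" using s[OF x] by (simp add: sums_iff)
  qed (use S in auto)
  moreover have "(\<Sum>n. f' n x) = \<i> * fourier_series (\<lambda>j. of_int j * u j) x"
    using s' by (simp add: sums_iff)
  moreover have "(\<Sum>n. f n y) = fourier_series u y" if "y \<in> S" for y
    using s[of y] that \<tau> by (simp add: sums_iff S_def)
  ultimately show ?thesis
    by (metis (no_types, lifting) has_field_derivative_transform_within_open[OF _ S(2,3)])
qed

lemma fourier_series_mult:
  assumes u: "exp_decay \<rho> u" and v: "exp_decay \<rho> v" and x: "\<bar>Im x\<bar> < \<rho>"
  shows "fourier_series u x * fourier_series v x = fourier_series (\<lambda>n. \<Sum>\<^sub>\<infinity>j. u j * v (n - j)) x"
proof -
  define f where "f j = u j * exp (\<i> * of_int j * x)" for j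
  define g where "g j = v j * exp (\<i> * of_int j * x)" for j
  have f: "(\<lambda>j. norm (f j)) summable_on UNIV" and g: "(\<lambda>j. norm (g j)) summable_on UNIV"
    unfolding f_def g_def using fourier_series_abs_summable[OF u x] fourier_series_abs_summable[OF v x] by auto
  have fg: "(\<lambda>p. norm (case p of (j, l) \<Rightarrow> f j * g l)) summable_on UNIV \<times> UNIV"
  proof (subst Infinite_Sum.abs_summable_on_Sigma_iff, intro conjI ballI)
    show "(\<lambda>y. norm (case (j, y) of (j, l) \<Rightarrow> f j * g l)) summable_on UNIV" for j
      using summable_on_cmult_right[OF g, of "norm (f j)"] by (simp add: norm_mult)
    have "(\<lambda>j. norm (f j) * (\<Sum>\<^sub>\<infinity>l. norm (g l))) summable_on UNIV"
      by (intro summable_on_cmult_left f)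
    moreover have "norm (\<Sum>\<^sub>\<infinity>l. norm (case (j, l) of (j, l) \<Rightarrow> f j * g l)) = norm (f j) * (\<Sum>\<^sub>\<infinity>l. norm (g l))" for j
      by (simp only: prod.case norm_mult infsum_cmult_right' real_norm_def abs_mult abs_norm_cancel
          abs_of_nonneg[OF infsum_nonneg[of UNIV "\<lambda>l. norm (g l)", OF norm_ge_zero]])
    ultimately show "(\<lambda>j. norm (\<Sum>\<^sub>\<infinity>l. norm (case (j, l) of (j, l) \<Rightarrow> f j * g l))) summable_on UNIV"
      by presburger
  qed
  \<comment> \<open>In the coordinates \<open>(n, j)\<close> with \<open>n = j + l\<close>, summing
    over \<open>j\<close> at fixed \<open>n\<close> collects a single frequency. Absolute
    summability over all pairs justifies both iterated sums.\<close>
  define h where "h = (\<lambda>(n, j). f j * g (n - j))"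
  have bij: "bij_betw (\<lambda>(n::int, j::int). (j, n - j)) (UNIV \<times> UNIV) (UNIV \<times> UNIV)"
    by (rule bij_betwI[of _ _ _ "\<lambda>(j, l). (j + l, j)"]) auto
  have h_eq: "h p = (case (case p of (n, j) \<Rightarrow> (j, n - j)) of (j, l) \<Rightarrow> f j * g l)" for p
    by (simp add: h_def split: prod.split)
  have h: "h summable_on UNIV \<times> UNIV"
    unfolding h_eq by (subst summable_on_reindex_bij_betw[OF bij]) (rule abs_summable_summable[OF fg])
  have fg': "(\<lambda>(j, l). f j * g l) summable_on UNIV \<times> UNIV"
    by (rule abs_summable_summable[OF fg])
  have "fourier_series u x * fourier_series v x = (\<Sum>\<^sub>\<infinity>j. f j * (\<Sum>\<^sub>\<infinity>l. g l))"
    unfolding fourier_series_def f_def g_def by (simp add: infsum_cmult_left')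
  also have "\<dots> = (\<Sum>\<^sub>\<infinity>j. \<Sum>\<^sub>\<infinity>l. f j * g l)" by (simp add: infsum_cmult_right')
  also have "\<dots> = infsum (\<lambda>(j, l). f j * g l) (UNIV \<times> UNIV)"
    by (rule infsum_Sigma'_banach[OF fg'])
  also have "\<dots> = infsum h (UNIV \<times> UNIV)"
    unfolding h_eq by (rule infsum_reindex_bij_betw[OF bij, symmetric])
  also have "\<dots> = (\<Sum>\<^sub>\<infinity>n. \<Sum>\<^sub>\<infinity>j. f j * g (n - j))"
    unfolding h_def by (rule infsum_Sigma'_banach[OF h[unfolded h_def], symmetric])
  also have "\<dots> = fourier_series (\<lambda>n. \<Sum>\<^sub>\<infinity>j. u j * v (n - j)) x"
    unfolding fourier_series_def
  proof (rule infsum_cong)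
    fix n
    have "f j * g (n - j) = u j * v (n - j) * exp (\<i> * of_int n * x)" for j
      by (simp add: f_def g_def mult_exp_exp algebra_simps)
    then show "(\<Sum>\<^sub>\<infinity>j. f j * g (n - j)) = (\<Sum>\<^sub>\<infinity>j. u j * v (n - j)) * exp (\<i> * of_int n * x)"
      by (simp add: infsum_cmult_left')
  qed
  finally show ?thesis .
qed

section \<open>Lambert-type series for the Jacobi elliptic functions\<close>

text \<open>The summand is 2 for \<open>j\<close> strictly between 0 and \<open>n\<close>, 0
  outside, and 1 at the two ends. Among odd \<open>j\<close> the end 0 never occurs, and the end
  \<open>n\<close> occurs exactly when \<open>n\<close> is odd; in both cases the total is
  \<open>n\<close>.\<close>

lemma sgn_sum_odd_nonneg:
  "((\<lambda>j. real_of_int (sgn j + sgn (int n - j))) has_sum real n) {j. odd j}"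
proof -
  define k where "k = n div 2"
  have inj: "inj_on (\<lambda>i. 2 * int i + 1) A" for A by (auto simp: inj_on_def)
  have fin: "((\<lambda>j. real_of_int (sgn j + sgn (int n - j))) has_sum real n) ((\<lambda>i. 2 * int i + 1) ` {..<(n + 1) div 2})"
  proof (rule has_sum_finiteI)
    show "real n = (\<Sum>j\<in>(\<lambda>i. 2 * int i + 1) ` {..<(n + 1) div 2}. real_of_int (sgn j + sgn (int n - j)))"
    proof (cases "even n")
      case True
      then have n: "n = 2 * k" "(n + 1) div 2 = k" by (auto simp: k_def)
      have "(\<Sum>i<k. real_of_int (sgn (2 * int i + 1) + sgn (int n - (2 * int i + 1)))) = (\<Sum>i<k. 2)"
        by (rule sum.cong) (auto simp: n sgn_if)
      then show ?thesis by (subst sum.reindex[OF inj]) (simp add: n)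
    next
      case False
      then have n: "n = 2 * k + 1" "(n + 1) div 2 = Suc k" by (auto simp: k_def elim: oddE)
      have "(\<Sum>i<k. real_of_int (sgn (2 * int i + 1) + sgn (int n - (2 * int i + 1)))) = (\<Sum>i<k. 2)"
        by (rule sum.cong) (auto simp: n sgn_if)
      then show ?thesis by (subst sum.reindex[OF inj]) (simp add: n)
    qed
  qed auto
  show ?thesis
  proof (subst has_sum_cong_neutral[where T = "(\<lambda>i. 2 * int i + 1) ` {..<(n + 1) div 2}"])
    fix j :: int assume j: "j \<in> {j. odd j} - (\<lambda>i. 2 * int i + 1) ` {..<(n + 1) div 2}"
    have "j < 0 \<or> j > int n"
    proof (rule ccontr)
      assume "\<not> ?thesis"
      then obtain m where m: "j = int m" "m \<le> n" using zero_le_imp_eq_int[of j] by auto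
      with j obtain i where i: "m = 2 * i + 1" by (auto elim: oddE)
      with m have "j = 2 * int i + 1" "i < (n + 1) div 2" by auto
      with j show False by blast
    qed
    then show "real_of_int (sgn j + sgn (int n - j)) = 0" by auto
  qed (use fin in auto)
qed

lemma sgn_sum_odd:
  "((\<lambda>j. real_of_int (sgn j + sgn (N - j))) has_sum of_int N) {j. odd j}"
proof (cases "N \<ge> 0")
  case True
  then show ?thesis using sgn_sum_odd_nonneg[of "nat N"] by simp
next
  case False
  have "((\<lambda>j. real_of_int (sgn j + sgn (- N - j))) has_sum of_int (- N)) {j. odd j}"
    using False sgn_sum_odd_nonneg[of "nat (- N)"] by simp
  then have "((\<lambda>j. - real_of_int (sgn j + sgn (- N - j))) has_sum - of_int (- N)) {j. odd j}"
    by (rule has_sum_uminusI)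
  also have "?this \<longleftrightarrow> ?thesis"
    by (rule has_sum_reindex_bij_witness[of _ uminus uminus]) (auto simp: sgn_if)
  finally show ?thesis .
qed

text \<open>The deviations of \<open>g\<close> and \<open>h\<close> from \<open>sgn\<close> cancel by oddness, which leaves the finite sum of \<open>sgn j + sgn (N - j)\<close>.\<close>

lemma odd_sign_like_sum:
  fixes g h :: "int \<Rightarrow> real"
  assumes g: "\<And>j. g (- j) = - g j" "(\<lambda>j. g j - of_int (sgn j)) summable_on {j. odd j}"
    and h: "\<And>j. h (- j) = - h j" "(\<lambda>j. h j - of_int (sgn j)) summable_on UNIV"
  shows "((\<lambda>j. g j + h (N - j)) has_sum of_int N) {j. odd j}"
proof -
  let ?e1 = "\<lambda>j. g j - of_int (sgn j)" and ?e2 = "\<lambda>j. h j - of_int (sgn j)"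
  have "infsum ?e1 {j. odd j} = 0"
    by (rule infsum_anti_involution[where \<sigma> = uminus]) (auto simp: g)
  then have 1: "(?e1 has_sum 0) {j. odd j}" using g(2) by (metis has_sum_infsum)
  have "(\<lambda>j. ?e2 (N - j)) summable_on UNIV"
    using h(2) by (subst summable_on_reindex_bij_betw[where g = "\<lambda>j. N - j" and B = UNIV])
      (auto intro!: bij_betwI[where g = "\<lambda>j. N - j"])
  then have s2: "(\<lambda>j. ?e2 (N - j)) summable_on {j. odd j}"
    by (rule summable_on_subset_banach) auto
  \<comment> \<open>The reflection about \<open>N\<close> preserves oddness of \<open>j\<close>,
    whatever the parity of \<open>N\<close>, and changes the sign of \<open>N - j\<close>.\<close>
  have "?e2 (N - (2 * N - j)) = - ?e2 (N - j)" for j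
    using h(1)[of "N - j"] by (simp add: sgn_if)
  then have "infsum (\<lambda>j. ?e2 (N - j)) {j. odd j} = 0"
    by (intro infsum_anti_involution[where \<sigma> = "\<lambda>j. 2 * N - j"]) auto
  then have 2: "((\<lambda>j. ?e2 (N - j)) has_sum 0) {j. odd j}" using s2 by (metis has_sum_infsum)
  show ?thesis
    using has_sum_add[OF has_sum_add[OF 1 2] sgn_sum_odd[of N]] by (simp add: algebra_simps)
qed

section \<open>Exponential bounds for hyperbolic functions\<close>

lemma sech_le: "1 / cosh (y::real) \<le> 2 * exp (- \<bar>y\<bar>)"
proof -
  have "exp \<bar>y\<bar> \<le> 2 * cosh \<bar>y\<bar>" by (simp add: cosh_def)
  then have "1 \<le> 2 * exp (- \<bar>y\<bar>) * cosh y"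
    by (simp add: exp_minus field_simps)
  then show ?thesis by (simp add: divide_le_eq cosh_real_pos)
qed

lemma csch_le:
  assumes "c > 0" "\<bar>y::real\<bar> \<ge> c"
  shows "\<bar>1 / sinh y\<bar> \<le> 2 / (1 - exp (- 2 * c)) * exp (- \<bar>y\<bar>)"
proof -
  have 1: "1 - exp (- 2 * c) > 0" using assms by simp
  have "\<bar>sinh y\<bar> = sinh \<bar>y\<bar>" by (simp add: abs_if)
  also have "\<dots> = (1 - exp (- 2 * \<bar>y\<bar>)) * exp \<bar>y\<bar> / 2"
    by (simp add: sinh_field_def algebra_simps mult_exp_exp)
  finally have 2: "\<bar>sinh y\<bar> = (1 - exp (- 2 * \<bar>y\<bar>)) * exp \<bar>y\<bar> / 2" .
  have "(1 - exp (- 2 * c)) * exp \<bar>y\<bar> / 2 \<le> \<bar>sinh y\<bar>"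
    unfolding 2 using assms by (intro divide_right_mono mult_right_mono) auto
  moreover have "0 < (1 - exp (- 2 * c)) * exp \<bar>y\<bar> / 2" using 1 by simp
  ultimately have "1 / \<bar>sinh y\<bar> \<le> 1 / ((1 - exp (- 2 * c)) * exp \<bar>y\<bar> / 2)"
    by (intro divide_left_mono mult_pos_pos) auto
  then show ?thesis by (simp add: exp_minus field_simps)
qed

lemma abs_tanh_minus_sgn_le: "\<bar>tanh (y::real) - sgn y\<bar> \<le> 1 / cosh y"
proof (cases y "0::real" rule: linorder_cases)
  case less
  have "tanh y - sgn y = exp y / cosh y"
    using less by (simp add: tanh_def add_divide_distrib flip: cosh_plus_sinh)
  moreover have "exp y \<le> 1" using less by simp
  ultimately show ?thesis by (simp add: divide_right_mono cosh_real_pos less_imp_le)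
next
  case greater
  have "tanh y - sgn y = - (exp (- y) / cosh y)"
    using greater by (simp add: tanh_def diff_divide_distrib flip: cosh_minus_sinh)
  moreover have "exp (- y) \<le> 1" using greater by simp
  ultimately show ?thesis by (simp add: divide_right_mono cosh_real_pos less_imp_le)
qed auto

lemma abs_coth_minus_sgn_le: "\<bar>cosh (y::real) / sinh y - sgn y\<bar> \<le> \<bar>1 / sinh y\<bar>"
proof (cases y "0::real" rule: linorder_cases)
  case less
  have "cosh y / sinh y - sgn y = exp y / sinh y"
    using less by (simp add: add_divide_distrib flip: cosh_plus_sinh)
  then have "\<bar>cosh y / sinh y - sgn y\<bar> = exp y * \<bar>1 / sinh y\<bar>" by (simp add: abs_divide)
  moreover have "exp y * \<bar>1 / sinh y\<bar> \<le> \<bar>1 / sinh y\<bar>"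
    using less by (intro mult_left_le_one_le) auto
  ultimately show ?thesis by simp
next
  case greater
  have "cosh y / sinh y - sgn y = exp (- y) / sinh y"
    using greater by (simp add: diff_divide_distrib flip: cosh_minus_sinh)
  then have "\<bar>cosh y / sinh y - sgn y\<bar> = exp (- y) * \<bar>1 / sinh y\<bar>" by (simp add: abs_divide)
  moreover have "exp (- y) * \<bar>1 / sinh y\<bar> \<le> \<bar>1 / sinh y\<bar>"
    using greater by (intro mult_left_le_one_le) auto
  ultimately show ?thesis by simp
qed auto

lemma summable_tanh_minus_sgn:
  assumes "(c::real) > 0"
  shows "(\<lambda>j::int. tanh (of_int j * c) - of_int (sgn j)) summable_on UNIV"
proof (rule abs_summable_summable, rule summable_on_comparison_test)
  show "(\<lambda>j::int. 2 * exp (- c * \<bar>real_of_int j\<bar>)) summable_on UNIV"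
    by (intro summable_on_cmult_right summable_on_exp_int assms)
  fix j :: int
  have "\<bar>tanh (of_int j * c) - sgn (of_int j * c)\<bar> \<le> 2 * exp (- \<bar>of_int j * c\<bar>)"
    using order_trans[OF abs_tanh_minus_sgn_le sech_le] .
  moreover have "sgn (of_int j * c) = of_int (sgn j)" using assms by (auto simp: sgn_if zero_less_mult_iff)
  ultimately show "norm (tanh (of_int j * c) - of_int (sgn j)) \<le> 2 * exp (- c * \<bar>real_of_int j\<bar>)"
    using assms by (simp add: abs_mult mult.commute)
qed auto

lemma summable_coth_minus_sgn:
  assumes "(c::real) > 0"
  shows "(\<lambda>j::int. cosh (of_int j * c) / sinh (of_int j * c) - of_int (sgn j)) summable_on {j. odd j}"
proof (rule abs_summable_summable, rule summable_on_comparison_test)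
  show "(\<lambda>j::int. 2 / (1 - exp (- 2 * c)) * exp (- c * \<bar>real_of_int j\<bar>)) summable_on {j. odd j}"
    by (intro summable_on_cmult_right summable_on_subset_banach[OF summable_on_exp_int] assms) auto
  fix j :: int
  assume "j \<in> {j. odd j}"
  then have "\<bar>real_of_int j\<bar> \<ge> 1" by (cases "j = 0") auto
  then have "\<bar>of_int j * c\<bar> \<ge> c" using assms by (simp add: abs_mult)
  then have "\<bar>cosh (of_int j * c) / sinh (of_int j * c) - sgn (of_int j * c)\<bar> \<le> 2 / (1 - exp (- 2 * c)) * exp (- \<bar>of_int j * c\<bar>)"
    using order_trans[OF abs_coth_minus_sgn_le csch_le] assms by blast
  moreover have "sgn (of_int j * c) = of_int (sgn j)" using assms by (auto simp: sgn_if zero_less_mult_iff)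
  ultimately show "norm (cosh (of_int j * c) / sinh (of_int j * c) - of_int (sgn j)) \<le> 2 / (1 - exp (- 2 * c)) * exp (- c * \<bar>real_of_int j\<bar>)"
    using assms by (simp add: abs_mult mult.commute)
qed auto

text \<open>Both convolutions rest on the addition theorem, e.g.
  \<open>cosh (a + b) / (sinh a cosh b) = coth a + tanh b\<close>.\<close>

lemma csch_sech_convolution:
  assumes "(c::real) > 0"
  shows "((\<lambda>j::int. 1 / (sinh (of_int j * c) * cosh (of_int (N - j) * c))) has_sum of_int N / cosh (of_int N * c)) {j. odd j}"
proof -
  have "((\<lambda>j. cosh (of_int j * c) / sinh (of_int j * c) + tanh (of_int (N - j) * c)) has_sum of_int N) {j. odd j}"
    using odd_sign_like_sum[OF _ summable_coth_minus_sgn[OF assms] _ summable_tanh_minus_sgn[OF assms]] by simp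
  then have "((\<lambda>j. (cosh (of_int j * c) / sinh (of_int j * c) + tanh (of_int (N - j) * c)) * (1 / cosh (of_int N * c))) has_sum of_int N * (1 / cosh (of_int N * c))) {j. odd j}"
    by (rule has_sum_cmult_left)
  moreover have "(cosh (of_int j * c) / sinh (of_int j * c) + tanh (of_int (N - j) * c)) * (1 / cosh (of_int N * c))
      = 1 / (sinh (of_int j * c) * cosh (of_int (N - j) * c))" if "j \<in> {j. odd j}" for j
  proof -
    define a b where "a = of_int j * c" and "b = of_int (N - j) * c"
    have N: "of_int N * c = a + b" by (simp add: a_def b_def algebra_simps)
    have "j \<noteq> 0" using that by auto
    then have [simp]: "a \<noteq> 0" using assms by (simp add: a_def)
    show ?thesis
      unfolding N a_def[symmetric] b_def[symmetric]
      by (simp add: tanh_def cosh_real_nonzero divide_simps) (simp add: cosh_add algebra_simps)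
  qed
  ultimately show ?thesis using has_sum_cong by (metis (no_types, lifting) mult.right_neutral times_divide_eq_right)
qed

lemma sech_sech_convolution:
  assumes "(c::real) > 0" "N \<noteq> 0"
  shows "((\<lambda>j::int. 1 / (cosh (of_int j * c) * cosh (of_int (N - j) * c))) has_sum of_int N / sinh (of_int N * c)) {j. odd j}"
proof -
  have "(\<lambda>j. tanh (of_int j * c) - of_int (sgn j)) summable_on {j. odd j}"
    using summable_tanh_minus_sgn[OF assms(1)] summable_on_subset_banach by blast
  then have "((\<lambda>j. tanh (of_int j * c) + tanh (of_int (N - j) * c)) has_sum of_int N) {j. odd j}"
    using odd_sign_like_sum[OF _ _ _ summable_tanh_minus_sgn[OF assms(1)]] by simp
  then have "((\<lambda>j. (tanh (of_int j * c) + tanh (of_int (N - j) * c)) * (1 / sinh (of_int N * c))) has_sum of_int N * (1 / sinh (of_int N * c))) {j. odd j}"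
    by (rule has_sum_cmult_left)
  moreover have "(tanh (of_int j * c) + tanh (of_int (N - j) * c)) * (1 / sinh (of_int N * c))
      = 1 / (cosh (of_int j * c) * cosh (of_int (N - j) * c))" for j
  proof -
    define a b where "a = of_int j * c" and "b = of_int (N - j) * c"
    have N: "of_int N * c = a + b" by (simp add: a_def b_def algebra_simps)
    have [simp]: "a + b \<noteq> 0" unfolding N[symmetric] using assms by simp
    show ?thesis
      unfolding N a_def[symmetric] b_def[symmetric]
      by (simp add: tanh_def cosh_real_nonzero divide_simps) (simp add: sinh_add algebra_simps)
  qed
  ultimately show ?thesis by simp
qed

section \<open>The three series and their differential system\<close>

definition sech_coeff :: "real \<Rightarrow> int \<Rightarrow> complex" where
  "sech_coeff s j = of_real (1 / cosh (of_int j * (s / 2)))"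

text \<open>In classical notation, with \<open>M\<close> and \<open>\<kappa>\<close> as in the
  overview, \<open>ell_C\<close>, \<open>ell_D\<close> and \<open>ell_S\<close> are
  \<open>\<kappa> M cn (M x)\<close>, \<open>M dn (M x)\<close> and
  \<open>\<kappa> M sn (M x)\<close>. This normalisation removes all constants from the differential
  system and leaves plain hyperbolic quotients as coefficients.\<close>

definition ell_C :: "real \<Rightarrow> complex \<Rightarrow> complex" where
  "ell_C s = fourier_series (\<lambda>j. if odd j then sech_coeff s j else 0)"

definition ell_D :: "real \<Rightarrow> complex \<Rightarrow> complex" where
  "ell_D s = fourier_series (\<lambda>j. if even j then sech_coeff s j else 0)"

definition ell_S :: "real \<Rightarrow> complex \<Rightarrow> complex" where
  "ell_S s = fourier_series (\<lambda>j. if odd j then - \<i> * of_real (1 / sinh (of_int j * (s / 2))) else 0)"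

lemma exp_decay_sech:
  assumes "s > 0" shows "exp_decay (s / 2) (sech_coeff s)"
proof (rule exp_decayI)
  fix j
  show "norm (sech_coeff s j) \<le> 2 * exp (- (s / 2) * \<bar>real_of_int j\<bar>)"
    using sech_le[of "of_int j * (s / 2)"] assms cosh_real_pos[of "of_int j * (s / 2)"]
    by (simp add: sech_coeff_def norm_divide abs_mult mult.commute)
qed

lemma exp_decay_restrict: "exp_decay \<rho> u \<Longrightarrow> exp_decay \<rho> (\<lambda>j. if P j then u j else 0)"
  unfolding exp_decay_def by (fastforce intro: order_trans[OF norm_ge_zero])

lemma exp_decay_csch:
  assumes "s > 0" shows "exp_decay (s / 2) (\<lambda>j. if odd j then - \<i> * of_real (1 / sinh (of_int j * (s / 2))) else 0)"
proof (rule exp_decayI)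
  fix j :: int
  have e: "exp (- s) < 1" using assms by simp
  show "norm (if odd j then - \<i> * of_real (1 / sinh (of_int j * (s / 2))) else (0::complex))
      \<le> 2 / (1 - exp (- s)) * exp (- (s / 2) * \<bar>real_of_int j\<bar>)"
  proof (cases "odd j")
    case True
    then have "\<bar>real_of_int j\<bar> \<ge> 1" by (cases "j = 0") auto
    then have "\<bar>of_int j * (s / 2)\<bar> \<ge> s / 2" using assms by (simp add: abs_mult)
    from csch_le[OF _ this] show ?thesis
      using assms True by (simp add: norm_mult norm_divide abs_mult mult.commute)
  qed (use e in simp)
qed

lemmas ell_decay = exp_decay_restrict[OF exp_decay_sech, of _ even] exp_decay_restrict[OF exp_decay_sech, of _ odd] exp_decay_csch

text \<open>Differentiation multiplies the coefficient at \<open>j\<close> by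
  \<open>\<i> * j\<close>, and each convolution returns a hyperbolic coefficient times its index.
  The parities fit: two odd indices add up to an even one, an odd and an even index to an odd
  one.\<close>

lemma ell_deriv:
  assumes s: "s > 0" and x: "\<bar>Im x\<bar> < s / 2"
  shows "(ell_D s has_field_derivative - (ell_S s x * ell_C s x)) (at x)"
    and "(ell_C s has_field_derivative - (ell_S s x * ell_D s x)) (at x)"
    and "(ell_S s has_field_derivative ell_C s x * ell_D s x) (at x)"
proof -
  have c: "s / 2 > 0" using s by simp
  \<comment> \<open>One computation serves both products with \<open>S\<close>: \<open>P\<close> is
    the parity of the index of the \<open>sech\<close> factor. As \<open>j\<close> is odd, the
    product lives on the indices \<open>n\<close> of the opposite parity, which
    \<open>P (n - 1)\<close> expresses.\<close>
  have CS: "(\<Sum>\<^sub>\<infinity>j. (if odd j then - \<i> * of_real (1 / sinh (of_int j * (s / 2))) else 0)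
        * (if P (n - j) then sech_coeff s (n - j) else 0)) = (if P (n - 1) then - \<i> * (of_int n * sech_coeff s n) else 0)"
      if P: "\<And>j. odd j \<Longrightarrow> P (n - j) \<longleftrightarrow> P (n - 1)" for n P
  proof (cases "P (n - 1)")
    case True
    have "((\<lambda>j. - \<i> * complex_of_real (1 / (sinh (of_int j * (s / 2)) * cosh (of_int (n - j) * (s / 2)))))
        has_sum - \<i> * of_real (of_int n / cosh (of_int n * (s / 2)))) {j. odd j}"
      by (intro has_sum_cmult_right has_sum_of_real csch_sech_convolution c)
    then have "(\<Sum>\<^sub>\<infinity>j\<in>{j. odd j}. - \<i> * complex_of_real (1 / (sinh (of_int j * (s / 2)) * cosh (of_int (n - j) * (s / 2)))))
        = - \<i> * of_real (of_int n / cosh (of_int n * (s / 2)))" by (rule infsumI)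
    also have "(\<Sum>\<^sub>\<infinity>j\<in>{j. odd j}. - \<i> * complex_of_real (1 / (sinh (of_int j * (s / 2)) * cosh (of_int (n - j) * (s / 2)))))
      = (\<Sum>\<^sub>\<infinity>j. (if odd j then - \<i> * of_real (1 / sinh (of_int j * (s / 2))) else 0)
        * (if P (n - j) then sech_coeff s (n - j) else 0))"
      by (rule infsum_cong_neutral) (use P True in \<open>auto simp: sech_coeff_def\<close>)
    finally show ?thesis using True by (simp add: sech_coeff_def)
  next
    case False
    have "(\<Sum>\<^sub>\<infinity>j. (if odd j then - \<i> * of_real (1 / sinh (of_int j * (s / 2))) else 0)
        * (if P (n - j) then sech_coeff s (n - j) else 0)) = (\<Sum>\<^sub>\<infinity>j\<in>(UNIV::int set). 0)"
      by (rule infsum_cong) (use P False in auto)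
    then show ?thesis using False by simp
  qed
  \<comment> \<open>Only odd \<open>n\<close> contribute, so the division by
    \<open>sinh (n s / 2)\<close> in the convolution is legitimate.\<close>
  have CD: "(\<Sum>\<^sub>\<infinity>j. (if odd j then sech_coeff s j else 0) * (if even (n - j) then sech_coeff s (n - j) else 0))
     = (if odd n then of_int n * of_real (1 / sinh (of_int n * (s / 2))) else 0)" for n
  proof (cases "odd n")
    case True
    have "((\<lambda>j. complex_of_real (1 / (cosh (of_int j * (s / 2)) * cosh (of_int (n - j) * (s / 2)))))
        has_sum of_real (of_int n / sinh (of_int n * (s / 2)))) {j. odd j}"
      using True by (intro has_sum_of_real sech_sech_convolution c) auto
    then have "(\<Sum>\<^sub>\<infinity>j\<in>{j. odd j}. complex_of_real (1 / (cosh (of_int j * (s / 2)) * cosh (of_int (n - j) * (s / 2)))))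
        = of_real (of_int n / sinh (of_int n * (s / 2)))" by (rule infsumI)
    also have "(\<Sum>\<^sub>\<infinity>j\<in>{j. odd j}. complex_of_real (1 / (cosh (of_int j * (s / 2)) * cosh (of_int (n - j) * (s / 2)))))
      = (\<Sum>\<^sub>\<infinity>j. (if odd j then sech_coeff s j else 0) * (if even (n - j) then sech_coeff s (n - j) else 0))"
      by (rule infsum_cong_neutral) (use True in \<open>auto simp: sech_coeff_def\<close>)
    finally show ?thesis using True by simp
  next
    case False
    have "(\<Sum>\<^sub>\<infinity>j. (if odd j then sech_coeff s j else 0) * (if even (n - j) then sech_coeff s (n - j) else 0))
        = (\<Sum>\<^sub>\<infinity>j\<in>(UNIV::int set). 0)"
      by (rule infsum_cong) (use False in auto)
    then show ?thesis using False by simp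
  qed
  have cm: "fourier_series (\<lambda>j. c * u j) y = c * fourier_series u y" for c u y
    unfolding fourier_series_def by (simp add: infsum_cmult_right' mult.assoc)
  have neg: "- fourier_series u y = fourier_series (\<lambda>j. - u j) y" for u y
    using cm[of "-1" u y] by simp
  have "\<i> * fourier_series (\<lambda>j. of_int j * (if even j then sech_coeff s j else 0)) x
      = - fourier_series (\<lambda>n. \<Sum>\<^sub>\<infinity>j. (if odd j then - \<i> * of_real (1 / sinh (of_int j * (s / 2))) else 0)
        * (if odd (n - j) then sech_coeff s (n - j) else 0)) x"
    by (subst CS) (auto simp: cm[symmetric] neg if_distrib cong: if_cong intro!: arg_cong[of _ _ "\<lambda>u. fourier_series u x"])
  then show "(ell_D s has_field_derivative - (ell_S s x * ell_C s x)) (at x)"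
    using has_field_derivative_fourier_series[OF ell_decay(1)[OF s] x]
    unfolding ell_D_def ell_C_def ell_S_def fourier_series_mult[OF ell_decay(3)[OF s] ell_decay(2)[OF s] x] by simp
  have "\<i> * fourier_series (\<lambda>j. of_int j * (if odd j then sech_coeff s j else 0)) x
      = - fourier_series (\<lambda>n. \<Sum>\<^sub>\<infinity>j. (if odd j then - \<i> * of_real (1 / sinh (of_int j * (s / 2))) else 0)
        * (if even (n - j) then sech_coeff s (n - j) else 0)) x"
    by (subst CS) (auto simp: cm[symmetric] neg if_distrib cong: if_cong intro!: arg_cong[of _ _ "\<lambda>u. fourier_series u x"])
  then show "(ell_C s has_field_derivative - (ell_S s x * ell_D s x)) (at x)"
    using has_field_derivative_fourier_series[OF ell_decay(2)[OF s] x]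
    unfolding ell_D_def ell_C_def ell_S_def fourier_series_mult[OF ell_decay(3)[OF s] ell_decay(1)[OF s] x] by simp
  have "\<i> * fourier_series (\<lambda>j. of_int j * (if odd j then - \<i> * of_real (1 / sinh (of_int j * (s / 2))) else 0)) x
      = fourier_series (\<lambda>n. \<Sum>\<^sub>\<infinity>j. (if odd j then sech_coeff s j else 0)
        * (if even (n - j) then sech_coeff s (n - j) else 0)) x"
  proof -
    have e: "\<i> * (of_int j * (- \<i> * z)) = of_int j * z" for j z by (simp add: algebra_simps)
    show ?thesis
      unfolding CD cm[symmetric] if_distrib[of "\<lambda>z. of_int _ * z"] if_distrib[of "\<lambda>z. \<i> * z"] e by (simp only: mult_zero_right)
  qed
  from has_field_derivative_fourier_series[OF ell_decay(3)[OF s] x, unfolded this]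
  show "(ell_S s has_field_derivative ell_C s x * ell_D s x) (at x)"
    unfolding ell_D_def ell_C_def ell_S_def fourier_series_mult[OF ell_decay(2)[OF s] ell_decay(1)[OF s] x] .
qed

lemma exp_int_pi: "exp (\<i> * of_int j * of_real pi) = (if even j then 1 else -1)"
proof (cases "even j")
  case True
  then obtain m where "j = 2 * m" by (elim evenE)
  then show ?thesis using exp_integer_2pi[of "of_int m"] by (simp add: mult_ac)
next
  case False
  then obtain m where "j = 2 * m + 1" by (elim oddE)
  then show ?thesis using exp_integer_2pi_plus1[of "of_int m"] by (simp add: mult_ac)
qed

lemma fourier_series_shift_pi:
  "fourier_series u (x + of_real pi) = fourier_series (\<lambda>j. (if even j then 1 else -1) * u j) x"
  unfolding fourier_series_def
  by (intro infsum_cong) (simp add: distrib_left exp_add exp_int_pi)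

lemma fourier_series_minus: "fourier_series u (- x) = fourier_series (\<lambda>j. u (- j)) x"
  unfolding fourier_series_def
  by (rule infsum_reindex_bij_witness[of _ uminus uminus]) auto

lemma fourier_series_uminus: "fourier_series (\<lambda>j. - u j) x = - fourier_series u x"
  unfolding fourier_series_def by (simp add: infsum_uminus)

lemma ell_shift_pi:
  "ell_C s (x + of_real pi) = - ell_C s x"
  "ell_D s (x + of_real pi) = ell_D s x"
  "ell_S s (x + of_real pi) = - ell_S s x"
  unfolding ell_C_def ell_D_def ell_S_def fourier_series_shift_pi fourier_series_uminus[symmetric]
  by (rule arg_cong[of _ _ "\<lambda>u. fourier_series u x"], force)+

lemma ell_minus:
  "ell_C s (- x) = ell_C s x"
  "ell_D s (- x) = ell_D s x"
  "ell_S s (- x) = - ell_S s x"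
  unfolding ell_C_def ell_D_def ell_S_def fourier_series_minus fourier_series_uminus[symmetric]
  by (rule arg_cong[of _ _ "\<lambda>u. fourier_series u x"], force simp: sech_coeff_def)+

text \<open>With \<open>j = 2 * m\<close>, the even frequencies at \<open>s\<close> are all the
  frequencies at \<open>2 * s\<close> in the variable \<open>2 * x\<close>.\<close>

lemma ell_D_eq_fourier_series: "ell_D s x = fourier_series (sech_coeff (2 * s)) (2 * x)"
proof -
  have "(\<Sum>\<^sub>\<infinity>j. (if even j then sech_coeff s j else 0) * exp (\<i> * of_int j * x))
      = (\<Sum>\<^sub>\<infinity>j\<in>{j. even j}. sech_coeff s j * exp (\<i> * of_int j * x))"
    by (rule infsum_cong_neutral) auto
  also have "\<dots> = (\<Sum>\<^sub>\<infinity>j. sech_coeff (2 * s) j * exp (\<i> * of_int j * (2 * x)))"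
  proof (rule infsum_reindex_bij_witness[of _ "\<lambda>m. 2 * m" "\<lambda>j. j div 2"])
    fix j :: int assume "j \<in> {j. even j}"
    then obtain m where "j = 2 * m" by (auto elim: evenE)
    then show "sech_coeff (2 * s) (j div 2) * exp (\<i> * of_int (j div 2) * (2 * x)) = sech_coeff s j * exp (\<i> * of_int j * x)"
      by (simp add: sech_coeff_def) (simp add: ac_simps)
  qed auto
  finally show ?thesis by (simp add: ell_D_def fourier_series_def)
qed

text \<open>The full series at \<open>2 * s\<close> splits into its even and odd frequencies. This
  is a Landen transformation, since doubling \<open>s\<close> squares the nome.\<close>

lemma ell_D_half_argument:
  assumes "s > 0" "\<bar>Im x\<bar> < s / 2"
  shows "ell_D s x = ell_D (2 * s) (2 * x) + ell_C (2 * s) (2 * x)"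
proof -
  have "\<bar>Im (2 * x)\<bar> < 2 * s / 2" "2 * s > 0" using assms by auto
  note s = fourier_series_summable[OF ell_decay(1)[OF this(2)] this(1)] fourier_series_summable[OF ell_decay(2)[OF this(2)] this(1)]
  have "ell_D (2 * s) (2 * x) + ell_C (2 * s) (2 * x) = fourier_series (sech_coeff (2 * s)) (2 * x)"
    unfolding ell_D_def ell_C_def fourier_series_def infsum_add[OF s, symmetric]
    by (rule infsum_cong) auto
  then show ?thesis by (simp add: ell_D_eq_fourier_series)
qed

lemma exp_plus_exp_minus: "exp (\<i> * z) + exp (- (\<i> * z)) = 2 * cos (z :: complex)"
  by (simp add: cos_exp_eq)

lemma exp_minus_exp_minus: "- (\<i> * exp (\<i> * z)) + \<i> * exp (- (\<i> * z)) = 2 * sin (z :: complex)"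
  by (simp add: sin_exp_eq field_simps)

text \<open>Opposite indices combine to cosines for the symmetric coefficients of \<open>C\<close>
  and \<open>D\<close>, and to sines for the antisymmetric ones of \<open>S\<close>.
  \<open>D\<close> is read off in its form at \<open>2 * s\<close>, whose index runs over all
  integers; the term at index 0 is the constant 1.\<close>

lemma ell_sums:
  assumes s: "s > 0" and x: "\<bar>Im x\<bar> < s / 2"
  shows "(\<lambda>n. 2 * cos (of_nat (2 * Suc n) * x) / of_real (cosh (real (Suc n) * s))) sums (ell_D s x - 1)"
    and "(\<lambda>n. 2 * cos (of_nat (2 * n + 1) * x) / of_real (cosh (real (2 * n + 1) * (s / 2)))) sums ell_C s x"
    and "(\<lambda>n. 2 * sin (of_nat (2 * n + 1) * x) / of_real (sinh (real (2 * n + 1) * (s / 2)))) sums ell_S s x"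
proof -
  have "\<bar>Im (2 * x)\<bar> < 2 * s / 2" "2 * s > 0" using assms by auto
  note sD = fourier_series_summable[OF exp_decay_sech[OF this(2)] this(1)]
  have tD: "sech_coeff (2 * s) (int (Suc n)) * exp (\<i> * of_int (int (Suc n)) * (2 * x))
      + sech_coeff (2 * s) (- int (Suc n)) * exp (\<i> * of_int (- int (Suc n)) * (2 * x))
      = 2 * cos (of_nat (2 * Suc n) * x) / of_real (cosh (real (Suc n) * s))" for n
  proof -
    have "sech_coeff (2 * s) (- int (Suc n)) = sech_coeff (2 * s) (int (Suc n))"
      by (simp add: sech_coeff_def flip: minus_add_distrib minus_mult_left)
    moreover have "sech_coeff (2 * s) (int (Suc n)) = 1 / of_real (cosh (real (Suc n) * s))"
      by (simp add: sech_coeff_def)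
    moreover have "exp (\<i> * of_int (int (Suc n)) * (2 * x)) + exp (\<i> * of_int (- int (Suc n)) * (2 * x)) = 2 * cos (of_nat (2 * Suc n) * x)"
      using exp_plus_exp_minus[of "of_nat (2 * Suc n) * x"] by (simp add: algebra_simps)
    ultimately show ?thesis by (simp only: flip: distrib_left) simp
  qed
  show "(\<lambda>n. 2 * cos (of_nat (2 * Suc n) * x) / of_real (cosh (real (Suc n) * s))) sums (ell_D s x - 1)"
    using infsum_int_sums[OF sD] unfolding tD fourier_series_def[symmetric] ell_D_eq_fourier_series[symmetric]
    by (simp add: sech_coeff_def)
  note sC = fourier_series_summable[OF ell_decay(2)[OF s] x]
  have tC: "(if odd (int (2 * n + 1)) then sech_coeff s (int (2 * n + 1)) else 0) * exp (\<i> * of_int (int (2 * n + 1)) * x)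
      + (if odd (- int (2 * n + 1)) then sech_coeff s (- int (2 * n + 1)) else 0) * exp (\<i> * of_int (- int (2 * n + 1)) * x)
      = 2 * cos (of_nat (2 * n + 1) * x) / of_real (cosh (real (2 * n + 1) * (s / 2)))" for n
  proof -
    have 1: "sech_coeff s (- int (2 * n + 1)) = sech_coeff s (int (2 * n + 1))"
      unfolding sech_coeff_def of_int_minus minus_mult_left[symmetric] cosh_minus ..
    have 2: "sech_coeff s (int (2 * n + 1)) = 1 / of_real (cosh (real (2 * n + 1) * (s / 2)))"
      by (simp add: sech_coeff_def)
    have "exp (\<i> * of_int (int (2 * n + 1)) * x) + exp (\<i> * of_int (- int (2 * n + 1)) * x) = 2 * cos (of_nat (2 * n + 1) * x)"
      using exp_plus_exp_minus[of "of_nat (2 * n + 1) * x"] by (simp add: algebra_simps)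
    moreover have "odd (int (2 * n + 1))" "odd (- int (2 * n + 1))" by auto
    ultimately show ?thesis by (simp only: if_True 1 2 flip: distrib_left) simp
  qed
  show "(\<lambda>n. 2 * cos (of_nat (2 * n + 1) * x) / of_real (cosh (real (2 * n + 1) * (s / 2)))) sums ell_C s x"
    using infsum_odd_int_sums[OF sC] unfolding tC fourier_series_def[symmetric] ell_C_def[symmetric]
    by simp
  note sS = fourier_series_summable[OF ell_decay(3)[OF s] x]
  have tS: "(if odd (int (2 * n + 1)) then - \<i> * of_real (1 / sinh (of_int (int (2 * n + 1)) * (s / 2))) else 0) * exp (\<i> * of_int (int (2 * n + 1)) * x)
      + (if odd (- int (2 * n + 1)) then - \<i> * of_real (1 / sinh (of_int (- int (2 * n + 1)) * (s / 2))) else 0) * exp (\<i> * of_int (- int (2 * n + 1)) * x)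
      = 2 * sin (of_nat (2 * n + 1) * x) / of_real (sinh (real (2 * n + 1) * (s / 2)))" for n
  proof -
    define e where "e = of_real (1 / sinh (real (2 * n + 1) * (s / 2))) * complex_of_real 1"
    have 1: "complex_of_real (1 / sinh (of_int (- int (2 * n + 1)) * (s / 2))) = - e"
      unfolding e_def of_int_minus minus_mult_left[symmetric] sinh_minus by simp
    have 2: "complex_of_real (1 / sinh (of_int (int (2 * n + 1)) * (s / 2))) = e"
      by (simp add: e_def)
    have "- (\<i> * exp (\<i> * of_int (int (2 * n + 1)) * x)) + \<i> * exp (\<i> * of_int (- int (2 * n + 1)) * x) = 2 * sin (of_nat (2 * n + 1) * x)"
      using exp_minus_exp_minus[of "of_nat (2 * n + 1) * x"] by (simp add: algebra_simps)
    moreover have "odd (int (2 * n + 1))" "odd (- int (2 * n + 1))" by auto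
    moreover have "- \<i> * e * a + - \<i> * - e * b = (- (\<i> * a) + \<i> * b) * e" for a b
      by (simp add: algebra_simps)
    ultimately have "(if odd (int (2 * n + 1)) then - \<i> * of_real (1 / sinh (of_int (int (2 * n + 1)) * (s / 2))) else 0) * exp (\<i> * of_int (int (2 * n + 1)) * x)
      + (if odd (- int (2 * n + 1)) then - \<i> * of_real (1 / sinh (of_int (- int (2 * n + 1)) * (s / 2))) else 0) * exp (\<i> * of_int (- int (2 * n + 1)) * x)
      = 2 * sin (of_nat (2 * n + 1) * x) * e"
      by (simp only: if_True not_False_eq_True 1 2)
    also have "\<dots> = 2 * sin (of_nat (2 * n + 1) * x) / of_real (sinh (real (2 * n + 1) * (s / 2)))"
      unfolding e_def of_real_divide of_real_1 mult_1_right times_divide_eq_right ..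
    finally show ?thesis .
  qed
  show "(\<lambda>n. 2 * sin (of_nat (2 * n + 1) * x) / of_real (sinh (real (2 * n + 1) * (s / 2)))) sums ell_S s x"
    using infsum_odd_int_sums[OF sS] unfolding tS fourier_series_def[symmetric] ell_S_def[symmetric]
    by simp
qed

section \<open>Quadratic relations and reality\<close>

lemma strip_constant:
  assumes "\<And>y. \<bar>Im y\<bar> < \<rho> \<Longrightarrow> (f has_field_derivative 0) (at y)" "\<bar>Im x\<bar> < \<rho>"
  shows "f x = f (0::complex)"
proof -
  have alt: "{y. \<bar>Im y\<bar> < \<rho>} = {y. Im y < \<rho>} \<inter> {y. Im y > - \<rho>}" by auto
  have "convex {y. \<bar>Im y\<bar> < \<rho>}"
    unfolding alt by (intro convex_Int convex_halfspace_Im_lt convex_halfspace_Im_gt)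
  then obtain c where "\<And>y. \<bar>Im y\<bar> < \<rho> \<Longrightarrow> f y = c"
    using has_field_derivative_zero_constant[of "{y. \<bar>Im y\<bar> < \<rho>}" f] assms(1)
    by (auto intro: has_field_derivative_at_within)
  then show ?thesis using assms(2) by simp
qed

lemma ell_S_0 [simp]: "ell_S s 0 = 0"
  using ell_minus(3)[of s 0] by simp

lemma ell_quadratic_relations:
  assumes s: "s > 0" and x: "\<bar>Im x\<bar> < s / 2"
  shows "ell_S s x ^ 2 + ell_C s x ^ 2 = ell_C s 0 ^ 2"
    and "ell_S s x ^ 2 + ell_D s x ^ 2 = ell_D s 0 ^ 2"
proof -
  have "((\<lambda>x. ell_S s x ^ 2 + ell_C s x ^ 2) has_field_derivative 0) (at y)" if y: "\<bar>Im y\<bar> < s / 2" for y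
    by (rule derivative_eq_intros ell_deriv[OF s y] refl)+ (simp add: algebra_simps)
  moreover have "((\<lambda>x. ell_S s x ^ 2 + ell_D s x ^ 2) has_field_derivative 0) (at y)" if y: "\<bar>Im y\<bar> < s / 2" for y
    by (rule derivative_eq_intros ell_deriv[OF s y] refl)+ (simp add: algebra_simps)
  ultimately show "ell_S s x ^ 2 + ell_C s x ^ 2 = ell_C s 0 ^ 2" "ell_S s x ^ 2 + ell_D s x ^ 2 = ell_D s 0 ^ 2"
    using strip_constant[of "s / 2" "\<lambda>x. ell_S s x ^ 2 + ell_C s x ^ 2", OF _ x]
      strip_constant[of "s / 2" "\<lambda>x. ell_S s x ^ 2 + ell_D s x ^ 2", OF _ x] by simp_all
qed

text \<open>Differentiating the two summands of the half-argument formula gives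
  \<open>- 2 * ell_S (2 * s) (2 * x)\<close> times the sum of the same two functions in exchanged
  order. So \<open>D\<close> solves a linear equation, although the original system is
  quadratic.\<close>

lemma ell_D_log_deriv:
  assumes s: "s > 0" and x: "\<bar>Im x\<bar> < s / 2"
  shows "(ell_D s has_field_derivative - (2 * ell_S (2 * s) (2 * x) * ell_D s x)) (at x)"
proof -
  have alt: "{y. \<bar>Im y\<bar> < s / 2} = {y. Im y < s / 2} \<inter> {y. Im y > - (s / 2)}" by auto
  have op: "open {y. \<bar>Im y\<bar> < s / 2}"
    unfolding alt by (intro open_Int open_halfspace_Im_lt open_halfspace_Im_gt)
  have s2: "2 * s > 0" and x2: "\<bar>Im (2 * x)\<bar> < 2 * s / 2" using s x by auto
  have m: "((\<lambda>x. 2 * x) has_field_derivative 2) (at x)" by (auto intro!: derivative_eq_intros)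
  have "((\<lambda>y. ell_D (2 * s) (2 * y) + ell_C (2 * s) (2 * y)) has_field_derivative
      - (ell_S (2 * s) (2 * x) * ell_C (2 * s) (2 * x)) * 2 + - (ell_S (2 * s) (2 * x) * ell_D (2 * s) (2 * x)) * 2) (at x)"
    by (intro DERIV_add DERIV_chain2[OF ell_deriv(1)[OF s2 x2] m] DERIV_chain2[OF ell_deriv(2)[OF s2 x2] m])
  then have "(ell_D s has_field_derivative
      - (ell_S (2 * s) (2 * x) * ell_C (2 * s) (2 * x)) * 2 + - (ell_S (2 * s) (2 * x) * ell_D (2 * s) (2 * x)) * 2) (at x)"
    by (rule has_field_derivative_transform_within_open[OF _ op]) (use x in \<open>auto simp: ell_D_half_argument[OF s]\<close>)
  then show ?thesis by (simp add: ell_D_half_argument[OF s x] algebra_simps)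
qed

text \<open>A shift of \<open>x\<close> by \<open>pi / 2\<close> moves \<open>2 * x\<close> by
  \<open>pi\<close> and changes the sign of \<open>ell_S (2 * s)\<close>, so the two logarithmic
  derivatives cancel. Classically this is \<open>dn (u + K) = k' / dn u\<close>.\<close>

lemma ell_D_mult_shift:
  assumes s: "s > 0" and x: "\<bar>Im x\<bar> < s / 2"
  shows "ell_D s x * ell_D s (x + of_real (pi / 2)) = ell_D s 0 * ell_D s (of_real (pi / 2))"
proof -
  have "((\<lambda>x. ell_D s x * ell_D s (x + of_real (pi / 2))) has_field_derivative 0) (at y)" if y: "\<bar>Im y\<bar> < s / 2" for y
  proof -
    have y': "\<bar>Im (y + of_real (pi / 2))\<bar> < s / 2" using y by simp
    have S: "ell_S (2 * s) (2 * (y + of_real (pi / 2))) = - ell_S (2 * s) (2 * y)"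
      using ell_shift_pi(3)[of "2 * s" "2 * y"] by (simp add: algebra_simps)
    have a: "((\<lambda>x. x + of_real (pi / 2)) has_field_derivative 1) (at y)" by (auto intro!: derivative_eq_intros)
    show ?thesis
      by (rule DERIV_cong[OF DERIV_mult[OF ell_D_log_deriv[OF s y] DERIV_chain2[OF ell_D_log_deriv[OF s y'] a]]])
        (simp only: S, simp)
  qed
  then show ?thesis
    using strip_constant[of "s / 2" "\<lambda>x. ell_D s x * ell_D s (x + of_real (pi / 2))", OF _ x] by simp
qed

text \<open>The cosine and sine series have real coefficients, so taking \<open>Re\<close> on the
  real axis loses nothing; \<open>of_real_jac\<close> records this.\<close>

definition jac_C :: "real \<Rightarrow> real \<Rightarrow> real" where "jac_C s x = Re (ell_C s (of_real x))"
definition jac_D :: "real \<Rightarrow> real \<Rightarrow> real" where "jac_D s x = Re (ell_D s (of_real x))"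
definition jac_S :: "real \<Rightarrow> real \<Rightarrow> real" where "jac_S s x = Re (ell_S s (of_real x))"

lemma sums_of_real_imp_of_real_Re:
  assumes "(\<lambda>n. complex_of_real (f n)) sums z"
  shows "z = of_real (Re z)" "f sums Re z"
proof -
  show "f sums Re z" using sums_Re[OF assms] by simp
  have "(\<lambda>n. 0) sums Im z" using sums_Im[OF assms] by simp
  then have "Im z = 0" by (simp add: sums_iff)
  then show "z = of_real (Re z)" by (simp add: complex_eq_iff)
qed

text \<open>Stated with \<open>s\<close> as a variable because the positivity of
  \<open>jac_D s\<close> needs it at \<open>2 * s\<close>.\<close>

lemma jac_S_continuous:
  assumes "s > 0" shows "continuous_on A (jac_S s)"
proof (rule continuous_at_imp_continuous_on, rule ballI)
  fix x
  have "isCont (ell_S s) (complex_of_real x)"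
    by (rule DERIV_isCont[OF ell_deriv(3)]) (use assms in auto)
  then have "isCont (\<lambda>x. ell_S s (complex_of_real x)) x"
    by (rule isCont_o2[OF continuous_of_real[OF continuous_ident]])
  then have "isCont (\<lambda>x. Re (ell_S s (complex_of_real x))) x"
    by (rule continuous_Re)
  then show "isCont (jac_S s) x" by (simp add: jac_S_def[abs_def])
qed

context
  fixes s :: real
  assumes s: "s > 0"
begin

lemma jac_sums:
  "(\<lambda>n. 2 * cos (real (2 * Suc n) * x) / cosh (real (Suc n) * s)) sums (jac_D s x - 1)"
  "(\<lambda>n. 2 * cos (real (2 * n + 1) * x) / cosh (real (2 * n + 1) * (s / 2))) sums jac_C s x"
  "(\<lambda>n. 2 * sin (real (2 * n + 1) * x) / sinh (real (2 * n + 1) * (s / 2))) sums jac_S s x"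
  and of_real_jac:
  "complex_of_real (jac_D s x) = ell_D s (of_real x)"
  "complex_of_real (jac_C s x) = ell_C s (of_real x)"
  "complex_of_real (jac_S s x) = ell_S s (of_real x)"
proof -
  have x: "\<bar>Im (of_real x)\<bar> < s / 2" using s by simp
  have eq: "2 * cos (of_nat k * complex_of_real x) / of_real r = complex_of_real (2 * cos (real k * x) / r)"
     "2 * sin (of_nat k * complex_of_real x) / of_real r = complex_of_real (2 * sin (real k * x) / r)" for k r
    by (simp_all add: cos_of_real[symmetric] sin_of_real[symmetric])
  note * = sums_of_real_imp_of_real_Re[OF ell_sums(1)[OF s x, unfolded eq]]
      sums_of_real_imp_of_real_Re[OF ell_sums(2)[OF s x, unfolded eq]]
      sums_of_real_imp_of_real_Re[OF ell_sums(3)[OF s x, unfolded eq]]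
  show "(\<lambda>n. 2 * cos (real (2 * Suc n) * x) / cosh (real (Suc n) * s)) sums (jac_D s x - 1)"
    using *(2) by (simp add: jac_D_def)
  show "(\<lambda>n. 2 * cos (real (2 * n + 1) * x) / cosh (real (2 * n + 1) * (s / 2))) sums jac_C s x"
    using *(4) by (simp add: jac_C_def)
  show "(\<lambda>n. 2 * sin (real (2 * n + 1) * x) / sinh (real (2 * n + 1) * (s / 2))) sums jac_S s x"
    using *(6) by (simp add: jac_S_def)
  show "complex_of_real (jac_D s x) = ell_D s (of_real x)"
    using *(1) by (simp add: jac_D_def complex_eq_iff)
  show "complex_of_real (jac_C s x) = ell_C s (of_real x)"
    using *(3) by (simp add: jac_C_def complex_eq_iff)
  show "complex_of_real (jac_S s x) = ell_S s (of_real x)"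
    using *(5) by (simp add: jac_S_def complex_eq_iff)
qed

lemma jac_deriv:
  "(jac_D s has_real_derivative - (jac_S s x * jac_C s x)) (at x within A)"
  "(jac_C s has_real_derivative - (jac_S s x * jac_D s x)) (at x within A)"
  "(jac_S s has_real_derivative jac_C s x * jac_D s x) (at x within A)"
  "(jac_D s has_real_derivative - (2 * jac_S (2 * s) (2 * x) * jac_D s x)) (at x within A)"
proof -
  have x: "\<bar>Im (of_real x)\<bar> < s / 2" using s by simp
  have d: "((\<lambda>x. Re (f (of_real x))) has_real_derivative r) (at x within A)"
    if "(f has_field_derivative z) (at (of_real x))" "z = of_real r" for f z r
    using has_field_derivative_Re[OF has_vector_derivative_real_field[OF that(1)]] that(2) by simp
  \<comment> \<open>\<open>of_real_jac\<close> speaks of the fixed \<open>s\<close> only, so reality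
    at \<open>2 * s\<close> is read off from the sine series once more.\<close>
  have 2: "complex_of_real (jac_S (2 * s) (2 * x)) = ell_S (2 * s) (2 * of_real x)"
  proof -
    have "\<bar>Im (of_real (2 * x))\<bar> < 2 * s / 2" using s by simp
    have eq: "2 * sin (of_nat k * complex_of_real (2 * x)) / of_real r = complex_of_real (2 * sin (real k * (2 * x)) / r)" for k r
      by (simp add: sin_of_real[symmetric])
    show ?thesis
      using sums_of_real_imp_of_real_Re(1)[OF ell_sums(3)[of "2 * s" "of_real (2 * x)", unfolded eq]] s
      by (simp add: jac_S_def)
  qed
  show "(jac_D s has_real_derivative - (jac_S s x * jac_C s x)) (at x within A)"
    unfolding jac_D_def[abs_def] by (rule d[OF ell_deriv(1)[OF s x]]) (simp add: of_real_jac)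
  show "(jac_C s has_real_derivative - (jac_S s x * jac_D s x)) (at x within A)"
    unfolding jac_C_def[abs_def] by (rule d[OF ell_deriv(2)[OF s x]]) (simp add: of_real_jac)
  show "(jac_S s has_real_derivative jac_C s x * jac_D s x) (at x within A)"
    unfolding jac_S_def[abs_def] by (rule d[OF ell_deriv(3)[OF s x]]) (simp add: of_real_jac)
  show "(jac_D s has_real_derivative - (2 * jac_S (2 * s) (2 * x) * jac_D s x)) (at x within A)"
    unfolding jac_D_def[abs_def] by (rule d[OF ell_D_log_deriv[OF s x]]) (simp add: of_real_jac[unfolded jac_D_def] 2)
qed

lemma continuous_on_jac:
  "continuous_on A (jac_D s)" "continuous_on A (jac_C s)" "continuous_on A (jac_S s)"
  by (rule DERIV_continuous_on[OF jac_deriv(1)] DERIV_continuous_on[OF jac_deriv(2)] DERIV_continuous_on[OF jac_deriv(3)])+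

lemma jac_symmetries:
  "jac_D s (- x) = jac_D s x" "jac_C s (- x) = jac_C s x" "jac_S s (- x) = - jac_S s x"
  "jac_D s (x + pi) = jac_D s x" "jac_C s (x + pi) = - jac_C s x" "jac_S s (x + pi) = - jac_S s x"
  by (simp_all add: jac_D_def jac_C_def jac_S_def ell_minus ell_shift_pi)

lemma jac_S_0 [simp]: "jac_S s 0 = 0"
  by (simp add: jac_S_def)

lemma jac_C_half_pi [simp]: "jac_C s (pi / 2) = 0"
  using jac_symmetries(5)[of "- (pi / 2)"] jac_symmetries(2)[of "pi / 2"] by simp

lemma jac_quadratic_relations:
  "jac_S s x ^ 2 + jac_C s x ^ 2 = jac_C s 0 ^ 2"
  "jac_S s x ^ 2 + jac_D s x ^ 2 = jac_D s 0 ^ 2"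
proof -
  have x: "\<bar>Im (of_real x)\<bar> < s / 2" using s by simp
  have "complex_of_real (jac_S s x ^ 2 + jac_C s x ^ 2) = complex_of_real (jac_C s 0 ^ 2)"
    using ell_quadratic_relations(1)[OF s x] by (simp add: of_real_jac)
  then show "jac_S s x ^ 2 + jac_C s x ^ 2 = jac_C s 0 ^ 2" unfolding of_real_eq_iff .
  have "complex_of_real (jac_S s x ^ 2 + jac_D s x ^ 2) = complex_of_real (jac_D s 0 ^ 2)"
    using ell_quadratic_relations(2)[OF s x] by (simp add: of_real_jac)
  then show "jac_S s x ^ 2 + jac_D s x ^ 2 = jac_D s 0 ^ 2" unfolding of_real_eq_iff .
qed

lemma jac_D_mult_shift: "jac_D s x * jac_D s (x + pi / 2) = jac_D s 0 * jac_D s (pi / 2)"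
proof -
  have x: "\<bar>Im (of_real x)\<bar> < s / 2" using s by simp
  have "complex_of_real (jac_D s x * jac_D s (x + pi / 2)) = complex_of_real (jac_D s 0 * jac_D s (pi / 2))"
    using ell_D_mult_shift[OF s x] by (simp add: of_real_jac)
  then show ?thesis unfolding of_real_eq_iff .
qed

lemma jac_C_0_pos: "jac_C s 0 > 0"
proof -
  have "0 < (\<Sum>n. 2 * cos (real (2 * n + 1) * 0) / cosh (real (2 * n + 1) * (s / 2)))"
    by (rule suminf_pos) (use jac_sums(2)[of 0] in \<open>auto simp: sums_iff cosh_real_pos\<close>)
  then show ?thesis using jac_sums(2)[of 0] by (simp add: sums_iff)
qed

lemma jac_D_0_pos: "jac_D s 0 > 0"
proof -
  have "0 < (\<Sum>n. 2 * cos (real (2 * Suc n) * 0) / cosh (real (Suc n) * s))"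
    by (rule suminf_pos) (use jac_sums(1)[of 0] in \<open>auto simp: sums_iff cosh_real_pos\<close>)
  then show ?thesis using jac_sums(1)[of 0] by (simp add: sums_iff)
qed

text \<open>The linear equation \<open>D' = - 2 S_2s(2 t) D\<close> has the integrating factor
  \<open>exp (g t)\<close>, so \<open>D\<close> keeps the sign it has at 0; evenness covers negative
  \<open>x\<close>.\<close>

lemma jac_D_pos: "jac_D s x > 0"
proof -
  have pos: "jac_D s x > 0" if "x \<ge> 0" for x
  proof -
    have "continuous_on {0..x} (\<lambda>t. 2 * jac_S (2 * s) (2 * t))"
      by (intro continuous_intros continuous_on_compose2[OF jac_S_continuous[of "2 * s"]]) (use s in auto)
    then obtain g where g: "\<And>t. t \<in> {0..x} \<Longrightarrow> (g has_real_derivative 2 * jac_S (2 * s) (2 * t)) (at t within {0..x})"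
      using antiderivative_continuous[of 0 x] by (metis has_real_derivative_iff_has_vector_derivative)
    have "((\<lambda>t. jac_D s t * exp (g t)) has_real_derivative 0) (at t within {0..x})" if "t \<in> {0..x}" for t
      by (rule derivative_eq_intros jac_deriv(4) g[OF that] refl)+ (simp add: algebra_simps)
    then have "jac_D s x * exp (g x) = jac_D s 0 * exp (g 0)"
      using has_field_derivative_zero_constant[of "{0..x}" "\<lambda>t. jac_D s t * exp (g t)"] that by fastforce
    moreover have "jac_D s 0 * exp (g 0) > 0" using jac_D_0_pos by simp
    ultimately have "jac_D s x * exp (g x) > 0" by simp
    then show ?thesis by (simp add: zero_less_mult_iff)
  qed
  show ?thesis using pos[of x] pos[of "- x"] jac_symmetries(1)[of x] by (cases "x \<ge> 0") auto
qed

text \<open>At \<open>pi / 2\<close> the function \<open>C\<close> vanishes, so the two quadratic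
  relations give \<open>D (pi / 2)\<^sup>2 = D 0\<^sup>2 - C 0\<^sup>2\<close>, and the left side is
  positive.\<close>

lemma jac_C_less_jac_D: "jac_C s 0 < jac_D s 0"
proof -
  have "jac_D s (pi / 2) ^ 2 = jac_D s 0 ^ 2 - jac_C s 0 ^ 2"
    using jac_quadratic_relations[of "pi / 2"] by simp
  moreover have "jac_D s (pi / 2) ^ 2 > 0" using jac_D_pos[of "pi / 2"] by simp
  ultimately have "jac_C s 0 ^ 2 < jac_D s 0 ^ 2" by linarith
  then show ?thesis using jac_D_0_pos power2_less_imp_less by fastforce
qed

end

section \<open>The complete elliptic integral\<close>

lemma has_integral_sums_uniform:
  fixes f :: "nat \<Rightarrow> real \<Rightarrow> real"
  assumes cont: "\<And>n. continuous_on {a..b} (f n)"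
    and bound: "\<And>n x. x \<in> {a..b} \<Longrightarrow> \<bar>f n x\<bar> \<le> B n" and B: "summable B"
    and sums: "\<And>x. x \<in> {a..b} \<Longrightarrow> (\<lambda>n. f n x) sums g x"
    and int: "\<And>n. (f n has_integral I n) {a..b}"
  shows "continuous_on {a..b} g" "I sums integral {a..b} g"
proof -
  have u: "uniform_limit {a..b} (\<lambda>n x. \<Sum>i<n. f i x) g sequentially"
    using uniform_limit_cong'[THEN iffD1, OF _ _ Weierstrass_m_test[of "{a..b}" f B]] bound B sums
    by (auto simp: sums_iff)
  have c: "continuous_on {a..b} (\<lambda>x. \<Sum>i<n. f i x)" for n
    by (intro continuous_on_sum cont)
  show "continuous_on {a..b} g"
    by (rule uniform_limit_theorem[OF _ u]) (simp_all add: c)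
  obtain I' J where I': "\<And>n. ((\<lambda>x. \<Sum>i<n. f i x) has_integral I' n) {a..b}" "(g has_integral J) {a..b}" "I' \<longlonglongrightarrow> J"
    using uniform_limit_integral[OF u c] by (metis sequentially_bot)
  have "((\<lambda>x. \<Sum>i<n. f i x) has_integral (\<Sum>i<n. I i)) {a..b}" for n
    by (intro has_integral_sum) (auto intro: int)
  then have eq: "I' = (\<lambda>n. \<Sum>i<n. I i)" using I'(1) has_integral_unique by blast
  then show "I sums integral {a..b} g" using I'(2,3) by (simp add: eq sums_def integral_unique)
qed

text \<open>\<open>N + M\<close> and \<open>N - M\<close> are odd integers. Hence they are nonzero,
  and the antiderivative obtained from the product-to-sum formula vanishes at \<open>pi / 2\<close>;
  only its value at 0 remains.\<close>

lemma sin_cos_has_integral: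
  fixes n m :: nat
  defines "N \<equiv> real (2 * n + 1)" and "M \<equiv> real (2 * m)"
  shows "((\<lambda>x. sin (N * x) * cos (M * x)) has_integral N / (N\<^sup>2 - M\<^sup>2)) {0..pi / 2}"
proof -
  define F where "F x = - (cos ((N + M) * x) / (N + M) + cos ((N - M) * x) / (N - M)) / 2" for x
  have "2 * int n + 1 \<noteq> 2 * int m" by presburger
  then have "real_of_int (2 * int n + 1) \<noteq> real_of_int (2 * int m)" by (simp only: of_int_eq_iff not_False_eq_True)
  then have ne: "N + M > 0" "N - M \<noteq> 0" by (auto simp: N_def M_def)
  have d: "(F has_real_derivative sin (N * x) * cos (M * x)) (at x within {0..pi/2})" for x
  proof -
    have "(F has_real_derivative (sin ((N + M) * x) + sin ((N - M) * x)) / 2) (at x within {0..pi/2})"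
    proof -
      have "((\<lambda>x. - (cos (A * x) / A + cos (B * x) / B) / 2) has_real_derivative (sin (A * x) + sin (B * x)) / 2) (at x within {0..pi/2})"
        if "A \<noteq> 0" "B \<noteq> 0" for A B :: real
        by (rule derivative_eq_intros refl that)+ (use that in \<open>simp_all add: add_divide_distrib\<close>)
      from this[of "N + M" "N - M"] show ?thesis using ne by (simp add: F_def[abs_def])
    qed
    moreover have "(sin ((N + M) * x) + sin ((N - M) * x)) / 2 = sin (N * x) * cos (M * x)"
      by (simp add: distrib_right left_diff_distrib sin_add sin_diff)
    ultimately show ?thesis by simp
  qed
  have z: "cos (real_of_int (2 * j + 1) * (pi / 2)) = 0" for j
    using cos_zero_iff_int by (metis even_add even_mult_iff odd_one even_numeral)
  have "F (pi / 2) = 0"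
    using z[of "int n + int m"] z[of "int n - int m"] by (simp add: F_def N_def M_def algebra_simps)
  moreover have "F 0 = - (N / (N\<^sup>2 - M\<^sup>2))"
  proof -
    have "(N + M) * (N - M) = N\<^sup>2 - M\<^sup>2" by (simp add: algebra_simps power2_eq_square)
    moreover have "1 / (N + M) + 1 / (N - M) = 2 * (N / ((N + M) * (N - M)))" using ne by (simp add: field_simps)
    ultimately have "1 / (N + M) + 1 / (N - M) = 2 * (N / (N\<^sup>2 - M\<^sup>2))" by (simp only:)
    moreover have "F 0 = - ((1 / (N + M) + 1 / (N - M)) / 2)"
      by (simp only: F_def mult_zero_right cos_zero minus_divide_left)
    ultimately show ?thesis by (simp only: nonzero_mult_div_cancel_left[of 2] zero_neq_numeral not_sym)
  qed
  moreover have "((\<lambda>x. sin (N * x) * cos (M * x)) has_integral F (pi / 2) - F 0) {0..pi / 2}"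
    using d by (intro fundamental_theorem_of_calculus) (auto simp: has_real_derivative_iff_has_vector_derivative)
  ultimately show ?thesis by simp
qed

text \<open>For fixed \<open>n\<close> the cosine series of \<open>g\<close> is integrated against
  one sine, and only afterwards is the sum over \<open>n\<close> taken, so the double sum appears in
  iterated form. The term \<open>1 / real (2 * n + 1)\<close> is the contribution of the constant
  term 1 of \<open>g\<close>.\<close>

lemma integral_sine_cosine_series:
  fixes a b :: "nat \<Rightarrow> real"
  assumes a: "summable (\<lambda>n. \<bar>a n\<bar>)" and b: "summable (\<lambda>n. \<bar>b n\<bar>)"
    and f: "\<And>x. x \<in> {0..pi/2} \<Longrightarrow> (\<lambda>n. a n * sin (real (2 * n + 1) * x)) sums f x"
    and g: "\<And>x. x \<in> {0..pi/2} \<Longrightarrow> (\<lambda>m. b m * cos (real (2 * Suc m) * x)) sums (g x - 1)"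
  shows "(\<lambda>n. a n * (1 / real (2 * n + 1) + (\<Sum>m. b m * (real (2 * n + 1) / (real (2 * n + 1) ^ 2 - real (2 * Suc m) ^ 2)))))
      sums integral {0..pi/2} (\<lambda>x. f x * g x)"
proof -
  have g1: "(\<lambda>m. b m * cos (real (2 * Suc m) * x)) sums (g x - 1)"
    "\<bar>g x - 1\<bar> \<le> (\<Sum>m. \<bar>b m\<bar>)" if "x \<in> {0..pi/2}" for x
  proof -
    show s: "(\<lambda>m. b m * cos (real (2 * Suc m) * x)) sums (g x - 1)" by (rule g[OF that])
    have "norm (\<Sum>m. b m * cos (real (2 * Suc m) * x)) \<le> (\<Sum>m. \<bar>b m\<bar>)"
    proof (rule norm_suminf_le[OF _ b])
      show "norm (b m * cos (real (2 * Suc m) * x)) \<le> \<bar>b m\<bar>" for m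
        by (simp only: real_norm_def abs_mult mult_left_le abs_cos_le_one abs_ge_zero)
    qed
    then show "\<bar>g x - 1\<bar> \<le> (\<Sum>m. \<bar>b m\<bar>)" using s by (simp add: sums_iff)
  qed
  have contg1: "continuous_on {0..pi/2} (\<lambda>x. g x - 1)"
  proof (rule has_integral_sums_uniform(1)[where f = "\<lambda>m x. b m * cos (real (2 * Suc m) * x)"
        and I = "\<lambda>m. integral {0..pi/2} (\<lambda>x. b m * cos (real (2 * Suc m) * x))"])
    show "\<bar>b m * cos (real (2 * Suc m) * x)\<bar> \<le> \<bar>b m\<bar>" for m x
      by (simp only: abs_mult mult_left_le abs_cos_le_one abs_ge_zero)
    show "((\<lambda>x. b m * cos (real (2 * Suc m) * x)) has_integral integral {0..pi/2} (\<lambda>x. b m * cos (real (2 * Suc m) * x))) {0..pi/2}" for m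
      by (intro integrable_integral integrable_continuous_real continuous_intros)
  qed (rule b g1(1) continuous_intros | assumption)+
  then have contg: "continuous_on {0..pi/2} g"
    using continuous_on_add[OF contg1 continuous_on_const[of _ 1]] by simp
  define I where "I n = 1 / real (2 * n + 1) + (\<Sum>m. b m * (real (2 * n + 1) / (real (2 * n + 1) ^ 2 - real (2 * Suc m) ^ 2)))" for n
  have I: "((\<lambda>x. sin (real (2 * n + 1) * x) * g x) has_integral I n) {0..pi/2}" for n
  proof -
    have "(\<lambda>m. b m * (real (2 * n + 1) / (real (2 * n + 1) ^ 2 - real (2 * Suc m) ^ 2)))
        sums integral {0..pi/2} (\<lambda>x. sin (real (2 * n + 1) * x) * (g x - 1))"
    proof (rule has_integral_sums_uniform(2)[where f = "\<lambda>m x. b m * (sin (real (2 * n + 1) * x) * cos (real (2 * Suc m) * x))" and B = "\<lambda>m. \<bar>b m\<bar>"])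
      show "\<bar>b m * (sin (real (2 * n + 1) * x) * cos (real (2 * Suc m) * x))\<bar> \<le> \<bar>b m\<bar>" for m x
      proof -
        have "\<bar>sin (real (2 * n + 1) * x)\<bar> * \<bar>cos (real (2 * Suc m) * x)\<bar> \<le> 1 * 1"
          by (intro mult_mono) (auto simp del: of_nat_mult of_nat_Suc of_nat_add)
        then show ?thesis unfolding abs_mult using mult_left_le by fastforce
      qed
      show "(\<lambda>m. b m * (sin (real (2 * n + 1) * x) * cos (real (2 * Suc m) * x))) sums (sin (real (2 * n + 1) * x) * (g x - 1))"
        if "x \<in> {0..pi/2}" for x
        using sums_mult[OF g1(1)[OF that], of "sin (real (2 * n + 1) * x)"] by (simp only: mult.left_commute)
      show "((\<lambda>x. b m * (sin (real (2 * n + 1) * x) * cos (real (2 * Suc m) * x))) has_integral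
          b m * (real (2 * n + 1) / (real (2 * n + 1) ^ 2 - real (2 * Suc m) ^ 2))) {0..pi/2}" for m
        by (intro has_integral_mult_right sin_cos_has_integral)
    qed (auto intro!: b continuous_intros)
    then have "integral {0..pi/2} (\<lambda>x. sin (real (2 * n + 1) * x) * (g x - 1))
        = (\<Sum>m. b m * (real (2 * n + 1) / (real (2 * n + 1) ^ 2 - real (2 * Suc m) ^ 2)))"
      by (simp add: sums_iff)
    moreover have "(\<lambda>x. sin (real (2 * n + 1) * x) * (g x - 1)) integrable_on {0..pi/2}"
      by (intro integrable_continuous_real continuous_intros contg)
    ultimately have "((\<lambda>x. sin (real (2 * n + 1) * x) * (g x - 1)) has_integral
        (\<Sum>m. b m * (real (2 * n + 1) / (real (2 * n + 1) ^ 2 - real (2 * Suc m) ^ 2)))) {0..pi/2}"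
      using integrable_integral by fastforce
    moreover have "((\<lambda>x. sin (real (2 * n + 1) * x)) has_integral 1 / real (2 * n + 1)) {0..pi/2}"
      using sin_cos_has_integral[of n 0] by (simp add: power2_eq_square del: of_nat_mult of_nat_Suc of_nat_add)
    ultimately have "((\<lambda>x. sin (real (2 * n + 1) * x) + sin (real (2 * n + 1) * x) * (g x - 1)) has_integral I n) {0..pi/2}"
      unfolding I_def by (rule has_integral_add[rotated])
    then show ?thesis by (simp only: right_diff_distrib mult_1_right add_diff_eq add_diff_cancel_left')
  qed
  have "(\<lambda>n. a n * I n) sums integral {0..pi/2} (\<lambda>x. f x * g x)"
  proof (rule has_integral_sums_uniform(2)[where f = "\<lambda>n x. a n * (sin (real (2 * n + 1) * x) * g x)" and B = "\<lambda>n. \<bar>a n\<bar> * (1 + (\<Sum>m. \<bar>b m\<bar>))"])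
    show "summable (\<lambda>n. \<bar>a n\<bar> * (1 + (\<Sum>m. \<bar>b m\<bar>)))" by (intro summable_mult2 a)
    show "\<bar>a n * (sin (real (2 * n + 1) * x) * g x)\<bar> \<le> \<bar>a n\<bar> * (1 + (\<Sum>m. \<bar>b m\<bar>))" if "x \<in> {0..pi/2}" for n x
    proof -
      have "\<bar>sin (real (2 * n + 1) * x)\<bar> * \<bar>g x\<bar> \<le> 1 * (1 + (\<Sum>m. \<bar>b m\<bar>))"
        using g1(2)[OF that] by (intro mult_mono) (auto simp del: of_nat_mult of_nat_Suc of_nat_add)
      then show ?thesis unfolding abs_mult by (simp add: mult_left_mono)
    qed
    show "(\<lambda>n. a n * (sin (real (2 * n + 1) * x) * g x)) sums (f x * g x)" if "x \<in> {0..pi/2}" for x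
      using sums_mult2[OF f[OF that], of "g x"] by (simp only: mult.assoc)
    show "((\<lambda>x. a n * (sin (real (2 * n + 1) * x) * g x)) has_integral a n * I n) {0..pi/2}" for n
      by (intro has_integral_mult_right I)
  qed (auto intro!: continuous_intros contg)
  then show ?thesis by (simp only: I_def)
qed

lemma indefinite_integral_less:
  fixes f :: "real \<Rightarrow> real"
  assumes f: "\<And>A. continuous_on A f" "\<And>t. f t > 0" and ab: "0 \<le> a" "a < b"
  shows "integral {0..a} f < integral {0..b} f"
proof (rule DERIV_pos_imp_increasing_open[OF ab(2)])
  fix z assume z: "a < z" "z < b"
  then have "((\<lambda>x. integral {0..x} f) has_real_derivative f z) (at z)"
    using integral_has_real_derivative[OF f(1), of z 0 b] at_within_interior[of z "{0..b}"] ab by auto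
  then show "\<exists>d. ((\<lambda>x. integral {0..x} f) has_real_derivative d) (at z) \<and> d > 0" using f(2) by blast
next
  show "continuous_on {a..b} (\<lambda>x. integral {0..x} f)"
    by (rule continuous_on_subset[OF indefinite_integral_continuous_1[of f 0 b]])
      (use ab f(1) in \<open>auto intro: integrable_continuous_real\<close>)
qed

lemma Delta_pos_abs:
  fixes k :: real
  assumes "\<bar>k\<bar> < 1"
  shows "1 - k\<^sup>2 * (sin t)\<^sup>2 > 0"
proof -
  have "k\<^sup>2 < 1" using assms by (simp add: abs_square_less_1)
  moreover have "k\<^sup>2 * (sin t)\<^sup>2 \<le> k\<^sup>2 * 1"
    by (intro mult_left_mono) (simp_all add: abs_square_le_1)
  ultimately show ?thesis by simp
qed

lemma Delta_pos:
  fixes k :: real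
  assumes "0 \<le> k" "k < 1"
  shows "1 - k\<^sup>2 * (sin t)\<^sup>2 > 0"
  by (rule Delta_pos_abs) (use assms in simp)

lemma continuous_on_inverse_Delta:
  fixes k :: real
  assumes "0 \<le> k" "k < 1"
  shows "continuous_on A (\<lambda>t. 1 / sqrt (1 - k\<^sup>2 * (sin t)\<^sup>2))"
  by (intro continuous_intros) (use Delta_pos[OF assms] in \<open>auto simp: less_imp_neq[symmetric]\<close>)

text \<open>The substitution \<open>z = sin t\<close> is carried out backwards:
  \<open>F (arcsin z)\<close> is an antiderivative on the open interval and continuous on the closed
  one, which deals with the unbounded integrand at \<open>z = 1\<close>.\<close>

lemma elliptic_K_trig:
  assumes k: "0 \<le> k" "k < 1"
  shows "elliptic_K k = integral {0..pi / 2} (\<lambda>t. 1 / sqrt (1 - k\<^sup>2 * (sin t)\<^sup>2))"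
proof -
  define f where "f t = 1 / sqrt (1 - k\<^sup>2 * (sin t)\<^sup>2)" for t
  define F where "F t = integral {0..t} f" for t
  have cf: "continuous_on A f" for A unfolding f_def by (rule continuous_on_inverse_Delta[OF k])
  have dF: "(F has_real_derivative f t) (at t within {0..pi/2})" if "t \<in> {0..pi/2}" for t
    unfolding F_def using integral_has_real_derivative[OF cf that] .
  have cF: "continuous_on {0..pi/2} F" by (rule DERIV_continuous_on[OF dF])
  have "((\<lambda>z. 1 / sqrt ((1 - z\<^sup>2) * (1 - k\<^sup>2 * z\<^sup>2))) has_integral F (arcsin 1) - F (arcsin 0)) {0..1}"
  proof (rule fundamental_theorem_of_calculus_interior)
    show "continuous_on {0..1} (\<lambda>z. F (arcsin z))"
    proof (rule continuous_on_compose2[OF cF])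
      show "continuous_on {0..1} arcsin" by (rule continuous_on_subset[OF continuous_on_arcsin']) auto
      show "arcsin ` {0..1} \<subseteq> {0..pi/2}" proof (rule image_subsetI)
        fix x :: real assume "x \<in> {0..1}"
        then show "arcsin x \<in> {0..pi/2}" using arcsin_le_arcsin[of 0 x] arcsin_ubound[of x] by simp
      qed
    qed
    fix z :: real assume z: "z \<in> {0<..<1}"
    have "arcsin z \<in> {0<..<pi/2}"
      using z arcsin_less_mono[of 0 z] arcsin_less_mono[of z 1] by auto
    then have "(F has_real_derivative f (arcsin z)) (at (arcsin z))"
      using dF[of "arcsin z"] at_within_interior[of "arcsin z" "{0..pi/2}"] by auto
    moreover have "(arcsin has_real_derivative inverse (sqrt (1 - z\<^sup>2))) (at z)"
      by (rule DERIV_arcsin) (use z in auto)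
    ultimately have "((\<lambda>z. F (arcsin z)) has_real_derivative f (arcsin z) * inverse (sqrt (1 - z\<^sup>2))) (at z)"
      by (rule DERIV_chain2)
    moreover have "f (arcsin z) * inverse (sqrt (1 - z\<^sup>2)) = 1 / sqrt ((1 - z\<^sup>2) * (1 - k\<^sup>2 * z\<^sup>2))"
      using z by (simp add: f_def real_sqrt_mult divide_inverse mult.commute)
    ultimately show "((\<lambda>z. F (arcsin z)) has_vector_derivative 1 / sqrt ((1 - z\<^sup>2) * (1 - k\<^sup>2 * z\<^sup>2))) (at z)"
      by (simp add: has_real_derivative_iff_has_vector_derivative)
  qed auto
  then show ?thesis unfolding elliptic_K_def by (simp add: integral_unique F_def f_def[abs_def])
qed

lemma elliptic_K_pos:
  assumes k: "0 \<le> k" "k < 1"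
  shows "elliptic_K k > 0"
proof -
  have "1 / sqrt (1 - k\<^sup>2 * (sin t)\<^sup>2) > 0" for t
    using Delta_pos[OF k, of t] by simp
  then have "integral {0..pi/2} (\<lambda>t. 1 / sqrt (1 - k\<^sup>2 * (sin t)\<^sup>2)) \<noteq> 0"
    using integral_eq_0_iff[OF continuous_on_inverse_Delta[OF k], of 0 "pi / 2"]
    by (metis atLeastAtMost_iff less_eq_real_def order_refl pi_half_gt_zero rel_simps(70))
  moreover have "integral {0..pi/2} (\<lambda>t. 1 / sqrt (1 - k\<^sup>2 * (sin t)\<^sup>2)) \<ge> 0"
    by (rule integral_nonneg) (use Delta_pos[OF k] in \<open>auto intro!: integrable_continuous_real continuous_on_inverse_Delta[OF k] simp: less_imp_le\<close>)
  ultimately show ?thesis by (simp add: elliptic_K_trig[OF k])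
qed

lemma elliptic_K_strict_mono:
  assumes kl: "0 \<le> k" "k < l" "l < 1"
  shows "elliptic_K k < elliptic_K l"
proof -
  have k: "0 \<le> k" "k < 1" and l: "0 \<le> l" "l < 1" using kl by auto
  define h where "h t = 1 / sqrt (1 - l\<^sup>2 * (sin t)\<^sup>2) - 1 / sqrt (1 - k\<^sup>2 * (sin t)\<^sup>2)" for t
  have k2: "k\<^sup>2 < l\<^sup>2" using kl by (simp add: power_strict_mono)
  have h0: "h t \<ge> 0" for t
  proof -
    have "sqrt (1 - l\<^sup>2 * (sin t)\<^sup>2) \<le> sqrt (1 - k\<^sup>2 * (sin t)\<^sup>2)"
      using k2 by (simp add: mult_right_mono)
    then show ?thesis unfolding h_def using Delta_pos[OF l, of t] by (simp add: divide_left_mono)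
  qed
  have "sqrt (1 - l\<^sup>2) < sqrt (1 - k\<^sup>2)" using k2 by simp
  moreover have "1 - l\<^sup>2 > 0" using Delta_pos[OF l, of "pi / 2"] by simp
  ultimately have h1: "h (pi / 2) > 0" by (simp add: h_def divide_strict_left_mono)
  have ch: "continuous_on {0..pi/2} h"
    unfolding h_def by (intro continuous_on_diff continuous_on_inverse_Delta k l)
  have "integral {0..pi/2} h \<noteq> 0"
    using integral_eq_0_iff[OF ch] h0 h1
    by (metis atLeastAtMost_iff less_eq_real_def order_refl pi_half_gt_zero less_irrefl)
  moreover have "integral {0..pi/2} h \<ge> 0"
    by (rule integral_nonneg) (use h0 ch in \<open>auto intro: integrable_continuous_real\<close>)
  moreover have "integral {0..pi/2} h = elliptic_K l - elliptic_K k"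
    unfolding h_def elliptic_K_trig[OF k] elliptic_K_trig[OF l]
    by (intro integral_diff integrable_continuous_real continuous_on_inverse_Delta k l)
  ultimately show ?thesis by simp
qed

text \<open>Separation of variables: under \<open>t = \<theta> x\<close> the integrand becomes the
  constant \<open>M\<close>. It serves three curves: the amplitude on the real axis, its counterpart
  on the imaginary axis with the complementary modulus, and the doubled-speed curve of the
  duplication formula.\<close>

lemma elliptic_amplitude:
  assumes k: "0 \<le> k" "k < 1" and b: "0 \<le> b"
    and d: "\<And>x. x \<in> {0..b} \<Longrightarrow> (\<theta> has_real_derivative M * sqrt (1 - k\<^sup>2 * (sin (\<theta> x))\<^sup>2)) (at x within {0..b})"
    and \<theta>: "\<theta> 0 = 0" "\<theta> ` {0..b} \<subseteq> {0..c}"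
  shows "integral {0..\<theta> b} (\<lambda>t. 1 / sqrt (1 - k\<^sup>2 * (sin t)\<^sup>2)) = M * b"
proof -
  have "\<theta> b \<ge> 0" using \<theta>(2) b by (auto simp: image_subset_iff)
  have "((\<lambda>x. (M * sqrt (1 - k\<^sup>2 * (sin (\<theta> x))\<^sup>2)) *\<^sub>R (1 / sqrt (1 - k\<^sup>2 * (sin (\<theta> x))\<^sup>2)))
      has_integral integral {\<theta> 0..\<theta> b} (\<lambda>t. 1 / sqrt (1 - k\<^sup>2 * (sin t)\<^sup>2))) {0..b}"
    by (rule has_integral_substitution[OF b _ \<theta>(2) continuous_on_inverse_Delta[OF k] d]) (use \<theta> b \<open>\<theta> b \<ge> 0\<close> in auto)
  moreover have "(M * sqrt (1 - k\<^sup>2 * (sin (\<theta> x))\<^sup>2)) *\<^sub>R (1 / sqrt (1 - k\<^sup>2 * (sin (\<theta> x))\<^sup>2)) = M" for x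
    using Delta_pos[OF k, of "\<theta> x"] by simp
  ultimately have "((\<lambda>x. M) has_integral integral {0..\<theta> b} (\<lambda>t. 1 / sqrt (1 - k\<^sup>2 * (sin t)\<^sup>2))) {0..b}"
    by (simp only: \<theta>(1))
  moreover have "((\<lambda>x. M) has_integral M * b) {0..b}"
    using has_integral_const_real[of M 0 b] b by (simp add: mult.commute)
  ultimately show ?thesis by (rule has_integral_unique)
qed

section \<open>Dilogarithms as integrals of elementary functions\<close>

text \<open>Legendre's chi function \<open>\<chi>\<^sub>2\<close> for \<open>e = 1\<close> and the inverse tangent integral \<open>Ti\<^sub>2\<close> for \<open>e = -1\<close>.\<close>

definition odd_dilog :: "real \<Rightarrow> real \<Rightarrow> real" where
  "odd_dilog e x = (\<Sum>n. e ^ n * x ^ (2 * n + 1) / real (2 * n + 1) ^ 2)"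

lemma summable_inverse_squares: "summable (\<lambda>n. 1 / real (n + 1) ^ 2)"
  using summable_ignore_initial_segment[OF inverse_power_summable[of 2, where 'a = real], of 1]
  by (simp add: inverse_eq_divide)

lemma summable_inverse_odd_squares: "summable (\<lambda>n. 1 / real (2 * n + 1) ^ 2)"
proof (rule summable_comparison_test'[OF summable_inverse_squares])
  show "norm (1 / real (2 * n + 1) ^ 2) \<le> 1 / real (n + 1) ^ 2" for n
    by (simp del: of_nat_Suc add: frac_le power_mono)
qed

lemma odd_dilog_bound:
  assumes "\<bar>e\<bar> \<le> 1" "\<bar>x\<bar> \<le> 1"
  shows "\<bar>e ^ n * x ^ (2 * n + 1) / real (2 * n + 1) ^ 2\<bar> \<le> 1 / real (2 * n + 1) ^ 2"
proof -
  have "\<bar>e ^ n * x ^ (2 * n + 1)\<bar> \<le> 1 * 1"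
    unfolding abs_mult power_abs using assms by (intro mult_mono power_le_one) auto
  then show ?thesis by (simp add: divide_right_mono del: power_Suc)
qed

lemma odd_dilog_sums:
  assumes "\<bar>e\<bar> \<le> 1" "\<bar>x\<bar> \<le> 1"
  shows "(\<lambda>n. e ^ n * x ^ (2 * n + 1) / real (2 * n + 1) ^ 2) sums odd_dilog e x"
  unfolding odd_dilog_def
  by (rule summable_sums, rule summable_comparison_test'[OF summable_inverse_odd_squares]) (use odd_dilog_bound[OF assms] in simp)

lemma odd_dilog_0 [simp]: "odd_dilog e 0 = 0"
  by (simp add: odd_dilog_def)

lemma continuous_on_odd_dilog:
  assumes "\<bar>e\<bar> \<le> 1"
  shows "continuous_on {-1..1} (odd_dilog e)"
proof (rule uniform_limit_theorem)
  show "uniform_limit {-1..1} (\<lambda>n x. \<Sum>i<n. e ^ i * x ^ (2 * i + 1) / real (2 * i + 1) ^ 2) (odd_dilog e) sequentially"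
    unfolding odd_dilog_def[abs_def]
    by (rule Weierstrass_m_test[OF _ summable_inverse_odd_squares]) (use odd_dilog_bound[OF assms] in auto)
  show "\<forall>\<^sub>F n in sequentially. continuous_on {-1..1} (\<lambda>x. \<Sum>i<n. e ^ i * x ^ (2 * i + 1) / real (2 * i + 1) ^ 2)"
    by (intro always_eventually allI continuous_intros) auto
qed auto

text \<open>Differentiation cancels one factor \<open>2 * n + 1\<close>. The closed form
  \<open>l\<close> of \<open>x\<close> times the derived series is left to the caller: it is
  \<open>artanh x\<close> for \<open>e = 1\<close> and \<open>arctan x\<close> for
  \<open>e = -1\<close>.\<close>

lemma odd_dilog_deriv:
  assumes e: "\<bar>e\<bar> \<le> 1" and x: "\<bar>x\<bar> < 1" and s: "(\<lambda>n. e ^ n * x ^ (2 * n + 1) / real (2 * n + 1)) sums l" and x0: "x \<noteq> 0"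
  shows "(odd_dilog e has_real_derivative l / x) (at x)"
proof -
  \<comment> \<open>A radius strictly between \<open>\<bar>x\<bar>\<close> and 1 gives the geometric
    majorant \<open>(c\<^sup>2) ^ n\<close> for the derived series on a neighbourhood of
    \<open>x\<close>.\<close>
  define c where "c = (\<bar>x\<bar> + 1) / 2"
  have c: "\<bar>x\<bar> < c" "c < 1" "c > 0" using x by (auto simp: c_def)
  have "((\<lambda>x. \<Sum>n. e ^ n * x ^ (2 * n + 1) / real (2 * n + 1) ^ 2) has_real_derivative (\<Sum>n. e ^ n * x ^ (2 * n) / real (2 * n + 1))) (at x)"
  proof (rule has_field_derivative_series'(2)[of "{-c..c}" _ _ 0])
    show "((\<lambda>x. e ^ n * x ^ (2 * n + 1) / real (2 * n + 1) ^ 2) has_real_derivative e ^ n * y ^ (2 * n) / real (2 * n + 1)) (at y within {-c..c})" for n y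
      by (auto intro!: derivative_eq_intros simp: power2_eq_square divide_simps simp del: power_Suc)
    show "uniformly_convergent_on {-c..c} (\<lambda>n x. \<Sum>i<n. e ^ i * x ^ (2 * i) / real (2 * i + 1))"
    proof (rule Weierstrass_m_test')
      have "c * c < 1" using c mult_strict_mono[of c 1 c 1] by simp
      then show "summable (\<lambda>n. (c\<^sup>2) ^ n)" using c by (intro summable_geometric) (simp add: power2_eq_square)
      fix n y assume "y \<in> {-c..c}"
      then have y: "\<bar>y\<bar> \<le> c" by auto
      have "\<bar>e ^ n * y ^ (2 * n)\<bar> \<le> 1 * c ^ (2 * n)"
        unfolding abs_mult power_abs using e y by (intro mult_mono power_le_one power_mono) auto
      moreover have "\<bar>e ^ n * y ^ (2 * n) / real (2 * n + 1)\<bar> \<le> \<bar>e ^ n * y ^ (2 * n)\<bar> / 1"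
        unfolding abs_divide by (intro divide_left_mono) auto
      ultimately show "norm (e ^ n * y ^ (2 * n) / real (2 * n + 1)) \<le> (c\<^sup>2) ^ n"
        by (simp add: power_mult)
    qed
    show "x \<in> interior {-c..c}" using c by (simp add: abs_less_iff)
  qed (use c in auto)
  moreover have "(\<lambda>n. e ^ n * x ^ (2 * n) / real (2 * n + 1)) sums (l / x)"
    using sums_divide[OF s, of x] x0 by simp
  ultimately show ?thesis by (simp add: odd_dilog_def[abs_def] sums_iff)
qed

lemma chi2_deriv:
  assumes "0 < x" "x < 1"
  shows "(odd_dilog 1 has_real_derivative ln ((1 + x) / (1 - x)) / (2 * x)) (at x)"
proof -
  have e: "2 * a / b / 2 = a / b" for a b :: real by simp
  have "((1 + x) / (1 - x) - 1) / ((1 + x) / (1 - x) + 1) = x"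
    using assms by (simp add: field_simps)
  with ln_series_quadratic[of "(1 + x) / (1 - x)"] assms
  have "(\<lambda>n. 2 * x ^ (2 * n + 1) / real (2 * n + 1)) sums ln ((1 + x) / (1 - x))" by simp
  from sums_divide[OF this, of 2]
  have "(\<lambda>n. 1 ^ n * x ^ (2 * n + 1) / real (2 * n + 1)) sums (ln ((1 + x) / (1 - x)) / 2)"
    by (simp only: e power_one mult_1_left)
  from odd_dilog_deriv[OF _ _ this] assms show ?thesis by simp
qed

lemma Ti2_deriv:
  assumes "0 < x" "x < 1"
  shows "(odd_dilog (-1) has_real_derivative arctan x / x) (at x)"
proof -
  have "(\<lambda>n. (- 1) ^ n * (1 / real (n * 2 + 1)) * x ^ (n * 2 + 1)) sums arctan x"
    using arctan_series[of x] summable_arctan_series[of x] assms by (simp add: sums_iff)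
  then have "(\<lambda>n. (- 1) ^ n * x ^ (2 * n + 1) / real (2 * n + 1)) sums arctan x"
    by (simp add: mult.commute)
  from odd_dilog_deriv[OF _ _ this] assms show ?thesis by simp
qed

text \<open>The endpoint 0 is treated by continuity: there the derivative formulas divide by
  \<open>x\<close>, or the inverse tangent integral is evaluated at the boundary point 1.\<close>

lemma eq_if_derivatives_eq:
  fixes f g :: "real \<Rightarrow> real"
  assumes k: "0 \<le> k" and cont: "continuous_on {0..k} f" "continuous_on {0..k} g" and z: "f 0 = g 0"
    and d: "\<And>x. 0 < x \<Longrightarrow> x < k \<Longrightarrow> (f has_real_derivative d x) (at x)"
      "\<And>x. 0 < x \<Longrightarrow> x < k \<Longrightarrow> (g has_real_derivative d x) (at x)"
  shows "f k = g k"
proof (cases "k = 0")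
  case False
  then have "k > 0" using k by simp
  then have "f k - g k = f 0 - g 0"
  proof (rule DERIV_isconst_end)
    show "continuous_on {0..k} (\<lambda>x. f x - g x)" by (intro continuous_on_diff cont)
    show "((\<lambda>x. f x - g x) has_real_derivative 0) (at x)" if "0 < x" "x < k" for x
      using DERIV_diff[OF d(1)[OF that] d(2)[OF that]] by simp
  qed
  then show ?thesis using z by simp
qed (use z in simp)

lemma leibniz_interval:
  fixes f f' :: "real \<Rightarrow> real \<Rightarrow> real"
  assumes d: "\<And>x t. \<bar>x\<bar> < 1 \<Longrightarrow> t \<in> {a..b} \<Longrightarrow> ((\<lambda>x. f x t) has_real_derivative f' x t) (at x)"
    and c: "\<And>x. \<bar>x\<bar> < 1 \<Longrightarrow> continuous_on {a..b} (f x)"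
    and c': "continuous_on ({-1<..<1} \<times> {a..b}) (\<lambda>(x, t). f' x t)"
    and x: "\<bar>x\<bar> < 1"
  shows "((\<lambda>x. integral {a..b} (f x)) has_real_derivative integral {a..b} (f' x)) (at x)"
proof -
  have "((\<lambda>x. integral (cbox a b) (f x)) has_field_derivative integral (cbox a b) (f' x)) (at x within {-1<..<1})"
  proof (rule leibniz_rule_field_derivative)
    show "continuous_on ({-1<..<1} \<times> cbox a b) (\<lambda>(x, t). f' x t)" using c' by simp
    show "f y integrable_on cbox a b" if "y \<in> {-1<..<1}" for y
      using integrable_continuous_real[OF c[of y]] that by auto
    show "((\<lambda>x. f x t) has_real_derivative f' y t) (at y within {-1<..<1})" if "y \<in> {-1<..<1}" "t \<in> cbox a b" for y t
      using d[of y t] that by (auto intro: has_field_derivative_at_within)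
  qed (use x in auto)
  moreover have "at x within {-1<..<1} = at x" using x by (intro at_within_open) auto
  ultimately show ?thesis by simp
qed

lemma integral_eq_antiderivative:
  fixes F f :: "real \<Rightarrow> real"
  assumes "a \<le> b" "\<And>t. t \<in> {a..b} \<Longrightarrow> (F has_real_derivative f t) (at t within {a..b})"
  shows "integral {a..b} f = F b - F a"
  using fundamental_theorem_of_calculus[of a b F f] assms
  by (intro integral_unique) (simp add: has_real_derivative_iff_has_vector_derivative)

lemma abs_mult_sin_less:
  fixes k :: real
  assumes "\<bar>k\<bar> < 1"
  shows "\<bar>k * sin t\<bar> < 1"
  using mult_left_le[OF abs_sin_le_one[of t] abs_ge_zero[of k]] assms by (simp add: abs_mult)

text \<open>Both sides vanish at \<open>k = 0\<close> and have the derivative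
  \<open>artanh k / k\<close>. On the left, differentiation under the integral leaves an elementary
  integrand.\<close>

lemma integral_arcsin_sin:
  assumes k: "0 \<le> k" "k < 1"
  shows "integral {0..pi/2} (\<lambda>t. arcsin (k * sin t)) = odd_dilog 1 k"
proof -
  define f' where "f' k t = sin t / sqrt (1 - k\<^sup>2 * (sin t)\<^sup>2)" for k t :: real
  have D: "((\<lambda>k. integral {0..pi/2} (\<lambda>t. arcsin (k * sin t))) has_real_derivative integral {0..pi/2} (f' k)) (at k)" if "\<bar>k\<bar> < 1" for k
  proof (rule leibniz_interval[OF _ _ _ that])
    fix x t :: real assume x: "\<bar>x\<bar> < 1"
    have "\<bar>x * sin t\<bar> < 1" by (rule abs_mult_sin_less[OF x])
    then show "((\<lambda>x. arcsin (x * sin t)) has_real_derivative f' x t) (at x)"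
      unfolding f'_def by (auto intro!: derivative_eq_intros simp: abs_less_iff power_mult_distrib divide_inverse)
  next
    fix x :: real assume x: "\<bar>x\<bar> < 1"
    have "\<bar>x * sin t\<bar> \<le> 1" for t using abs_mult_sin_less[OF x, of t] by simp
    then show "continuous_on {0..pi/2} (\<lambda>t. arcsin (x * sin t))"
      by (intro continuous_intros) (auto simp: abs_le_iff minus_le_iff)
  next
    show "continuous_on ({-1<..<1} \<times> {0..pi/2}) (\<lambda>(k, t). f' k t)"
      unfolding f'_def case_prod_beta
    proof (intro continuous_intros ballI)
      fix p :: "real \<times> real" assume "p \<in> {-1<..<1} \<times> {0..pi/2}"
      then show "sqrt (1 - (fst p)\<^sup>2 * (sin (snd p))\<^sup>2) \<noteq> 0"
        using Delta_pos_abs[of "fst p" "snd p"] by (auto simp: abs_less_iff)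
    qed
  qed
  have I: "integral {0..pi/2} (f' k) = ln ((1 + k) / (1 - k)) / (2 * k)" if k: "0 < k" "k < 1" for k
  proof -
    define l where "l = sqrt (1 - k\<^sup>2)"
    have l2: "l\<^sup>2 = 1 - k\<^sup>2" "l > 0" using k by (simp_all add: l_def abs_square_le_1 abs_square_less_1)
    have "integral {0..pi/2} (f' k) = - arsinh (k * cos (pi / 2) / l) / k - - arsinh (k * cos 0 / l) / k"
    proof (rule integral_eq_antiderivative)
      fix t
      \<comment> \<open>Because \<open>l\<^sup>2 + k\<^sup>2 cos\<^sup>2 t = 1 - k\<^sup>2
        sin\<^sup>2 t\<close>, the derivative of the inverse hyperbolic sine produces the root in
        \<open>f'\<close>.\<close>
      have "(k * cos t / l)\<^sup>2 + 1 = (1 - k\<^sup>2 * (sin t)\<^sup>2) / l\<^sup>2"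
        using l2 by (simp add: power_divide power_mult_distrib cos_squared_eq field_simps)
      then have "sqrt ((k * cos t / l)\<^sup>2 + 1) = sqrt (1 - k\<^sup>2 * (sin t)\<^sup>2) / l"
        using l2(2) by (simp add: real_sqrt_divide)
      then show "((\<lambda>t. - arsinh (k * cos t / l) / k) has_real_derivative f' k t) (at t within {0..pi/2})"
        unfolding f'_def using k l2(2)
        by (auto intro!: derivative_eq_intros arsinh_real_has_field_derivative[THEN DERIV_chain2])
    qed simp
    also have "\<dots> = arsinh (k / l) / k" by simp
    also have "arsinh (k / l) = ln ((1 + k) / l)"
    proof -
      have "(k / l)\<^sup>2 + 1 = (1 / l)\<^sup>2" using l2 by (simp add: power_divide field_simps)
      then show ?thesis using l2(2) by (simp add: arsinh_real_def add_divide_distrib add.commute)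
    qed
    also have "\<dots> = ln ((1 + k) / (1 - k)) / 2"
    proof -
      have "((1 + k) / l)\<^sup>2 = (1 + k) / (1 - k)" 
      proof -
        have "l\<^sup>2 = (1 - k) * (1 + k)" unfolding l2(1) by (simp add: power2_eq_square algebra_simps)
        then show ?thesis using k by (simp add: power_divide power2_eq_square[of "1 + k"])
      qed
      moreover have "ln (((1 + k) / l)\<^sup>2) = real 2 * ln ((1 + k) / l)" by (rule ln_realpow)
      ultimately have "ln ((1 + k) / (1 - k)) = 2 * ln ((1 + k) / l)" by simp
      then show ?thesis by simp
    qed
    finally show ?thesis by simp
  qed
  show ?thesis
  proof (rule eq_if_derivatives_eq[OF k(1), where d = "\<lambda>k. ln ((1 + k) / (1 - k)) / (2 * k)"])
    show "continuous_on {0..k} (\<lambda>k. integral {0..pi/2} (\<lambda>t. arcsin (k * sin t)))"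
      by (rule DERIV_continuous_on, rule has_field_derivative_at_within, rule D) (use k in auto)
    show "continuous_on {0..k} (odd_dilog 1)"
      by (rule continuous_on_subset[OF continuous_on_odd_dilog]) (use k in auto)
    show "((\<lambda>k. integral {0..pi/2} (\<lambda>t. arcsin (k * sin t))) has_real_derivative ln ((1 + x) / (1 - x)) / (2 * x)) (at x)" if "0 < x" "x < k" for x
      using D[of x] I[of x] that k by simp
  qed (use k chi2_deriv in auto)
qed

text \<open>The coefficient of the cosine is \<open>tan (2 * arctan r)\<close>. Differentiation in
  \<open>r\<close> makes the integrand rational in \<open>sin t\<close> and \<open>cos t\<close>,
  and its integral \<open>2 artanh r / r\<close> is the derivative of the right-hand side.\<close>

lemma integral_arctan_cos:
  assumes r: "0 \<le> r" "r < 1"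
  shows "integral {0..pi/2} (\<lambda>t. arctan (2 * r / (1 - r\<^sup>2) * cos t)) = 2 * odd_dilog 1 r"
proof -
  define f' where "f' r t = 2 * (1 + r\<^sup>2) * cos t / ((1 - r\<^sup>2)\<^sup>2 + 4 * r\<^sup>2 * (cos t)\<^sup>2)" for r t :: real
  have sq: "r\<^sup>2 < 1" if "\<bar>r\<bar> < 1" for r :: real using that by (simp add: abs_square_less_1)
  have den: "(1 - r\<^sup>2)\<^sup>2 + 4 * r\<^sup>2 * (cos t)\<^sup>2 > 0" if "\<bar>r\<bar> < 1" for r t :: real
    using sq[OF that] by (intro add_pos_nonneg) auto
  have D: "((\<lambda>r. integral {0..pi/2} (\<lambda>t. arctan (2 * r / (1 - r\<^sup>2) * cos t))) has_real_derivative integral {0..pi/2} (f' r)) (at r)" if "\<bar>r\<bar> < 1" for r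
  proof (rule leibniz_interval[OF _ _ _ that])
    fix x t :: real assume x: "\<bar>x\<bar> < 1"
    have ne: "1 - x\<^sup>2 \<noteq> 0" using sq[OF x] by simp
    have 1: "((\<lambda>x. 2 * x / (1 - x\<^sup>2) * cos t) has_real_derivative 2 * (1 + x\<^sup>2) / (1 - x\<^sup>2)\<^sup>2 * cos t) (at x)"
      using ne by (auto intro!: derivative_eq_intros simp: power2_eq_square field_simps)
    have "inverse (1 + (2 * x / (1 - x\<^sup>2) * cos t)\<^sup>2) * (2 * (1 + x\<^sup>2) / (1 - x\<^sup>2)\<^sup>2 * cos t) = f' x t"
    proof -
      have "1 + (2 * x / (1 - x\<^sup>2) * cos t)\<^sup>2 = ((1 - x\<^sup>2)\<^sup>2 + 4 * x\<^sup>2 * (cos t)\<^sup>2) / (1 - x\<^sup>2)\<^sup>2"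
        using ne by (simp add: power_divide power_mult_distrib add_divide_distrib)
      then show ?thesis using ne by (simp add: f'_def)
    qed
    then show "((\<lambda>x. arctan (2 * x / (1 - x\<^sup>2) * cos t)) has_real_derivative f' x t) (at x)"
      using DERIV_chain2[OF DERIV_arctan 1] by simp
  next
    fix x :: real assume "\<bar>x\<bar> < 1"
    show "continuous_on {0..pi/2} (\<lambda>t. arctan (2 * x / (1 - x\<^sup>2) * cos t))"
      by (intro continuous_intros)
  next
    show "continuous_on ({-1<..<1} \<times> {0..pi/2}) (\<lambda>(k, t). f' k t)"
      unfolding f'_def case_prod_beta
    proof (intro continuous_intros ballI)
      fix p :: "real \<times> real" assume "p \<in> {-1<..<1} \<times> {0..pi/2}"
      then show "(1 - (fst p)\<^sup>2)\<^sup>2 + 4 * (fst p)\<^sup>2 * (cos (snd p))\<^sup>2 \<noteq> 0"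
        using den[of "fst p" "snd p"] by (auto simp: abs_less_iff)
    qed
  qed
  have I: "integral {0..pi/2} (f' r) = ln ((1 + r) / (1 - r)) / r" if r: "0 < r" "r < 1" for r
  proof -
    have "\<bar>2 * r * sin t\<bar> < 1 + r\<^sup>2" for t
    proof -
      have "\<bar>2 * r * sin t\<bar> \<le> 2 * r * 1" unfolding abs_mult using r by (intro mult_mono) auto
      moreover have "(1 - r)\<^sup>2 > 0" using r by simp
      ultimately show ?thesis by (simp add: power2_diff)
    qed
    then have pos: "1 + r\<^sup>2 + 2 * r * sin t > 0" "1 + r\<^sup>2 - 2 * r * sin t > 0" for t
      by (auto simp: abs_less_iff algebra_simps) (smt (verit))+
    have "integral {0..pi/2} (f' r) = (ln (1 + r\<^sup>2 + 2 * r * sin (pi / 2)) - ln (1 + r\<^sup>2 - 2 * r * sin (pi / 2))) / (2 * r)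
        - (ln (1 + r\<^sup>2 + 2 * r * sin 0) - ln (1 + r\<^sup>2 - 2 * r * sin 0)) / (2 * r)"
    proof (rule integral_eq_antiderivative)
      fix t
      have "((\<lambda>t. (ln (1 + r\<^sup>2 + 2 * r * sin t) - ln (1 + r\<^sup>2 - 2 * r * sin t)) / (2 * r)) has_real_derivative
          (2 * r * cos t / (1 + r\<^sup>2 + 2 * r * sin t) + 2 * r * cos t / (1 + r\<^sup>2 - 2 * r * sin t)) / (2 * r)) (at t within {0..pi/2})"
      proof -
        have "((\<lambda>t. ln (1 + r\<^sup>2 + 2 * r * sin t)) has_real_derivative 2 * r * cos t / (1 + r\<^sup>2 + 2 * r * sin t)) (at t within {0..pi/2})"
          "((\<lambda>t. ln (1 + r\<^sup>2 - 2 * r * sin t)) has_real_derivative - (2 * r * cos t / (1 + r\<^sup>2 - 2 * r * sin t))) (at t within {0..pi/2})"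
          using pos[of t] by (auto intro!: derivative_eq_intros)
        from DERIV_cdivide[OF DERIV_diff[OF this], of "2 * r"] show ?thesis by (simp only: diff_minus_eq_add)
      qed
      moreover have "(2 * r * cos t / (1 + r\<^sup>2 + 2 * r * sin t) + 2 * r * cos t / (1 + r\<^sup>2 - 2 * r * sin t)) / (2 * r) = f' r t"
      proof -
        \<comment> \<open>This factorisation of the denominator of \<open>f'\<close> allows
          integration by logarithms.\<close>
        have e: "(1 + r\<^sup>2 + 2 * r * sin t) * (1 + r\<^sup>2 - 2 * r * sin t) = (1 - r\<^sup>2)\<^sup>2 + 4 * r\<^sup>2 * (cos t)\<^sup>2"
          using sin_squared_eq[of t] by algebra
        have "(2 * r * cos t / P + 2 * r * cos t / Q) / (2 * r) = (P + Q) * cos t / (P * Q)" if "P > 0" "Q > 0" for P Q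
          using that r by (simp add: field_simps)
        from this[OF pos(1)[of t] pos(2)[of t]] show ?thesis unfolding e f'_def by (simp add: mult.assoc)
      qed
      ultimately show "((\<lambda>t. (ln (1 + r\<^sup>2 + 2 * r * sin t) - ln (1 + r\<^sup>2 - 2 * r * sin t)) / (2 * r)) has_real_derivative f' r t) (at t within {0..pi/2})"
        by simp
    qed simp
    also have "\<dots> = (ln ((1 + r)\<^sup>2) - ln ((1 - r)\<^sup>2)) / (2 * r)" by (simp add: power2_eq_square algebra_simps)
    also have "\<dots> = ln ((1 + r) / (1 - r)) / r" using r by (simp add: ln_realpow ln_div diff_divide_distrib)
    finally show ?thesis .
  qed
  show ?thesis
  proof (rule eq_if_derivatives_eq[OF r(1), where d = "\<lambda>k. ln ((1 + k) / (1 - k)) / k"])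
    show "continuous_on {0..r} (\<lambda>r. integral {0..pi/2} (\<lambda>t. arctan (2 * r / (1 - r\<^sup>2) * cos t)))"
      by (rule DERIV_continuous_on, rule has_field_derivative_at_within, rule D) (use r in auto)
    show "continuous_on {0..r} (\<lambda>r. 2 * odd_dilog 1 r)"
      by (intro continuous_intros continuous_on_subset[OF continuous_on_odd_dilog]) (use r in auto)
    show "((\<lambda>r. 2 * odd_dilog 1 r) has_real_derivative ln ((1 + x) / (1 - x)) / x) (at x)" if "0 < x" "x < r" for x
      using DERIV_cmult[OF chi2_deriv[of x], of 2] that r by simp
    show "((\<lambda>r. integral {0..pi/2} (\<lambda>t. arctan (2 * r / (1 - r\<^sup>2) * cos t))) has_real_derivative ln ((1 + x) / (1 - x)) / x) (at x)" if "0 < x" "x < r" for x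
      using D[of x] I[of x] that r by simp
  qed simp
qed

lemma Delta_plus_cos_pos:
  assumes "\<bar>k\<bar> < 1" "t \<in> {0..pi/2}"
  shows "sqrt (1 - k\<^sup>2 * (sin t)\<^sup>2) + cos t > 0"
  using Delta_pos_abs[OF assms(1), of t] cos_ge_zero[of t] assms(2) by (intro add_pos_nonneg) auto

text \<open>The derivative of the left side in \<open>k\<close> is
  \<open>arcsin k / (1 - k\<^sup>2)\<close>. With \<open>p = sqrt ((1 - k) / (1 + k))\<close> one
  has \<open>arcsin k = pi / 2 - 2 arctan p\<close> and \<open>p' = - p / (1 - k\<^sup>2)\<close>:
  the summand \<open>pi / 2\<close> integrates to the logarithm of \<open>p\<close>, the arctangent
  to the inverse tangent integral. At \<open>k = 0\<close> the integrand is zero and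
  \<open>p = 1\<close>, which explains the constant \<open>odd_dilog (-1) 1\<close>.\<close>

lemma integral_ln_Delta_cos:
  assumes k: "0 \<le> k" "k < 1"
  shows "integral {0..pi/2} (\<lambda>t. ln ((sqrt (1 - k\<^sup>2 * (sin t)\<^sup>2) + cos t) / (sqrt (1 - k\<^sup>2) * (1 + cos t))))
    = 2 * odd_dilog (-1) (sqrt ((1 - k) / (1 + k))) - 2 * odd_dilog (-1) 1 - pi / 2 * ln (sqrt ((1 - k) / (1 + k)))"
proof -
  define f where "f k t = ln (sqrt (1 - k\<^sup>2 * (sin t)\<^sup>2) + cos t) - ln (1 - k\<^sup>2) / 2 - ln (1 + cos t)" for k t :: real
  define f' where "f' k t = k / (1 - k\<^sup>2) * (cos t / sqrt (1 - k\<^sup>2 * (sin t)\<^sup>2))" for k t :: real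
  define p where "p k = sqrt ((1 - k) / (1 + k))" for k :: real
  have sq: "k\<^sup>2 < 1" if "\<bar>k\<bar> < 1" for k :: real using that by (simp add: abs_square_less_1)
  have D: "((\<lambda>k. integral {0..pi/2} (f k)) has_real_derivative integral {0..pi/2} (f' k)) (at k)" if "\<bar>k\<bar> < 1" for k
  proof (rule leibniz_interval[OF _ _ _ that])
    fix x t :: real assume x: "\<bar>x\<bar> < 1" and t: "t \<in> {0..pi/2}"
    define d where "d = sqrt (1 - x\<^sup>2 * (sin t)\<^sup>2)"
    have d: "d > 0" "d\<^sup>2 = 1 - x\<^sup>2 * (sin t)\<^sup>2" using Delta_pos_abs[OF x, of t] by (simp_all add: d_def)
    have pos: "d + cos t > 0" using Delta_plus_cos_pos[OF x t] by (simp add: d_def)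
    have "((\<lambda>x. f x t) has_real_derivative (- (x * (sin t)\<^sup>2) / d) / (d + cos t) + x / (1 - x\<^sup>2)) (at x)"
    proof -
      have "((\<lambda>x. sqrt (1 - x\<^sup>2 * (sin t)\<^sup>2)) has_real_derivative - (x * (sin t)\<^sup>2) / d) (at x)"
        using Delta_pos_abs[OF x, of t] by (auto intro!: derivative_eq_intros simp: d_def field_simps)
      then have 1: "((\<lambda>x. ln (sqrt (1 - x\<^sup>2 * (sin t)\<^sup>2) + cos t)) has_real_derivative (- (x * (sin t)\<^sup>2) / d) / (d + cos t)) (at x)"
        using DERIV_chain2[OF DERIV_ln_divide DERIV_add[OF _ DERIV_const]] pos unfolding d_def by fastforce
      have 2: "((\<lambda>x. ln (1 - x\<^sup>2) / 2) has_real_derivative - (x / (1 - x\<^sup>2))) (at x)"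
        using sq[OF x] by (auto intro!: derivative_eq_intros simp: field_simps)
      show ?thesis
        unfolding f_def using DERIV_diff[OF DERIV_diff[OF 1 2] DERIV_const[of "ln (1 + cos t)"]] by simp
    qed
    moreover have "(- (x * (sin t)\<^sup>2) / d) / (d + cos t) + x / (1 - x\<^sup>2) = f' x t"
    proof -
      \<comment> \<open>This difference of squares cancels the factor \<open>d + cos t\<close> left
        in the denominator by the logarithm.\<close>
      have "(1 - x\<^sup>2) * (sin t)\<^sup>2 = (d + cos t) * (d - cos t)"
        unfolding square_diff_square_factored[symmetric] power2_eq_square[symmetric] d(2)
        by (simp add: sin_squared_eq algebra_simps)
      then have "(sin t)\<^sup>2 = (d + cos t) * (d - cos t) / (1 - x\<^sup>2)" using sq[OF x] by (simp add: field_simps)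
      then have "(- (x * (sin t)\<^sup>2) / d) / (d + cos t) = - x * (d - cos t) / (d * (1 - x\<^sup>2))"
        using pos by simp
      moreover have "- x * (d - c) / (d * w) + x / w = x / w * (c / d)" if "w \<noteq> 0" for c w
        using d(1) that by (simp add: field_simps)
      ultimately have "(- (x * (sin t)\<^sup>2) / d) / (d + cos t) + x / (1 - x\<^sup>2) = x / (1 - x\<^sup>2) * (cos t / d)"
        using sq[OF x] by simp
      also have "\<dots> = f' x t" by (simp add: f'_def d_def)
      finally show ?thesis .
    qed
    ultimately show "((\<lambda>x. f x t) has_real_derivative f' x t) (at x)" by simp
  next
    fix x :: real assume x: "\<bar>x\<bar> < 1"
    show "continuous_on {0..pi/2} (f x)"
      unfolding f_def
    proof (intro continuous_intros ballI)
      fix t :: real assume t: "t \<in> {0..pi/2}"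
      show "sqrt (1 - x\<^sup>2 * (sin t)\<^sup>2) + cos t \<noteq> 0" using Delta_plus_cos_pos[OF x t] by simp
      show "1 + cos t \<noteq> 0" using cos_ge_zero[of t] t by auto
    qed
  next
    show "continuous_on ({-1<..<1} \<times> {0..pi/2}) (\<lambda>(k, t). f' k t)"
      unfolding f'_def case_prod_beta
    proof (intro continuous_intros ballI)
      fix p :: "real \<times> real" assume p: "p \<in> {-1<..<1} \<times> {0..pi/2}"
      then show "sqrt (1 - (fst p)\<^sup>2 * (sin (snd p))\<^sup>2) \<noteq> 0"
        using Delta_pos_abs[of "fst p" "snd p"] by (auto simp: abs_less_iff)
      show "1 - (fst p)\<^sup>2 \<noteq> 0" using sq[of "fst p"] p by (auto simp: abs_less_iff)
    qed
  qed
  have I: "integral {0..pi/2} (f' k) = arcsin k / (1 - k\<^sup>2)" if k: "0 < k" "k < 1" for k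
  proof -
    have "integral {0..pi/2} (f' k) = arcsin (k * sin (pi / 2)) / (1 - k\<^sup>2) - arcsin (k * sin 0) / (1 - k\<^sup>2)"
    proof (rule integral_eq_antiderivative)
      fix t
      have "\<bar>k * sin t\<bar> < 1" by (rule abs_mult_sin_less) (use k in simp)
      then have 1: "(arcsin has_real_derivative inverse (sqrt (1 - (k * sin t)\<^sup>2))) (at (k * sin t))"
        by (intro DERIV_arcsin) auto
      have "((\<lambda>t. k * sin t) has_real_derivative k * cos t) (at t within {0..pi/2})"
        by (auto intro!: derivative_eq_intros)
      from DERIV_cdivide[OF DERIV_chain2[OF 1 this], of "1 - k\<^sup>2"]
      show "((\<lambda>t. arcsin (k * sin t) / (1 - k\<^sup>2)) has_real_derivative f' k t) (at t within {0..pi/2})"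
        by (rule DERIV_cong) (simp add: f'_def power_mult_distrib divide_inverse)
    qed simp
    then show ?thesis by simp
  qed
  \<comment> \<open>\<open>p x\<close> is the tangent of half the angle whose cosine is
    \<open>x\<close>, so \<open>arcsin x\<close> is the complement of
    \<open>2 arctan (p x)\<close>.\<close>
  have p: "0 < p x" "p x < 1" "arcsin x = pi / 2 - 2 * arctan (p x)" "(p has_real_derivative - p x / (1 - x\<^sup>2)) (at x)"
    if x: "0 < x" "x < 1" for x
  proof -
    show p01: "0 < p x" "p x < 1" using x by (simp_all add: p_def)
    have p2: "(p x)\<^sup>2 = (1 - x) / (1 + x)" using x by (simp add: p_def)
    have "sin (pi / 2 - 2 * arctan (p x)) = cos (2 * arctan (p x))" by (simp add: sin_diff)
    also have "\<dots> = (1 - (p x)\<^sup>2) / (1 + (p x)\<^sup>2)"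
      by (simp add: cos_double cos_arctan sin_arctan power_divide diff_divide_distrib)
    also have "\<dots> = x" unfolding p2 using x by (simp add: field_simps)
    finally have "arcsin x = arcsin (sin (pi / 2 - 2 * arctan (p x)))" by simp
    also have "\<dots> = pi / 2 - 2 * arctan (p x)"
    proof (rule arcsin_sin)
      have "0 < arctan (p x)" "arctan (p x) < pi / 4" using p01 arctan_less_pi4_pos[of "p x"] by simp_all
      then show "- (pi / 2) \<le> pi / 2 - 2 * arctan (p x)" "pi / 2 - 2 * arctan (p x) \<le> pi / 2"
        using pi_gt_zero by linarith+
    qed
    finally show "arcsin x = pi / 2 - 2 * arctan (p x)" .
    have "((\<lambda>x. (1 - x) / (1 + x)) has_real_derivative - 2 / (1 + x)\<^sup>2) (at x)"
      using x by (auto intro!: derivative_eq_intros simp: power2_eq_square)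
    moreover have "(sqrt has_real_derivative inverse (p x) / 2) (at ((1 - x) / (1 + x)))"
      unfolding p_def by (rule DERIV_real_sqrt) (use x in simp)
    ultimately have "(p has_real_derivative inverse (p x) / 2 * (- 2 / (1 + x)\<^sup>2)) (at x)"
      unfolding p_def[abs_def] by (rule DERIV_chain2[rotated])
    moreover have "inverse (p x) / 2 * (- 2 / (1 + x)\<^sup>2) = - p x / (1 - x\<^sup>2)"
    proof -
      have "inverse (p x) = p x / (p x)\<^sup>2" using p01 by (simp add: power2_eq_square field_simps)
      also have "\<dots> = p x * (1 + x) / (1 - x)" unfolding p2 by simp
      finally have i: "inverse (p x) = p x * (1 + x) / (1 - x)" .
      have "inverse (p x) / 2 * (- 2 / (1 + x)\<^sup>2) = - inverse (p x) / (1 + x)\<^sup>2" by simp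
      also have "\<dots> = - (p x * (1 + x) / (1 - x)) / (1 + x)\<^sup>2" unfolding i ..
      also have "\<dots> = - p x / ((1 - x) * (1 + x))" using x by (simp add: power2_eq_square)
      also have "(1 - x) * (1 + x) = 1 - x\<^sup>2" by (simp add: power2_eq_square algebra_simps)
      finally show ?thesis .
    qed
    ultimately show "(p has_real_derivative - p x / (1 - x\<^sup>2)) (at x)" by simp
  qed
  have "integral {0..pi/2} (f k) = 2 * odd_dilog (-1) (p k) - 2 * odd_dilog (-1) 1 - pi / 2 * ln (p k)"
  proof (rule eq_if_derivatives_eq[OF k(1), where d = "\<lambda>k. arcsin k / (1 - k\<^sup>2)"])
    show "continuous_on {0..k} (\<lambda>k. integral {0..pi/2} (f k))"
      by (rule DERIV_continuous_on, rule has_field_derivative_at_within, rule D) (use k in auto)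
    have cp: "continuous_on {0..k} p"
      unfolding p_def[abs_def] by (intro continuous_intros) auto
    show "continuous_on {0..k} (\<lambda>k. 2 * odd_dilog (-1) (p k) - 2 * odd_dilog (-1) 1 - pi / 2 * ln (p k))"
    proof (intro continuous_intros cp ballI continuous_on_compose2[OF continuous_on_odd_dilog cp])
      show "p ` {0..k} \<subseteq> {-1..1}"
      proof (rule image_subsetI)
        fix x assume x: "x \<in> {0..k}"
        have "p x \<ge> 0" "p x \<le> 1" using x k by (auto simp: p_def)
        then show "p x \<in> {-1..1}" by simp
      qed
      show "p x \<noteq> 0" if "x \<in> {0..k}" for x using that k by (simp add: p_def)
    qed simp
    show "integral {0..pi/2} (f 0) = 2 * odd_dilog (-1) (p 0) - 2 * odd_dilog (-1) 1 - pi / 2 * ln (p 0)"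
    proof -
      have "f 0 = (\<lambda>t. 0)" by (simp add: f_def fun_eq_iff add.commute)
      then show ?thesis by (simp add: p_def)
    qed
    fix x assume x: "0 < x" "x < k"
    then have x1: "x < 1" using k by simp
    show "((\<lambda>k. integral {0..pi/2} (f k)) has_real_derivative arcsin x / (1 - x\<^sup>2)) (at x)"
      using D[of x] I[of x] x x1 by simp
    note p = p[OF x(1) x1]
    have "((\<lambda>k. 2 * odd_dilog (-1) (p k) - 2 * odd_dilog (-1) 1 - pi / 2 * ln (p k)) has_real_derivative
        2 * (arctan (p x) / p x * (- p x / (1 - x\<^sup>2))) - 0 - pi / 2 * (1 / p x * (- p x / (1 - x\<^sup>2)))) (at x)"
      by (intro DERIV_diff DERIV_cmult DERIV_const DERIV_chain2[OF Ti2_deriv[OF p(1,2)] p(4)] DERIV_chain2[OF DERIV_ln_divide[OF p(1)] p(4)])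
    moreover have "2 * (arctan (p x) / p x * (- p x / (1 - x\<^sup>2))) - 0 - pi / 2 * (1 / p x * (- p x / (1 - x\<^sup>2))) = arcsin x / (1 - x\<^sup>2)"
      unfolding p(3) using p(1) by (simp add: diff_divide_distrib)
    ultimately show "((\<lambda>k. 2 * odd_dilog (-1) (p k) - 2 * odd_dilog (-1) 1 - pi / 2 * ln (p k)) has_real_derivative arcsin x / (1 - x\<^sup>2)) (at x)"
      by simp
  qed
  moreover have "integral {0..pi/2} (f k) = integral {0..pi/2} (\<lambda>t. ln ((sqrt (1 - k\<^sup>2 * (sin t)\<^sup>2) + cos t) / (sqrt (1 - k\<^sup>2) * (1 + cos t))))"
  proof (rule integral_cong)
    fix t :: real assume t: "t \<in> {0..pi/2}"
    have k1: "\<bar>k\<bar> < 1" using k by simp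
    have c: "1 + cos t > 0" using cos_ge_zero[of t] t by auto
    show "f k t = ln ((sqrt (1 - k\<^sup>2 * (sin t)\<^sup>2) + cos t) / (sqrt (1 - k\<^sup>2) * (1 + cos t)))"
      unfolding f_def using Delta_plus_cos_pos[OF k1 t] c sq[OF k1] by (simp add: ln_div ln_mult ln_sqrt)
  qed
  ultimately show ?thesis by (simp add: p_def)
qed

section \<open>The amplitude and the nome\<close>

definition modulus :: "real \<Rightarrow> real" where "modulus s = jac_C s 0 / jac_D s 0"

text \<open>For \<open>x < 0\<close> the interval \<open>{0..x}\<close> is empty and \<open>amp s x\<close> has the junk value \<open>0\<close>.\<close>

definition amp :: "real \<Rightarrow> real \<Rightarrow> real" where "amp s x = integral {0..x} (jac_D s)"

context
  fixes s :: real
  assumes s: "s > 0"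
begin

lemma modulus_bounds: "0 < modulus s" "modulus s < 1"
  using jac_C_0_pos[OF s] jac_D_0_pos[OF s] jac_C_less_jac_D[OF s] by (auto simp: modulus_def)

lemma jac_C_0_eq: "jac_C s 0 = modulus s * jac_D s 0"
  using jac_D_0_pos[OF s] by (simp add: modulus_def)

lemma amp_deriv:
  assumes "x \<in> {0..b}"
  shows "(amp s has_real_derivative jac_D s x) (at x within {0..b})"
  unfolding amp_def[abs_def] by (rule integral_has_real_derivative[OF continuous_on_jac(1)[OF s] assms])

lemma amp_0 [simp]: "amp s 0 = 0"
  by (simp add: amp_def)

text \<open>The terms \<open>cos (2 m x)\<close> integrate to zero over this interval, so only the
  constant term 1 of \<open>D\<close> counts.\<close>

lemma amp_half_pi [simp]: "amp s (pi / 2) = pi / 2"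
proof -
  have "(\<lambda>n. 0) sums integral {0..pi/2} (\<lambda>x. jac_D s x - 1)"
  proof (rule has_integral_sums_uniform(2)[where f = "\<lambda>n x. 2 * cos (real (2 * Suc n) * x) / cosh (real (Suc n) * s)"
        and B = "\<lambda>n. 2 / cosh (real (Suc n) * s)"])
    show "\<bar>2 * cos (real (2 * Suc n) * x) / cosh (real (Suc n) * s)\<bar> \<le> 2 / cosh (real (Suc n) * s)" for n x
      by (simp add: abs_mult divide_right_mono cosh_real_pos less_imp_le del: of_nat_mult of_nat_Suc)
    show "summable (\<lambda>n. 2 / cosh (real (Suc n) * s))"
      using jac_sums(1)[OF s, of 0] by (simp add: sums_iff)
    fix n
    show "((\<lambda>x. 2 * cos (real (2 * Suc n) * x) / cosh (real (Suc n) * s)) has_integral 0) {0..pi/2}"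
    proof -
      define N where "N = real (Suc n)"
      have N: "N > 0" by (simp add: N_def)
      have "((\<lambda>x. 2 * cos (2 * N * x) / cosh (N * s)) has_integral
          sin (2 * N * (pi / 2)) / (N * cosh (N * s)) - sin (2 * N * 0) / (N * cosh (N * s))) {0..pi/2}"
        by (rule fundamental_theorem_of_calculus, simp, rule has_real_derivative_iff_has_vector_derivative[THEN iffD1])
          (use N in \<open>auto intro!: derivative_eq_intros\<close>)
      moreover have "2 * N * (pi / 2) = real (Suc n) * pi" by (simp add: N_def)
      then have "sin (2 * N * (pi / 2)) = 0" by (simp only: sin_npi)
      ultimately show ?thesis by (simp add: N_def algebra_simps)
    qed
  qed (use jac_sums(1)[OF s] in \<open>auto intro!: continuous_intros simp: cosh_real_nonzero\<close>)
  then have "integral {0..pi/2} (\<lambda>x. jac_D s x - 1) = 0" using sums_unique2 sums_zero by blast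
  moreover have "integral {0..pi/2} (\<lambda>x. jac_D s x - 1) = integral {0..pi/2} (jac_D s) - integral {0..pi/2} (\<lambda>x. 1)"
    by (intro integral_diff integrable_continuous_real continuous_on_jac s continuous_intros)
  ultimately show ?thesis by (simp add: amp_def)
qed

lemma amp_less: "0 \<le> x \<Longrightarrow> x < y \<Longrightarrow> amp s x < amp s y"
  unfolding amp_def by (rule indefinite_integral_less[OF continuous_on_jac(1)[OF s] jac_D_pos[OF s]])

lemma amp_range: "x \<in> {0..pi/2} \<Longrightarrow> amp s x \<in> {0..pi/2}"
proof -
  assume x: "x \<in> {0..pi/2}"
  have "amp s 0 \<le> amp s x" using amp_less[of 0 x] x by (cases "x = 0") auto
  moreover have "amp s x \<le> amp s (pi / 2)"
  proof (cases "x < pi / 2")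
    case False
    with x have "x = pi / 2" by simp
    then show ?thesis by (simp only: order_refl)
  qed (use amp_less[of x "pi / 2"] x in auto)
  ultimately show "amp s x \<in> {0..pi/2}" by simp
qed

text \<open>The vector \<open>(C, S)\<close> rotates with angular velocity \<open>D\<close>, which
  is also the speed of the amplitude. Rotated back by \<open>amp s x\<close> it is therefore
  constant.\<close>

lemma jac_amp:
  assumes "x \<ge> 0"
  shows "jac_S s x = jac_C s 0 * sin (amp s x)" "jac_C s x = jac_C s 0 * cos (amp s x)"
proof -
  have const: "f x = f 0" if "\<And>y. y \<in> {0..x} \<Longrightarrow> (f has_real_derivative 0) (at y within {0..x})" for f :: "real \<Rightarrow> real"
  proof -
    have "\<exists>c. \<forall>y\<in>{0..x}. f y = c"
      using has_field_derivative_zero_constant[OF convex_real_interval(5) that] .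
    then obtain c where "\<forall>y\<in>{0..x}. f y = c" ..
    then show ?thesis using assms by simp
  qed
  have "jac_S s x * cos (amp s x) - jac_C s x * sin (amp s x) = jac_S s 0 * cos (amp s 0) - jac_C s 0 * sin (amp s 0)"
  proof (rule const)
    fix y assume y: "y \<in> {0..x}"
    show "((\<lambda>y. jac_S s y * cos (amp s y) - jac_C s y * sin (amp s y)) has_real_derivative 0) (at y within {0..x})"
      by (rule derivative_eq_intros jac_deriv[OF s] amp_deriv[OF y] refl)+ (simp add: algebra_simps)
  qed
  then have 1: "jac_S s x * cos (amp s x) = jac_C s x * sin (amp s x)" using jac_S_0[OF s] by simp
  have "jac_S s x * sin (amp s x) + jac_C s x * cos (amp s x) = jac_S s 0 * sin (amp s 0) + jac_C s 0 * cos (amp s 0)"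
  proof (rule const)
    fix y assume y: "y \<in> {0..x}"
    show "((\<lambda>y. jac_S s y * sin (amp s y) + jac_C s y * cos (amp s y)) has_real_derivative 0) (at y within {0..x})"
      by (rule derivative_eq_intros jac_deriv[OF s] amp_deriv[OF y] refl)+ (simp add: algebra_simps)
  qed
  then have 2: "jac_S s x * sin (amp s x) + jac_C s x * cos (amp s x) = jac_C s 0" by simp
  define c d where "c = cos (amp s x)" and "d = sin (amp s x)"
  have cd: "c\<^sup>2 + d\<^sup>2 = 1" by (simp add: c_def d_def)
  have "jac_C s 0 * d = jac_S s x * (c\<^sup>2 + d\<^sup>2)"
    using 1 unfolding 2[symmetric] c_def[symmetric] d_def[symmetric] by algebra
  then show "jac_S s x = jac_C s 0 * sin (amp s x)" using cd by (simp add: d_def)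
  have "jac_C s 0 * c = jac_C s x * (c\<^sup>2 + d\<^sup>2)"
    using 1 unfolding 2[symmetric] c_def[symmetric] d_def[symmetric] by algebra
  then show "jac_C s x = jac_C s 0 * cos (amp s x)" using cd by (simp add: c_def)
qed

text \<open>Squared, this is the relation between \<open>S\<close> and \<open>D\<close>;
  \<open>jac_D_pos\<close> selects the positive root.\<close>

lemma jac_D_amp:
  assumes "x \<ge> 0"
  shows "jac_D s x = jac_D s 0 * sqrt (1 - (modulus s)\<^sup>2 * (sin (amp s x))\<^sup>2)"
proof -
  have "jac_D s x ^ 2 = (jac_D s 0)\<^sup>2 * (1 - (modulus s)\<^sup>2 * (sin (amp s x))\<^sup>2)"
    using jac_quadratic_relations(2)[OF s, of x] jac_amp(1)[OF assms] by (simp add: jac_C_0_eq algebra_simps)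
  then have "jac_D s x = sqrt ((jac_D s 0)\<^sup>2 * (1 - (modulus s)\<^sup>2 * (sin (amp s x))\<^sup>2))"
    using jac_D_pos[OF s, of x] by (metis less_imp_le real_sqrt_unique)
  then show ?thesis using jac_D_0_pos[OF s] by (simp add: real_sqrt_mult)
qed

lemma amp_integral:
  assumes "x \<in> {0..pi / 2}"
  shows "integral {0..amp s x} (\<lambda>t. 1 / sqrt (1 - (modulus s)\<^sup>2 * (sin t)\<^sup>2)) = jac_D s 0 * x"
proof (rule elliptic_amplitude)
  show "amp s ` {0..x} \<subseteq> {0..pi/2}" using amp_range assms by fastforce
  fix y assume "y \<in> {0..x}"
  then show "(amp s has_real_derivative jac_D s 0 * sqrt (1 - (modulus s)\<^sup>2 * (sin (amp s y))\<^sup>2)) (at y within {0..x})"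
    using amp_deriv[of y x] jac_D_amp[of y] by simp
qed (use modulus_bounds assms in auto)

lemma elliptic_K_modulus: "elliptic_K (modulus s) = jac_D s 0 * (pi / 2)"
  using amp_integral[of "pi / 2"] modulus_bounds by (simp add: elliptic_K_trig)

section \<open>The imaginary axis and the complementary modulus\<close>

lemma sin_arctan_power2: "(sin (arctan x))\<^sup>2 = x\<^sup>2 / (1 + x\<^sup>2)"
  by (simp add: sin_arctan power_divide)

lemma cosh_sinh_of_real:
  "cosh (complex_of_real y) = of_real (cosh y)" "sinh (complex_of_real y) = of_real (sinh y)"
  using exp_of_real[of y, where 'a = complex] exp_of_real[of "- y", where 'a = complex]
  by (simp_all add: cosh_field_def sinh_field_def)

text \<open>At an imaginary point cosines become hyperbolic cosines, and sines become
  \<open>\<i>\<close> times hyperbolic sines. So the square of \<open>S\<close> is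
  \<open>- h\<^sup>2\<close>, the circular relations turn hyperbolic, and positivity of
  \<open>c\<close> and \<open>d\<close> is visible term by term.\<close>

lemma ell_imaginary:
  fixes y :: real
  assumes y: "\<bar>y\<bar> < s / 2"
  defines "h \<equiv> Im (ell_S s (\<i> * of_real y))" and "c \<equiv> Re (ell_C s (\<i> * of_real y))" and "d \<equiv> Re (ell_D s (\<i> * of_real y))"
  shows "ell_S s (\<i> * of_real y) = \<i> * of_real h" "ell_C s (\<i> * of_real y) = of_real c" "ell_D s (\<i> * of_real y) = of_real d"
    and "(\<lambda>n. 2 * sinh (real (2 * n + 1) * y) / sinh (real (2 * n + 1) * (s / 2))) sums h" "c > 0" "d > 0"
    and "c\<^sup>2 = (jac_C s 0)\<^sup>2 + h\<^sup>2" "d\<^sup>2 = (jac_D s 0)\<^sup>2 + h\<^sup>2"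
proof -
  have x: "\<bar>Im (\<i> * of_real y)\<bar> < s / 2" using y by simp
  have ch: "2 * cos (of_nat k * (\<i> * complex_of_real y)) / of_real r = complex_of_real (2 * cosh (real k * y) / r)" for k r
  proof -
    have "cos (of_nat k * (\<i> * complex_of_real y)) = cos (\<i> * complex_of_real (real k * y))" by (simp add: mult.left_commute)
    then show ?thesis by (simp only: cosh_conv_cos[symmetric] cosh_sinh_of_real) simp
  qed
  have sh: "2 * sin (of_nat k * (\<i> * complex_of_real y)) / of_real r = \<i> * complex_of_real (2 * sinh (real k * y) / r)" for k r
  proof -
    have "sin (of_nat k * (\<i> * complex_of_real y)) = sin (\<i> * complex_of_real (real k * y))" by (simp add: mult.left_commute)
    also have "\<dots> = \<i> * sinh (complex_of_real (real k * y))" by (simp add: sinh_conv_sin)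
    finally show ?thesis by (simp only: cosh_sinh_of_real) simp
  qed
  note D = sums_of_real_imp_of_real_Re[OF ell_sums(1)[OF s x, unfolded ch]]
  note C = sums_of_real_imp_of_real_Re[OF ell_sums(2)[OF s x, unfolded ch]]
  have "(\<lambda>n. - \<i> * (\<i> * complex_of_real (2 * sinh (real (2 * n + 1) * y) / sinh (real (2 * n + 1) * (s / 2))))) sums (- \<i> * ell_S s (\<i> * of_real y))"
    by (rule sums_mult[OF ell_sums(3)[OF s x, unfolded sh]])
  then have "(\<lambda>n. complex_of_real (2 * sinh (real (2 * n + 1) * y) / sinh (real (2 * n + 1) * (s / 2)))) sums (- \<i> * ell_S s (\<i> * of_real y))"
    by (simp only: mult.assoc[symmetric] minus_mult_left[symmetric] complex_i_mult_minus i_squared minus_minus mult_1_left)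
  note S = sums_of_real_imp_of_real_Re[OF this]
  show 1: "ell_S s (\<i> * of_real y) = \<i> * of_real h" using S(1) by (simp add: h_def complex_eq_iff)
  show 2: "ell_C s (\<i> * of_real y) = of_real c" using C(1) by (simp add: c_def)
  show 3: "ell_D s (\<i> * of_real y) = of_real d" using D(1) by (simp add: d_def complex_eq_iff)
  show "(\<lambda>n. 2 * sinh (real (2 * n + 1) * y) / sinh (real (2 * n + 1) * (s / 2))) sums h" using S(2) by (simp add: h_def)
  have "0 < (\<Sum>n. 2 * cosh (real (2 * n + 1) * y) / cosh (real (2 * n + 1) * (s / 2)))"
    by (rule suminf_pos) (use C(2) in \<open>auto simp: sums_iff cosh_real_pos\<close>)
  then show "c > 0" using C(2) by (simp add: c_def sums_iff)
  have "0 < (\<Sum>n. 2 * cosh (real (2 * Suc n) * y) / cosh (real (Suc n) * s))"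
    by (rule suminf_pos) (use D(2) in \<open>auto simp: sums_iff cosh_real_pos\<close>)
  then show "d > 0" using D(2) by (simp add: d_def sums_iff)
  have "complex_of_real (c\<^sup>2) = of_real ((jac_C s 0)\<^sup>2 + h\<^sup>2)"
    using ell_quadratic_relations(1)[OF s x] of_real_jac(2)[OF s, of 0] by (simp add: 1 2 power_mult_distrib algebra_simps)
  then show "c\<^sup>2 = (jac_C s 0)\<^sup>2 + h\<^sup>2" unfolding of_real_eq_iff .
  have "complex_of_real (d\<^sup>2) = of_real ((jac_D s 0)\<^sup>2 + h\<^sup>2)"
    using ell_quadratic_relations(2)[OF s x] of_real_jac(1)[OF s, of 0] by (simp add: 1 3 power_mult_distrib algebra_simps)
  then show "d\<^sup>2 = (jac_D s 0)\<^sup>2 + h\<^sup>2" unfolding of_real_eq_iff .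
qed

lemma ell_S_imaginary_deriv:
  assumes y: "\<bar>y\<bar> < s / 2"
  shows "((\<lambda>y. Im (ell_S s (\<i> * of_real y))) has_real_derivative Re (ell_C s (\<i> * of_real y)) * Re (ell_D s (\<i> * of_real y))) (at y within A)"
proof -
  have x: "\<bar>Im (\<i> * of_real y)\<bar> < s / 2" using y by simp
  have "((\<lambda>z. ell_S s (\<i> * z)) has_field_derivative (ell_C s (\<i> * of_real y) * ell_D s (\<i> * of_real y)) * \<i>) (at (of_real y))"
    by (rule DERIV_chain2[where g = "\<lambda>z. \<i> * z", OF ell_deriv(3)[OF s x]]) (auto intro!: derivative_eq_intros)
  note has_field_derivative_Im[OF has_vector_derivative_real_field[OF this]]
  moreover have "Im (ell_C s (\<i> * of_real y)) = 0" "Im (ell_D s (\<i> * of_real y)) = 0"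
    using arg_cong[OF ell_imaginary(2)[OF y], of Im] arg_cong[OF ell_imaginary(3)[OF y], of Im] by simp_all
  ultimately show ?thesis by simp
qed

text \<open>Jacobi's imaginary transformation \<open>sn (\<i> u, k) = \<i> tan (am (u, k'))\<close>
  is behind \<open>\<psi>\<close>: it is the amplitude for the complementary modulus. Its elliptic
  integral is \<open>M * y\<close> for \<open>y < s / 2\<close>; the value at \<open>s / 2\<close>,
  where the series for \<open>h\<close> diverges, is a left limit.\<close>

lemma elliptic_K_complementary_modulus: "elliptic_K (sqrt (1 - (modulus s)\<^sup>2)) = jac_D s 0 * (s / 2)"
proof -
  define k where "k = modulus s"
  define k' where "k' = sqrt (1 - k\<^sup>2)"
  define M where "M = jac_D s 0"
  define h where "h y = Im (ell_S s (\<i> * of_real y))" for y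
  define \<psi> where "\<psi> y = arctan (h y / (k * M))" for y
  define f where "f t = 1 / sqrt (1 - k'\<^sup>2 * (sin t)\<^sup>2)" for t
  have k: "0 < k" "k < 1" using modulus_bounds by (auto simp: k_def)
  have M: "M > 0" using jac_D_0_pos[OF s] by (simp add: M_def)
  have \<kappa>: "jac_C s 0 = k * M" by (simp add: jac_C_0_eq k_def M_def)
  have "k\<^sup>2 < 1" using k by (simp add: abs_square_less_1)
  then have k'2: "k'\<^sup>2 = 1 - k\<^sup>2" and k': "0 \<le> k'" "k' < 1" using k by (auto simp: k'_def)
  have cf: "continuous_on A f" for A unfolding f_def[abs_def] by (rule continuous_on_inverse_Delta[OF k'])
  have h0: "h y \<ge> 0" if "0 \<le> y" "y < s / 2" for y
  proof -
    have "(\<lambda>n. 2 * sinh (real (2 * n + 1) * y) / sinh (real (2 * n + 1) * (s / 2))) sums h y"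
      using ell_imaginary(4)[of y] that by (simp add: h_def)
    then show ?thesis
      by (rule sums_le[OF _ sums_zero, rotated]) (use that s in \<open>auto intro!: divide_nonneg_nonneg mult_nonneg_nonneg\<close>)
  qed
  have range: "\<psi> y \<in> {0..pi/2}" if "0 \<le> y" "y < s / 2" for y
    using h0[OF that] k M arctan_ubound[of "h y / (k * M)"] by (simp add: \<psi>_def)
  have int: "integral {0..\<psi> y} f = M * y" if y: "0 \<le> y" "y < s / 2" for y
    unfolding f_def[abs_def]
  proof (rule elliptic_amplitude[OF k' y(1)])
    show "\<psi> 0 = 0" by (simp add: \<psi>_def h_def)
    show "\<psi> ` {0..y} \<subseteq> {0..pi/2}" using range y by fastforce
    fix z assume z: "z \<in> {0..y}"
    then have z': "\<bar>z\<bar> < s / 2" using y by simp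
    define c d where "c = Re (ell_C s (\<i> * of_real z))" and "d = Re (ell_D s (\<i> * of_real z))"
    note * = ell_imaginary(5-8)[OF z', folded h_def c_def d_def, unfolded \<kappa>, folded M_def]
    have "(h has_real_derivative c * d) (at z within {0..y})"
      unfolding h_def[abs_def] c_def d_def by (rule ell_S_imaginary_deriv[OF z'])
    then have "(\<psi> has_real_derivative (c * d / (k * M)) / (1 + (h z / (k * M))\<^sup>2)) (at z within {0..y})"
      unfolding \<psi>_def[abs_def] using k M by (auto intro!: derivative_eq_intros simp: field_simps)
    moreover have "(c * d / (k * M)) / (1 + (h z / (k * M))\<^sup>2) = k * M * d / c"
    proof -
      have "1 + (h z / (k * M))\<^sup>2 = c\<^sup>2 / (k * M)\<^sup>2" unfolding *(3) using k M by (simp add: field_simps)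
      then show ?thesis using k M *(1) by (simp add: field_simps power2_eq_square)
    qed
    moreover have "k * M * d / c = M * sqrt (1 - k'\<^sup>2 * (sin (\<psi> z))\<^sup>2)"
    proof -
      have "(sin (\<psi> z))\<^sup>2 = (h z / (k * M))\<^sup>2 / (1 + (h z / (k * M))\<^sup>2)"
        unfolding \<psi>_def by (rule sin_arctan_power2)
      also have "\<dots> = (h z)\<^sup>2 / c\<^sup>2" unfolding *(3) using k M by (simp add: field_simps)
      finally have "1 - k'\<^sup>2 * (sin (\<psi> z))\<^sup>2 = (c\<^sup>2 - (1 - k\<^sup>2) * (h z)\<^sup>2) / c\<^sup>2"
        using *(1) by (simp add: k'2 field_simps)
      \<comment> \<open>Both relations have the same \<open>h\<^sup>2\<close>: the left side is
        \<open>k\<^sup>2 M\<^sup>2 + k\<^sup>2 h\<^sup>2\<close>, which is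
        \<open>k\<^sup>2 d\<^sup>2\<close>.\<close>
      also have "c\<^sup>2 - (1 - k\<^sup>2) * (h z)\<^sup>2 = (k * d)\<^sup>2"
        unfolding *(3) power_mult_distrib *(4) by (simp add: algebra_simps)
      finally have "1 - k'\<^sup>2 * (sin (\<psi> z))\<^sup>2 = (k * d / c)\<^sup>2" by (simp add: power_divide)
      then show ?thesis using k *(1,2) by simp
    qed
    ultimately show "(\<psi> has_real_derivative M * sqrt (1 - k'\<^sup>2 * (sin (\<psi> z))\<^sup>2)) (at z within {0..y})"
      by simp
  qed
  \<comment> \<open>Each of the first \<open>m\<close> terms tends to 2 and the others are
    nonnegative, so \<open>h\<close> eventually exceeds every bound below
    \<open>2 * m\<close>.\<close>
  have h_lim: "filterlim h at_top (at_left (s / 2))"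
  proof (rule filterlim_at_top[THEN iffD2], rule allI)
    fix Z :: real
    obtain m :: nat where m: "Z < 2 * real m" using reals_Archimedean2[of "Z / 2"] by (auto simp: field_simps)
    have "((\<lambda>y. \<Sum>n<m. 2 * sinh (real (2 * n + 1) * y) / sinh (real (2 * n + 1) * (s / 2))) \<longlongrightarrow>
        (\<Sum>n<m. 2 * sinh (real (2 * n + 1) * (s / 2)) / sinh (real (2 * n + 1) * (s / 2)))) (at_left (s / 2))"
      by (intro tendsto_intros) (use s in auto)
    moreover have "(\<Sum>n<m. 2 * sinh (real (2 * n + 1) * (s / 2)) / sinh (real (2 * n + 1) * (s / 2))) = 2 * real m"
      using s by (simp add: add_eq_0_iff)
    ultimately have lim: "((\<lambda>y. \<Sum>n<m. 2 * sinh (real (2 * n + 1) * y) / sinh (real (2 * n + 1) * (s / 2))) \<longlongrightarrow> 2 * real m) (at_left (s / 2))"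
      by (simp only:)
    have "eventually (\<lambda>y. (\<Sum>n<m. 2 * sinh (real (2 * n + 1) * y) / sinh (real (2 * n + 1) * (s / 2))) > Z) (at_left (s / 2))"
      by (rule order_tendstoD(1)[OF lim m])
    moreover have "eventually (\<lambda>y. y \<in> {0<..<s / 2}) (at_left (s / 2))"
      by (rule eventually_at_leftI[of 0]) (use s in auto)
    ultimately show "eventually (\<lambda>y. Z \<le> h y) (at_left (s / 2))"
    proof eventually_elim
      case (elim y)
      then have y: "\<bar>y\<bar> < s / 2" by auto
      note ss = ell_imaginary(4)[OF y, folded h_def]
      have "(\<Sum>n<m. 2 * sinh (real (2 * n + 1) * y) / sinh (real (2 * n + 1) * (s / 2))) \<le> h y"
        unfolding sums_unique[OF ss]
        by (rule sum_le_suminf) (use ss elim s in \<open>auto simp: sums_iff intro!: divide_nonneg_nonneg mult_nonneg_nonneg\<close>)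
      then show ?case using elim by simp
    qed
  qed
  have "filterlim (\<lambda>y. inverse (k * M) * h y) at_top (at_left (s / 2))"
    by (rule filterlim_tendsto_pos_mult_at_top[OF tendsto_const _ h_lim]) (use k M in simp)
  then have "filterlim (\<lambda>y. h y / (k * M)) at_top (at_left (s / 2))"
    by (simp only: divide_inverse mult.commute)
  then have \<psi>_lim: "(\<psi> \<longlongrightarrow> pi / 2) (at_left (s / 2))"
    unfolding \<psi>_def[abs_def] by (rule filterlim_compose[OF tendsto_arctan_at_top])
  have ev: "eventually (\<lambda>y. y \<in> {0<..<s / 2}) (at_left (s / 2))"
    by (rule eventually_at_leftI[of 0]) (use s in auto)
  have "continuous_on {0..pi/2} (\<lambda>t. integral {0..t} f)"
    by (rule indefinite_integral_continuous_1[OF integrable_continuous_real[OF cf]])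
  then have "((\<lambda>y. integral {0..\<psi> y} f) \<longlongrightarrow> integral {0..pi/2} f) (at_left (s / 2))"
    by (rule continuous_on_tendsto_compose[OF _ \<psi>_lim]) (simp, rule eventually_mono[OF ev], use range in simp)
  moreover have "((\<lambda>y. integral {0..\<psi> y} f) \<longlongrightarrow> M * (s / 2)) (at_left (s / 2))"
  proof (rule Lim_transform_eventually)
    show "((\<lambda>y. M * y) \<longlongrightarrow> M * (s / 2)) (at_left (s / 2))" by (intro tendsto_intros)
    show "eventually (\<lambda>y. M * y = integral {0..\<psi> y} f) (at_left (s / 2))"
      by (rule eventually_mono[OF ev]) (use int in auto)
  qed
  ultimately have "integral {0..pi/2} f = M * (s / 2)"
    using tendsto_unique[OF trivial_limit_at_left_real] by blast
  then show ?thesis using elliptic_K_trig[OF k'] by (simp add: f_def[abs_def] k'_def k_def M_def)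
qed

end

text \<open>\<open>K\<close> increases with the modulus while \<open>K\<close> of the complementary
  modulus decreases, so their ratio, which fixes the nome, determines the modulus. The ratios are
  compared by cross-multiplication in \<open>less\<close>.\<close>

lemma modulus_eqI:
  assumes k: "0 < k" "k < 1"
    and s: "s = pi * elliptic_K (sqrt (1 - k\<^sup>2)) / elliptic_K k"
  shows "s > 0" "modulus s = k"
proof -
  have c: "0 < sqrt (1 - x\<^sup>2)" "sqrt (1 - x\<^sup>2) < 1" if "0 < x" "x < 1" for x :: real
    using that by (auto simp: abs_square_less_1)
  show s0: "s > 0" unfolding s using elliptic_K_pos[of k] elliptic_K_pos[of "sqrt (1 - k\<^sup>2)"] k c[OF k] by simp
  define l where "l = modulus s"
  have l: "0 < l" "l < 1" using modulus_bounds[OF s0] by (auto simp: l_def)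
  define K where "K x = elliptic_K x" for x
  have K: "K x > 0" if "0 < x" "x < 1" for x using elliptic_K_pos that by (simp add: K_def)
  have "K (sqrt (1 - l\<^sup>2)) = K l * (s / pi)"
    unfolding K_def l_def elliptic_K_modulus[OF s0] elliptic_K_complementary_modulus[OF s0] by simp
  also have "s / pi = K (sqrt (1 - k\<^sup>2)) / K k" by (simp add: s K_def)
  finally have eq: "K (sqrt (1 - l\<^sup>2)) * K k = K l * K (sqrt (1 - k\<^sup>2))"
    using K[OF k] by (simp add: field_simps)
  have less: "K (sqrt (1 - y\<^sup>2)) * K x < K y * K (sqrt (1 - x\<^sup>2))" if "0 < x" "x < y" "y < 1" for x y
  proof -
    have "K x < K y" unfolding K_def using that by (intro elliptic_K_strict_mono) auto
    moreover have "K (sqrt (1 - y\<^sup>2)) < K (sqrt (1 - x\<^sup>2))"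
      unfolding K_def using that c[of x] c[of y] by (intro elliptic_K_strict_mono) (auto simp: power_strict_mono)
    ultimately show ?thesis
      using K[of x] K[OF c[of y]] that by (simp add: mult.commute mult_strict_mono)
  qed
  show "modulus s = k"
    using less[of k l] less[of l k] eq k l by (cases l k rule: linorder_cases) (auto simp: l_def mult.commute)
qed

section \<open>The half-angle formula\<close>

lemma continuous_on_arcsin_sin:
  fixes k :: real
  assumes "\<bar>k\<bar> < 1" shows "continuous_on A (\<lambda>t. arcsin (k * sin t))"
proof -
  have "\<bar>k * sin t\<bar> \<le> 1" for t using abs_mult_sin_less[OF assms, of t] by simp
  then show ?thesis by (intro continuous_intros) (auto simp: abs_le_iff minus_le_iff)
qed

lemma sine_series_sums_integral:
  assumes c: "summable (\<lambda>n. \<bar>c n\<bar>)" and g: "\<And>x. (\<lambda>n. c n * cos (real (2 * n + 1) * x)) sums g x" and x: "0 \<le> x"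
  shows "(\<lambda>n. c n / real (2 * n + 1) * sin (real (2 * n + 1) * x)) sums integral {0..x} g"
proof (rule has_integral_sums_uniform(2)[OF _ _ c g])
  fix n
  have "((\<lambda>t. c n * cos (real (2 * n + 1) * t)) has_integral
      c n / real (2 * n + 1) * sin (real (2 * n + 1) * x) - c n / real (2 * n + 1) * sin (real (2 * n + 1) * 0)) {0..x}"
    by (rule fundamental_theorem_of_calculus[OF x], rule has_real_derivative_iff_has_vector_derivative[THEN iffD1])
      (auto intro!: derivative_eq_intros simp del: of_nat_Suc of_nat_add of_nat_mult)
  then show "((\<lambda>t. c n * cos (real (2 * n + 1) * t)) has_integral c n / real (2 * n + 1) * sin (real (2 * n + 1) * x)) {0..x}"
    by simp
  show "\<bar>c n * cos (real (2 * n + 1) * t)\<bar> \<le> \<bar>c n\<bar>" for t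
    by (simp only: abs_mult mult_left_le abs_cos_le_one abs_ge_zero)
qed (intro continuous_intros)

lemma integral_flip:
  fixes f :: "real \<Rightarrow> real"
  assumes "0 \<le> b" "continuous_on {0..b} f"
  shows "integral {0..b} (\<lambda>x. f (b - x)) = integral {0..b} f"
proof -
  have d: "((\<lambda>x. b - x) has_field_derivative - 1) (at x within A)" for x A
    by (rule derivative_eq_intros refl)+ simp
  have sub: "(\<lambda>x. b - x) ` {0..b} \<subseteq> {0..b}" by auto
  \<comment> \<open>For a decreasing substitution the rule returns the difference over both
    orientations; \<open>{b..0}\<close> is empty or a single point and contributes nothing.\<close>
  have "((\<lambda>x. (-1) *\<^sub>R f (b - x)) has_integral (integral {b - 0..b - b} f - integral {b - b..b - 0} f)) {0..b}"
    by (rule has_integral_substitution_general[where g' = "\<lambda>_. - 1", OF finite.emptyI assms(1) sub assms(2) _ d])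
      (intro continuous_intros)
  moreover have "integral {b..0} f = 0"
    using assms(1) by (cases "b = 0") (simp_all add: integral_refl)
  ultimately have "((\<lambda>x. - f (b - x)) has_integral - integral {0..b} f) {0..b}"
    by (simp only: scaleR_minus_left scaleR_one diff_self diff_zero diff_0)
  from has_integral_neg[OF this] show ?thesis by (simp only: minus_minus integral_unique)
qed

context
  fixes s :: real
  assumes s: "s > 0"
begin

lemma jac_C_pos:
  assumes "0 \<le> x" "x < pi / 2" shows "jac_C s x > 0"
proof -
  have "0 \<le> amp s x" using amp_range[OF s, of x] assms by auto
  moreover have "amp s x < pi / 2" using amp_less[OF s assms] amp_half_pi[OF s] by simp
  ultimately have "cos (amp s x) > 0" by (intro cos_gt_zero_pi) auto
  then show ?thesis using jac_amp(2)[OF s assms(1)] jac_C_0_pos[OF s] by simp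
qed

lemma jac_S_nonneg:
  assumes "0 \<le> x" "x \<le> pi / 2" shows "jac_S s x \<ge> 0"
proof -
  have "amp s x \<in> {0..pi/2}" using amp_range[OF s, of x] assms by auto
  then have "sin (amp s x) \<ge> 0" by (intro sin_ge_zero) auto
  then show ?thesis using jac_amp(1)[OF s assms(1)] jac_C_0_pos[OF s] by simp
qed

text \<open>The duplication formula \<open>tan (am (2 z) / 2) = sn z dn z / cn z\<close>: twice the arctangent of the right-hand side
  satisfies the differential equation of the amplitude at doubled speed.\<close>

lemma jac_half_angle:
  assumes z: "0 \<le> z" "z \<le> pi / 4"
  defines "t \<equiv> amp s (2 * z)"
  shows "(jac_D s z)\<^sup>2 * (1 + cos t) = (jac_D s 0)\<^sup>2 * (sqrt (1 - (modulus s)\<^sup>2 * (sin t)\<^sup>2) + cos t)"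
proof -
  define M k where "M = jac_D s 0" and "k = modulus s"
  define w where "w x = jac_S s x * jac_D s x / (jac_C s x * M)" for x
  define \<theta> where "\<theta> x = 2 * arctan (w x)" for x
  \<comment> \<open>\<open>Q x / ((jac_C s x)\<^sup>2 * M\<^sup>2)\<close> is
    \<open>1 + (w x)\<^sup>2\<close> and \<open>P x / ((jac_C s x)\<^sup>2 * M)\<close> is the
    derivative of \<open>w\<close>. The equation for \<open>\<theta>\<close> then amounts to
    \<open>P x / Q x\<close> being the square root in it.\<close>
  define P where "P x = (jac_C s x)\<^sup>2 * (jac_D s x)\<^sup>2 - (jac_S s x)\<^sup>2 * (jac_C s x)\<^sup>2 + (jac_S s x)\<^sup>2 * (jac_D s x)\<^sup>2" for x
  define Q where "Q x = (jac_C s x)\<^sup>2 * M\<^sup>2 + (jac_S s x)\<^sup>2 * (jac_D s x)\<^sup>2" for x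
  have M: "M > 0" using jac_D_0_pos[OF s] by (simp add: M_def)
  have k: "0 < k" "k < 1" using modulus_bounds[OF s] by (auto simp: k_def)
  note D = jac_D_pos[OF s]
  have rel: "(jac_S s x)\<^sup>2 + (jac_C s x)\<^sup>2 = (k * M)\<^sup>2" "(jac_S s x)\<^sup>2 + (jac_D s x)\<^sup>2 = M\<^sup>2" for x
    using jac_quadratic_relations[OF s, of x] by (simp_all add: k_def M_def jac_C_0_eq[OF s])
  have C: "jac_C s x > 0" if "x \<in> {0..z}" for x
  proof (rule jac_C_pos)
    show "0 \<le> x" "x < pi / 2" using that z(2) pi_gt_zero unfolding atLeastAtMost_iff by linarith+
  qed
  have Q: "Q x > 0" if "x \<in> {0..z}" for x
    unfolding Q_def using C[OF that] M by (intro add_pos_nonneg) auto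
  \<comment> \<open>Here \<open>D\<^sup>2 - C\<^sup>2\<close> is the constant
    \<open>M\<^sup>2 - (k * M)\<^sup>2\<close>. Positivity makes \<open>P x / Q x\<close> the root
    itself rather than its negative.\<close>
  have P: "P x > 0" if "x \<in> {0..z}" for x
  proof -
    have "P x = (jac_C s x)\<^sup>2 * (jac_D s x)\<^sup>2 + (jac_S s x)\<^sup>2 * (M\<^sup>2 - (k * M)\<^sup>2)"
      unfolding rel[of x, symmetric] P_def by (simp add: algebra_simps)
    moreover have "(k * M)\<^sup>2 \<le> M\<^sup>2" using k M by (intro power_mono) auto
    ultimately show ?thesis using C[OF that] D[of x] by (simp add: add_pos_nonneg)
  qed
  have w2: "1 + (w x)\<^sup>2 = Q x / ((jac_C s x)\<^sup>2 * M\<^sup>2)" if "x \<in> {0..z}" for x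
    using C[OF that] M by (simp add: w_def Q_def power_divide power_mult_distrib add_divide_distrib)
  have sin\<theta>: "sin (\<theta> x) = 2 * jac_S s x * jac_D s x * jac_C s x * M / Q x" if "x \<in> {0..z}" for x
  proof -
    have "sin (\<theta> x) = 2 * w x / (1 + (w x)\<^sup>2)"
      by (simp add: \<theta>_def sin_double sin_arctan cos_arctan flip: power2_eq_square)
    then show ?thesis unfolding w2[OF that] using C[OF that] M by (simp add: w_def power2_eq_square)
  qed
  have cos\<theta>: "cos (\<theta> x) = ((jac_C s x)\<^sup>2 * M\<^sup>2 - (jac_S s x)\<^sup>2 * (jac_D s x)\<^sup>2) / Q x" if "x \<in> {0..z}" for x
  proof -
    have "cos (\<theta> x) = (1 - (w x)\<^sup>2) / (1 + (w x)\<^sup>2)"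
      by (simp add: \<theta>_def cos_double sin_arctan cos_arctan power_divide diff_divide_distrib)
    moreover have "1 - (w x)\<^sup>2 = ((jac_C s x)\<^sup>2 * M\<^sup>2 - (jac_S s x)\<^sup>2 * (jac_D s x)\<^sup>2) / ((jac_C s x)\<^sup>2 * M\<^sup>2)"
      using C[OF that] M by (simp add: w_def power_divide power_mult_distrib diff_divide_distrib)
    ultimately show ?thesis unfolding w2[OF that] using C[OF that] M by simp
  qed
  have \<Delta>: "sqrt (1 - k\<^sup>2 * (sin (\<theta> x))\<^sup>2) = P x / Q x" if "x \<in> {0..z}" for x
  proof -
    have "(Q x)\<^sup>2 - k\<^sup>2 * (2 * jac_S s x * jac_D s x * jac_C s x * M)\<^sup>2 = (P x)\<^sup>2"
      using rel[of x] unfolding P_def Q_def by algebra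
    moreover have "1 - k\<^sup>2 * (Y / Q x)\<^sup>2 = ((Q x)\<^sup>2 - k\<^sup>2 * Y\<^sup>2) / (Q x)\<^sup>2" for Y
      using Q[OF that] by (simp add: power_divide diff_divide_distrib)
    ultimately have "1 - k\<^sup>2 * (sin (\<theta> x))\<^sup>2 = (P x / Q x)\<^sup>2"
      unfolding sin\<theta>[OF that] by (simp only: power_divide)
    then show ?thesis using P[OF that] Q[OF that] by simp
  qed
  have "integral {0..\<theta> z} (\<lambda>t. 1 / sqrt (1 - k\<^sup>2 * (sin t)\<^sup>2)) = (2 * M) * z"
  proof (rule elliptic_amplitude[where c = pi])
    show "\<theta> 0 = 0" by (simp add: \<theta>_def w_def jac_S_0[OF s])
    show "\<theta> ` {0..z} \<subseteq> {0..pi}"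
    proof (rule image_subsetI)
      fix x assume x: "x \<in> {0..z}"
      have "w x \<ge> 0" using jac_S_nonneg[of x] D[of x] C[OF x] M x z by (simp add: w_def)
      then show "\<theta> x \<in> {0..pi}" using arctan_ubound[of "w x"] by (simp add: \<theta>_def)
    qed
    fix x assume x: "x \<in> {0..z}"
    have "(w has_real_derivative P x / ((jac_C s x)\<^sup>2 * M)) (at x within {0..z})"
    proof -
      have "((\<lambda>x. jac_S s x * jac_D s x) has_real_derivative
          jac_C s x * jac_D s x * jac_D s x + - (jac_S s x * jac_C s x) * jac_S s x) (at x within {0..z})"
        by (rule DERIV_mult[OF jac_deriv(3)[OF s] jac_deriv(1)[OF s]])
      note d = DERIV_divide[OF this DERIV_cmult_right[OF jac_deriv(2)[OF s], of M]]
      show ?thesis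
        unfolding w_def[abs_def]
        by (rule DERIV_cong[OF d]) (use C[OF x] M in \<open>auto simp: P_def field_simps power2_eq_square\<close>)
    qed
    from DERIV_cmult[OF DERIV_chain2[OF DERIV_arctan this], of 2]
    have "(\<theta> has_real_derivative 2 * (inverse (1 + (w x)\<^sup>2) * (P x / ((jac_C s x)\<^sup>2 * M)))) (at x within {0..z})"
      by (simp add: \<theta>_def[abs_def])
    moreover have "2 * (inverse (1 + (w x)\<^sup>2) * (P x / ((jac_C s x)\<^sup>2 * M))) = 2 * M * sqrt (1 - k\<^sup>2 * (sin (\<theta> x))\<^sup>2)"
      unfolding w2[OF x] \<Delta>[OF x] using C[OF x] M Q[OF x] by (simp add: field_simps power2_eq_square)
    ultimately show "(\<theta> has_real_derivative 2 * M * sqrt (1 - k\<^sup>2 * (sin (\<theta> x))\<^sup>2)) (at x within {0..z})" by simp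
  qed (use k z in auto)
  also have "(2 * M) * z = integral {0..t} (\<lambda>t. 1 / sqrt (1 - k\<^sup>2 * (sin t)\<^sup>2))"
    using amp_integral[OF s, of "2 * z"] z by (simp add: t_def M_def k_def)
  finally have eq: "integral {0..\<theta> z} (\<lambda>t. 1 / sqrt (1 - k\<^sup>2 * (sin t)\<^sup>2)) = integral {0..t} (\<lambda>t. 1 / sqrt (1 - k\<^sup>2 * (sin t)\<^sup>2))" .
  have t0: "t \<ge> 0" using amp_range[OF s, of "2 * z"] z by (auto simp: t_def)
  have \<theta>0: "\<theta> z \<ge> 0" using jac_S_nonneg[of z] D[of z] C[of z] M z by (simp add: \<theta>_def w_def)
  have pos: "1 / sqrt (1 - k\<^sup>2 * (sin t)\<^sup>2) > 0" for t using Delta_pos[of k t] k by simp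
  have "continuous_on A (\<lambda>t. 1 / sqrt (1 - k\<^sup>2 * (sin t)\<^sup>2))" for A
    using continuous_on_inverse_Delta k by simp
  note less = indefinite_integral_less[OF this pos]
  \<comment> \<open>The integrand is positive, so equal elliptic integrals force equal upper
    limits.\<close>
  have "\<theta> z = t"
    using less[OF \<theta>0, of t] less[OF t0, of "\<theta> z"] eq by (cases "\<theta> z" t rule: linorder_cases) auto
  have z': "z \<in> {0..z}" using z by simp
  \<comment> \<open>This is the claim multiplied by \<open>Q z\<close>, with the values of cosine
    and root inserted; both sides equal twice the product of the squares of \<open>C\<close>,
    \<open>D\<close> and \<open>M\<close>.\<close>
  have "(jac_D s z)\<^sup>2 * (Q z + ((jac_C s z)\<^sup>2 * M\<^sup>2 - (jac_S s z)\<^sup>2 * (jac_D s z)\<^sup>2))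
      = M\<^sup>2 * (P z + ((jac_C s z)\<^sup>2 * M\<^sup>2 - (jac_S s z)\<^sup>2 * (jac_D s z)\<^sup>2))"
    using rel(2)[of z] unfolding P_def Q_def by algebra
  then have "(jac_D s z)\<^sup>2 * (1 + cos (\<theta> z)) = M\<^sup>2 * (sqrt (1 - k\<^sup>2 * (sin (\<theta> z))\<^sup>2) + cos (\<theta> z))"
    unfolding \<Delta>[OF z'] cos\<theta>[OF z'] using Q[OF z'] by (simp add: field_simps)
  then show ?thesis by (simp add: \<open>\<theta> z = t\<close> M_def k_def)
qed

lemma amp_substitution:
  assumes "continuous_on {0..pi/2} h"
  shows "integral {0..pi/2} (\<lambda>x. h (amp s x) * jac_D s x) = integral {0..pi/2} h"
proof -
  have "((\<lambda>x. jac_D s x *\<^sub>R h (amp s x)) has_integral (integral {amp s 0..amp s (pi / 2)} h)) {0..pi/2}"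
    by (rule has_integral_substitution[OF _ _ _ assms amp_deriv[OF s]]) (use amp_range[OF s] amp_0[OF s] amp_half_pi[OF s] in auto)
  then show ?thesis by (simp add: integral_unique amp_0[OF s] amp_half_pi[OF s] mult.commute)
qed

lemma jac_D_half_pi: "jac_D s (pi / 2) = jac_D s 0 * sqrt (1 - (modulus s)\<^sup>2)"
  using jac_D_amp[OF s, of "pi / 2"] amp_half_pi[OF s] by simp

lemma jac_D_flip: "jac_D s (pi / 2 - x) = (jac_D s 0)\<^sup>2 * sqrt (1 - (modulus s)\<^sup>2) / jac_D s x"
  using jac_D_mult_shift[OF s, of "- x"] jac_D_pos[OF s, of x]
  by (simp add: jac_symmetries[OF s] jac_D_half_pi power2_eq_square field_simps)

text \<open>The derivative of the arcsine has the root of the amplitude equation in its denominator,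
  and the speed \<open>jac_D s x\<close> of the amplitude cancels it up to the factor
  \<open>M\<close>.\<close>

lemma integral_jac_C:
  assumes x: "x \<in> {0..pi/2}"
  shows "integral {0..x} (jac_C s) = arcsin (modulus s * sin (amp s x))"
proof -
  have k: "\<bar>modulus s\<bar> < 1" using modulus_bounds[OF s] by simp
  have "integral {0..x} (jac_C s) = arcsin (modulus s * sin (amp s x)) - arcsin (modulus s * sin (amp s 0))"
  proof (rule integral_eq_antiderivative)
    fix t assume t: "t \<in> {0..x}"
    define d where "d = sqrt (1 - (modulus s)\<^sup>2 * (sin (amp s t))\<^sup>2)"
    have d: "d > 0" using Delta_pos_abs[OF k] by (simp add: d_def)
    have 1: "((\<lambda>t. modulus s * sin (amp s t)) has_real_derivative modulus s * (cos (amp s t) * jac_D s t)) (at t within {0..x})"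
      by (intro DERIV_cmult DERIV_chain2[OF DERIV_sin amp_deriv[OF s t]])
    have "\<bar>modulus s * sin (amp s t)\<bar> < 1" by (rule abs_mult_sin_less[OF k])
    then have "(arcsin has_real_derivative inverse d) (at (modulus s * sin (amp s t)))"
      unfolding d_def power_mult_distrib[symmetric] by (intro DERIV_arcsin) auto
    from DERIV_chain2[OF this 1]
    have "((\<lambda>t. arcsin (modulus s * sin (amp s t))) has_real_derivative inverse d * (modulus s * (cos (amp s t) * jac_D s t))) (at t within {0..x})" .
    moreover have "inverse d * (modulus s * (cos (amp s t) * jac_D s t)) = jac_C s t"
      using jac_D_amp[OF s, of t] jac_amp(2)[OF s, of t] t d by (simp add: d_def[symmetric] jac_C_0_eq[OF s])
    ultimately show "((\<lambda>t. arcsin (modulus s * sin (amp s t))) has_real_derivative jac_C s t) (at t within {0..x})" by simp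
  qed (use x in simp)
  then show ?thesis by (simp add: amp_0[OF s])
qed

text \<open>Classically \<open>sn (K - u) = cn u / dn u\<close>. With \<open>u\<close> the argument
  of the arcsine, the flip of \<open>D\<close> gives \<open>1 - u\<^sup>2 = l\<^sup>2 / (1 -
  k\<^sup>2 sin\<^sup>2 (amp s x))\<close>, from which the tangent of \<open>arcsin u\<close> is
  read off.\<close>

lemma arcsin_amp_flip:
  assumes x: "x \<in> {0..pi/2}"
  shows "arcsin (modulus s * sin (amp s (pi / 2 - x))) = arctan (modulus s / sqrt (1 - (modulus s)\<^sup>2) * cos (amp s x))"
proof -
  define k M l where "k = modulus s" and "M = jac_D s 0" and "l = sqrt (1 - k\<^sup>2)"
  have k: "0 < k" "k < 1" using modulus_bounds[OF s] by (auto simp: k_def)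
  have M: "M > 0" using jac_D_0_pos[OF s] by (simp add: M_def)
  have "k\<^sup>2 < 1" using k by (simp add: abs_square_less_1)
  then have l: "l > 0" "l\<^sup>2 = 1 - k\<^sup>2" by (simp_all add: l_def)
  define u where "u = k * sin (amp s (pi / 2 - x))"
  have S: "jac_S s (pi / 2 - x) = M * u"
    using jac_amp(1)[OF s, of "pi / 2 - x"] x by (simp add: u_def jac_C_0_eq[OF s] k_def M_def)
  have u0: "u \<ge> 0" using jac_S_nonneg[of "pi / 2 - x"] x M by (simp add: S zero_le_mult_iff)
  have "\<bar>u\<bar> < 1" unfolding u_def by (rule abs_mult_sin_less) (use k in simp)
  then have u1: "-1 < u" "u < 1" by auto
  have c0: "cos (amp s x) \<ge> 0" using amp_range[OF s x] by (intro cos_ge_zero) auto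
  have D: "(jac_D s x)\<^sup>2 = M\<^sup>2 * (1 - k\<^sup>2 * (sin (amp s x))\<^sup>2)"
    using jac_D_amp[OF s, of x] x Delta_pos[of k "amp s x"] k by (simp add: M_def k_def power_mult_distrib)
  have D': "1 - k\<^sup>2 * (sin (amp s x))\<^sup>2 > 0" using Delta_pos[of k "amp s x"] k by simp
  have "(M * u)\<^sup>2 + (jac_D s (pi / 2 - x))\<^sup>2 = M\<^sup>2"
    using jac_quadratic_relations(2)[OF s, of "pi / 2 - x"] by (simp add: S M_def)
  moreover have "(jac_D s (pi / 2 - x))\<^sup>2 = M\<^sup>2 * (l\<^sup>2 / (1 - k\<^sup>2 * (sin (amp s x))\<^sup>2))"
    unfolding jac_D_flip[folded k_def M_def, folded l_def] power_divide D
    using M D' by (simp add: power_mult_distrib power2_eq_square)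
  ultimately have "M\<^sup>2 * (u\<^sup>2 + l\<^sup>2 / (1 - k\<^sup>2 * (sin (amp s x))\<^sup>2)) = M\<^sup>2"
    by (simp add: power_mult_distrib distrib_left)
  then have "u\<^sup>2 + l\<^sup>2 / (1 - k\<^sup>2 * (sin (amp s x))\<^sup>2) = 1" using M by simp
  then have 1: "1 - u\<^sup>2 = l\<^sup>2 / (1 - k\<^sup>2 * (sin (amp s x))\<^sup>2)" by simp
  have "u\<^sup>2 / (1 - u\<^sup>2) = 1 / (1 - u\<^sup>2) - 1" using u1 by (simp add: field_simps abs_square_eq_1)
  also have "\<dots> = (k / l * cos (amp s x))\<^sup>2"
    unfolding 1 using l D' by (simp add: power_mult_distrib power_divide cos_squared_eq field_simps)
  finally have "(u / sqrt (1 - u\<^sup>2))\<^sup>2 = (k / l * cos (amp s x))\<^sup>2"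
    using u0 u1 by (simp add: power_divide abs_square_le_1)
  \<comment> \<open>Both sides are nonnegative because the amplitude stays in the first quadrant, so
    the squares may be removed.\<close>
  then have "u / sqrt (1 - u\<^sup>2) = k / l * cos (amp s x)"
    using u0 u1 k l c0 by (subst (asm) power2_eq_iff_nonneg) (auto simp: abs_square_le_1)
  moreover have "arcsin u = arctan (u / sqrt (1 - u\<^sup>2))" by (rule arcsin_arctan[OF u1])
  ultimately show ?thesis by (simp add: u_def k_def l_def)
qed

end

section \<open>The three Lambert-type series\<close>

lemma Li2_odd_part:
  assumes "norm z \<le> 1"
  shows "(\<lambda>n. 2 * z ^ (2 * n + 1) / of_nat (2 * n + 1) ^ 2) sums (Li2 z - Li2 (- z))"
proof -
  have Li2: "(\<lambda>n. w ^ Suc n / of_nat (Suc n) ^ 2) sums Li2 w" if "norm w \<le> 1" for w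
    unfolding Li2_def
  proof (rule summable_sums, rule summable_comparison_test'[OF summable_inverse_squares])
    show "norm (w ^ Suc n / of_nat (Suc n) ^ 2) \<le> 1 / real (n + 1) ^ 2" for n
    proof -
      have "norm (w ^ Suc n) \<le> 1" unfolding norm_power by (rule power_le_one) (use that in auto)
      then show ?thesis by (simp add: norm_divide norm_power divide_right_mono del: power_Suc of_nat_Suc)
    qed
  qed
  define h where "h n = z ^ Suc n / of_nat (Suc n) ^ 2 - (- z) ^ Suc n / of_nat (Suc n) ^ 2" for n
  have "h sums (Li2 z - Li2 (- z))"
    unfolding h_def[abs_def] using assms by (intro sums_diff Li2) auto
  moreover have "strict_mono (\<lambda>n::nat. 2 * n)" by (simp add: strict_mono_def)
  moreover have "h n = 0" if "n \<notin> range (\<lambda>n::nat. 2 * n)" for n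
  proof -
    have "even (Suc n)" using that by (auto elim: evenE)
    then show ?thesis by (simp add: h_def del: power_Suc)
  qed
  ultimately have "(\<lambda>n. h (2 * n)) sums (Li2 z - Li2 (- z))"
    using sums_mono_reindex[of "\<lambda>n::nat. 2 * n" h] by blast
  moreover have "h (2 * n) = 2 * z ^ (2 * n + 1) / of_nat (2 * n + 1) ^ 2" for n
    by (simp add: h_def)
  ultimately show ?thesis by simp
qed

lemma Li2_odd_part_real:
  assumes "\<bar>x\<bar> \<le> 1"
  shows "Li2 (of_real x) - Li2 (- of_real x) = of_real (2 * odd_dilog 1 x)"
proof -
  have "(\<lambda>n. complex_of_real (2 * (1 ^ n * x ^ (2 * n + 1) / real (2 * n + 1) ^ 2))) sums of_real (2 * odd_dilog 1 x)"
    by (intro sums_of_real sums_mult odd_dilog_sums assms) simp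
  moreover have "(\<lambda>n. 2 * complex_of_real x ^ (2 * n + 1) / of_nat (2 * n + 1) ^ 2) sums (Li2 (of_real x) - Li2 (- of_real x))"
    by (rule Li2_odd_part) (use assms in simp)
  moreover have "complex_of_real (2 * (1 ^ n * x ^ (2 * n + 1) / real (2 * n + 1) ^ 2)) = 2 * complex_of_real x ^ (2 * n + 1) / of_nat (2 * n + 1) ^ 2" for n
    by simp
  ultimately show ?thesis by (simp only: sums_unique2)
qed

lemma Li2_odd_part_imaginary:
  assumes "\<bar>x\<bar> \<le> 1"
  shows "Li2 (\<i> * of_real x) - Li2 (- (\<i> * of_real x)) = \<i> * of_real (2 * odd_dilog (-1) x)"
proof -
  have "(\<lambda>n. \<i> * complex_of_real (2 * ((-1) ^ n * x ^ (2 * n + 1) / real (2 * n + 1) ^ 2))) sums (\<i> * of_real (2 * odd_dilog (-1) x))"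
    by (intro sums_of_real sums_mult odd_dilog_sums assms) simp
  moreover have "(\<lambda>n. 2 * (\<i> * complex_of_real x) ^ (2 * n + 1) / of_nat (2 * n + 1) ^ 2) sums (Li2 (\<i> * of_real x) - Li2 (- (\<i> * of_real x)))"
    by (rule Li2_odd_part) (use assms in \<open>simp add: norm_mult\<close>)
  moreover have "\<i> * complex_of_real (2 * ((-1) ^ n * x ^ (2 * n + 1) / real (2 * n + 1) ^ 2)) = 2 * (\<i> * complex_of_real x) ^ (2 * n + 1) / of_nat (2 * n + 1) ^ 2" for n
    by (simp add: power_mult_distrib power_mult power_minus[of "(complex_of_real x)\<^sup>2"])
  ultimately show ?thesis by (simp only: sums_unique2)
qed

lemma odd_dilog_catalan: "odd_dilog (-1) 1 = catalan_G"
  by (simp add: odd_dilog_def catalan_G_def)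

text \<open>The integral yields one series over \<open>n\<close>; splitting it requires convergence
  of the parts. The denominators \<open>E n m\<close> are odd integers, hence at least 1 in absolute
  value, so the inner series is dominated by that of \<open>b\<close>. The double sum stays iterated
  throughout.\<close>

lemma double_sum_eq:
  fixes a b :: "nat \<Rightarrow> real"
  assumes a: "summable (\<lambda>n. \<bar>a n\<bar>)" and b: "summable (\<lambda>m. \<bar>b m\<bar>)"
    and J: "(\<lambda>n. 4 * a n / real (2 * n + 1) * (1 / real (2 * n + 1)
        + (\<Sum>m. 4 * b m * (real (2 * n + 1) / (real (2 * n + 1) ^ 2 - real (2 * Suc m) ^ 2))))) sums J"
  shows "(\<Sum>n. 1 / real (2 * n + 1) ^ 2 * a n)
    + 4 * (\<Sum>n. \<Sum>m. 1 / (real (2 * n + 1) ^ 2 - real (2 * Suc m) ^ 2) * (a n * b m)) = J / 4"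
proof -
  define E where "E n m = real (2 * n + 1) ^ 2 - real (2 * Suc m) ^ 2" for n m
  have E1: "\<bar>1 / E n m\<bar> \<le> 1" for n m
  proof -
    define z where "z = int (2 * n + 1) ^ 2 - int (2 * Suc m) ^ 2"
    have "odd z" by (simp add: z_def)
    then have "\<bar>z\<bar> \<ge> 1" by (cases "z = 0") auto
    moreover have "E n m = real_of_int z" by (simp add: E_def z_def)
    ultimately have "\<bar>E n m\<bar> \<ge> 1" by (metis of_int_1_le_iff of_int_abs)
    then show ?thesis by (simp add: abs_divide divide_le_eq)
  qed
  have sm: "summable (\<lambda>m. 1 / E n m * b m)" for n
  proof (rule summable_comparison_test'[OF b])
    show "norm (1 / E n m * b m) \<le> \<bar>b m\<bar>" for m
      using mult_right_mono[OF E1[of n m], of "\<bar>b m\<bar>"] by (simp only: real_norm_def abs_mult mult_1_left abs_ge_zero)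
  qed
  have inner: "(\<Sum>m. 4 * b m * (real (2 * n + 1) / E n m)) = 4 * real (2 * n + 1) * (\<Sum>m. 1 / E n m * b m)" for n
    unfolding suminf_mult[OF sm, symmetric] by (rule arg_cong[of _ _ suminf]) (simp add: fun_eq_iff)
  have X: "summable (\<lambda>n. 1 / real (2 * n + 1) ^ 2 * a n)"
  proof (rule summable_comparison_test'[OF a])
    fix n
    have "1 / real (2 * n + 1) ^ 2 \<le> 1" by simp
    then show "norm (1 / real (2 * n + 1) ^ 2 * a n) \<le> \<bar>a n\<bar>"
      using mult_right_mono[of "1 / real (2 * n + 1) ^ 2" 1 "\<bar>a n\<bar>"] by (simp add: abs_mult)
  qed
  define Y where "Y n = (\<Sum>m. 1 / E n m * (a n * b m))" for n
  have Y: "Y n = a n * (\<Sum>m. 1 / E n m * b m)" for n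
    unfolding Y_def suminf_mult[OF sm, symmetric] by (rule arg_cong[of _ _ suminf]) (simp add: fun_eq_iff)
  have "4 * a n / real (2 * n + 1) * (1 / real (2 * n + 1) + (\<Sum>m. 4 * b m * (real (2 * n + 1) / E n m)))
      = 4 * (1 / real (2 * n + 1) ^ 2 * a n + 4 * Y n)" for n
  proof -
    have e: "4 * A / N * (1 / N + 4 * N * S) = 4 * (1 / N ^ 2 * A + 4 * (A * S))" if "N \<noteq> 0" for A N S :: real
      using that by (simp add: field_simps power2_eq_square)
    show ?thesis unfolding inner Y by (rule e) simp
  qed
  with J have "(\<lambda>n. 4 * (1 / real (2 * n + 1) ^ 2 * a n + 4 * Y n)) sums J" by (simp only: E_def)
  have q: "4 * z / 4 = z" for z :: real by simp
  from sums_divide[OF \<open>(\<lambda>n. 4 * (1 / real (2 * n + 1) ^ 2 * a n + 4 * Y n)) sums J\<close>, of 4] have 1: "(\<lambda>n. 1 / real (2 * n + 1) ^ 2 * a n + 4 * Y n) sums (J / 4)"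
    by (simp only: q)
  from sums_diff[OF this summable_sums[OF X]]
  have "(\<lambda>n. 4 * Y n) sums (J / 4 - (\<Sum>n. 1 / real (2 * n + 1) ^ 2 * a n))" by simp
  from sums_divide[OF this, of 4] have "Y sums ((J / 4 - (\<Sum>n. 1 / real (2 * n + 1) ^ 2 * a n)) / 4)" by simp
  then have "suminf Y = (J / 4 - (\<Sum>n. 1 / real (2 * n + 1) ^ 2 * a n)) / 4" by (simp add: sums_iff)
  then show ?thesis by (simp add: Y_def[abs_def] E_def[abs_def])
qed

text \<open>\<open>a\<close> and \<open>b\<close> hold halved hyperbolic quotients up to sign, which
  is what the quotients in \<open>q\<close> are. The coefficients of the real series are twice the
  full quotients, hence the factor 4; the divisor \<open>2 * n + 1\<close> comes from one
  integration.\<close>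

lemma double_sum_integral:
  fixes a b :: "nat \<Rightarrow> real"
  assumes a: "summable (\<lambda>n. \<bar>a n\<bar>)" and b: "summable (\<lambda>m. \<bar>b m\<bar>)"
    and f: "\<And>x. x \<in> {0..pi/2} \<Longrightarrow> (\<lambda>n. 4 * a n / real (2 * n + 1) * sin (real (2 * n + 1) * x)) sums f x"
    and g: "\<And>x. x \<in> {0..pi/2} \<Longrightarrow> (\<lambda>m. 4 * b m * cos (real (2 * Suc m) * x)) sums (g x - 1)"
  shows "(\<Sum>n. 1 / real (2 * n + 1) ^ 2 * a n)
    + 4 * (\<Sum>n. \<Sum>m. 1 / (real (2 * n + 1) ^ 2 - real (2 * Suc m) ^ 2) * (a n * b m))
    = integral {0..pi/2} (\<lambda>x. f x * g x) / 4"
proof (rule double_sum_eq[OF a b integral_sine_cosine_series[OF _ _ f g]])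
  show "summable (\<lambda>n. \<bar>4 * a n / real (2 * n + 1)\<bar>)"
  proof (rule summable_comparison_test'[OF summable_mult[OF a, of 4]])
    fix n
    have "\<bar>4 * a n\<bar> / real (2 * n + 1) \<le> \<bar>4 * a n\<bar> / 1" by (intro divide_left_mono) auto
    then show "norm \<bar>4 * a n / real (2 * n + 1)\<bar> \<le> 4 * \<bar>a n\<bar>" by (simp add: abs_mult)
  qed
  show "summable (\<lambda>m. \<bar>4 * b m\<bar>)" using summable_mult[OF b, of 4] by (simp add: abs_mult)
qed

lemma cos_even_shift: "cos (real (2 * m) * (pi / 2 - x)) = (-1) ^ m * cos (real (2 * m) * x)"
proof -
  have "real (2 * m) * (pi / 2 - x) = real m * pi - real (2 * m) * x" by (simp add: algebra_simps)
  then show ?thesis by (simp only: cos_diff cos_npi sin_npi mult_zero_left add_0_right)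
qed

lemma sin_odd_shift: "sin (real (2 * n + 1) * (x + pi / 2)) = (-1) ^ n * cos (real (2 * n + 1) * x)"
proof -
  have "real (2 * n + 1) * (x + pi / 2) = real (2 * n + 1) * x + real n * pi + pi / 2" by (simp add: algebra_simps)
  then have "sin (real (2 * n + 1) * (x + pi / 2)) = cos (real (2 * n + 1) * x + real n * pi)"
    by (simp add: sin_add)
  then show ?thesis by (simp only: cos_add cos_npi sin_npi) simp
qed

context
  fixes s :: real
  assumes s: "s > 0"
begin

text \<open>At \<open>x = 0\<close> all cosines are 1, so convergence of the series for
  \<open>C\<close> and \<open>D\<close> there is already absolute summability.\<close>

lemma summable_inverse_cosh:
  "summable (\<lambda>n. \<bar>1 / (2 * cosh (real (2 * n + 1) * (s / 2)))\<bar>)"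
  "summable (\<lambda>m. \<bar>e ^ Suc m * (1 / (2 * cosh (real (Suc m) * s)))\<bar>)" if "\<bar>e\<bar> = 1"
proof -
  from sums_divide[OF jac_sums(2)[OF s, of 0], of 4]
  show "summable (\<lambda>n. \<bar>1 / (2 * cosh (real (2 * n + 1) * (s / 2)))\<bar>)"
    by (simp add: sums_iff abs_mult cosh_real_pos)
  have "\<bar>e ^ Suc m * (1 / (2 * cosh (real (Suc m) * s)))\<bar> = 1 / (2 * cosh (real (Suc m) * s))" for m
    unfolding abs_mult power_abs that power_one using cosh_real_pos[of "real (Suc m) * s"] by simp
  with sums_divide[OF jac_sums(1)[OF s, of 0], of 4]
  show "summable (\<lambda>m. \<bar>e ^ Suc m * (1 / (2 * cosh (real (Suc m) * s)))\<bar>)"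
    by (simp only: sums_iff) simp
qed

text \<open>The sine series vanishes at 0 and gives no information there; a geometric majorant takes
  its place.\<close>

lemma summable_inverse_sinh: "summable (\<lambda>n. \<bar>(-1) ^ n * (1 / (2 * sinh (real (2 * n + 1) * s)))\<bar>)"
proof -
  define C where "C = 2 / (1 - exp (- 2 * s))"
  have g: "summable (\<lambda>n. C * exp (- s) ^ n)"
    using s by (intro summable_mult summable_geometric) auto
  have C: "C \<ge> 0" using s by (simp add: C_def)
  have half: "z / 2 \<le> z" if "0 \<le> z" for z :: real using that by simp
  show ?thesis
  proof (rule summable_comparison_test'[OF g])
    fix n :: nat
    define y where "y = real (2 * n + 1) * s"
    have "s * 1 \<le> s * real (2 * n + 1)" using s by (intro mult_left_mono) auto
    then have y: "\<bar>y\<bar> \<ge> s" "real n * s \<le> \<bar>y\<bar>" using s by (simp_all add: y_def abs_mult algebra_simps)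
    have "\<bar>(-1) ^ n * (1 / (2 * sinh y))\<bar> = \<bar>1 / sinh y\<bar> / 2" by (simp add: abs_mult)
    also have "\<dots> \<le> \<bar>1 / sinh y\<bar>"
      by (rule half[OF abs_ge_zero])
    also have "\<dots> \<le> C * exp (- \<bar>y\<bar>)" unfolding C_def by (rule csch_le[OF s y(1)])
    also have "\<dots> \<le> C * exp (- (real n * s))" using C y(2) by (intro mult_left_mono) auto
    also have "exp (- (real n * s)) = exp (- s) ^ n" by (simp flip: exp_of_nat_mult)
    finally show "norm \<bar>(-1) ^ n * (1 / (2 * sinh (real (2 * n + 1) * s)))\<bar> \<le> C * exp (- s) ^ n"
      by (simp add: y_def)
  qed
qed

text \<open>The factor \<open>1 ^ Suc m\<close> keeps the form of
  \<open>summable_inverse_cosh(2)\<close> at \<open>e = 1\<close>; the reflected series has the same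
  form at \<open>e = -1\<close>.\<close>

lemma jac_D_series: "(\<lambda>m. 4 * (1 ^ Suc m * (1 / (2 * cosh (real (Suc m) * s)))) * cos (real (2 * Suc m) * x)) sums (jac_D s x - 1)"
  using jac_sums(1)[OF s, of x] by (simp add: mult.commute)

lemma jac_D_flip_series: "(\<lambda>m. 4 * ((-1) ^ Suc m * (1 / (2 * cosh (real (Suc m) * s)))) * cos (real (2 * Suc m) * x)) sums (jac_D s (pi / 2 - x) - 1)"
  using jac_sums(1)[OF s, of "pi / 2 - x"] unfolding cos_even_shift by (simp add: mult_ac)

lemma arcsin_amp_series:
  assumes "x \<in> {0..pi/2}"
  shows "(\<lambda>n. 4 * (1 / (2 * cosh (real (2 * n + 1) * (s / 2)))) / real (2 * n + 1) * sin (real (2 * n + 1) * x)) sums arcsin (modulus s * sin (amp s x))"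
  unfolding integral_jac_C[OF s assms, symmetric]
proof (rule sine_series_sums_integral)
  show "summable (\<lambda>n. \<bar>4 * (1 / (2 * cosh (real (2 * n + 1) * (s / 2))))\<bar>)"
    using summable_mult[OF summable_inverse_cosh(1)[of 1], of 4] by (simp add: abs_mult)
  show "(\<lambda>n. 4 * (1 / (2 * cosh (real (2 * n + 1) * (s / 2)))) * cos (real (2 * n + 1) * x)) sums jac_C s x" for x
    using jac_sums(2)[OF s, of x] by (simp add: mult.commute)
qed (use assms in simp)

text \<open>By the linear equation for \<open>D\<close>, the function
  \<open>- ln (jac_D s (t / 2 + pi / 4))\<close> has derivative
  \<open>jac_S (2 * s) (t + pi / 2)\<close>. The doubled parameter produces
  \<open>sinh (real (2 * n + 1) * s)\<close>, and the shift by \<open>pi / 2\<close> turns sines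
  into cosines with the sign \<open>(-1) ^ n\<close>.\<close>

lemma ln_jac_D_series:
  assumes "x \<in> {0..pi/2}"
  shows "(\<lambda>n. 4 * ((-1) ^ n * (1 / (2 * sinh (real (2 * n + 1) * s)))) / real (2 * n + 1) * sin (real (2 * n + 1) * x))
    sums ln (jac_D s (pi / 4) / jac_D s (x / 2 + pi / 4))"
proof -
  have "integral {0..x} (\<lambda>x. jac_S (2 * s) (x + pi / 2)) = - ln (jac_D s (x / 2 + pi / 4)) - - ln (jac_D s (0 / 2 + pi / 4))"
  proof (rule integral_eq_antiderivative)
    fix t
    have "((\<lambda>t. t / 2 + pi / 4) has_real_derivative 1 / 2) (at t within {0..x})"
      by (auto intro!: derivative_eq_intros)
    from DERIV_minus[OF DERIV_chain2[OF DERIV_ln_divide[OF jac_D_pos[OF s]] DERIV_chain2[OF jac_deriv(4)[OF s] this]]]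
    have "((\<lambda>t. - ln (jac_D s (t / 2 + pi / 4))) has_real_derivative
      - (1 / jac_D s (t / 2 + pi / 4) * (- (2 * jac_S (2 * s) (2 * (t / 2 + pi / 4)) * jac_D s (t / 2 + pi / 4)) * (1 / 2)))) (at t within {0..x})" .
    moreover have "2 * (t / 2 + pi / 4) = t + pi / 2" by simp
    ultimately show "((\<lambda>t. - ln (jac_D s (t / 2 + pi / 4))) has_real_derivative jac_S (2 * s) (t + pi / 2)) (at t within {0..x})"
      using jac_D_pos[OF s, of "t / 2 + pi / 4"] by (simp del: distrib_left_numeral)
  qed (use assms in simp)
  also have "\<dots> = ln (jac_D s (pi / 4) / jac_D s (x / 2 + pi / 4))"
    using jac_D_pos[OF s, of "pi / 4"] jac_D_pos[OF s, of "x / 2 + pi / 4"] by (simp add: ln_div)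
  finally have eq: "ln (jac_D s (pi / 4) / jac_D s (x / 2 + pi / 4)) = integral {0..x} (\<lambda>x. jac_S (2 * s) (x + pi / 2))" ..
  show ?thesis
    unfolding eq
  proof (rule sine_series_sums_integral)
    show "summable (\<lambda>n. \<bar>4 * ((-1) ^ n * (1 / (2 * sinh (real (2 * n + 1) * s))))\<bar>)"
      using summable_mult[OF summable_inverse_sinh, of 4] by (simp add: abs_mult)
    have "2 * s > 0" using s by simp
    then show "(\<lambda>n. 4 * ((-1) ^ n * (1 / (2 * sinh (real (2 * n + 1) * s)))) * cos (real (2 * n + 1) * x)) sums jac_S (2 * s) (x + pi / 2)" for x
      using jac_sums(3)[of "2 * s" "x + pi / 2"] unfolding sin_odd_shift by (simp add: mult_ac)
  qed (use assms in simp)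
qed

lemma nome_formula_1:
  "(\<Sum>n. 1 / real (2 * n + 1) ^ 2 * (1 / (2 * cosh (real (2 * n + 1) * (s / 2)))))
    + 4 * (\<Sum>n. \<Sum>m. 1 / (real (2 * n + 1) ^ 2 - real (2 * Suc m) ^ 2)
        * (1 / (2 * cosh (real (2 * n + 1) * (s / 2))) * (1 ^ Suc m * (1 / (2 * cosh (real (Suc m) * s))))))
    = odd_dilog 1 (modulus s) / 4"
proof -
  have k: "0 \<le> modulus s" "modulus s < 1" using modulus_bounds[OF s] by auto
  have "integral {0..pi/2} (\<lambda>x. arcsin (modulus s * sin (amp s x)) * jac_D s x) = odd_dilog 1 (modulus s)"
    using amp_substitution[OF s continuous_on_arcsin_sin] integral_arcsin_sin[OF k] k by simp
  with double_sum_integral[OF summable_inverse_cosh(1)[of 1] summable_inverse_cosh(2)[of 1] arcsin_amp_series jac_D_series]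
  show ?thesis by simp
qed

text \<open>The sign \<open>(-1) ^ m\<close> is the effect of replacing \<open>D(x)\<close> by
  \<open>D(\<pi> / 2 - x)\<close>. Reflecting the variable moves the shift to the arcsine, which
  becomes an arctangent of \<open>cos (amp s x)\<close>, and leaves \<open>jac_D s x\<close> as the
  weight of the substitution.\<close>

lemma nome_formula_2:
  defines "k \<equiv> modulus s"
  shows "(\<Sum>n. 1 / real (2 * n + 1) ^ 2 * (1 / (2 * cosh (real (2 * n + 1) * (s / 2)))))
    + 4 * (\<Sum>n. \<Sum>m. 1 / (real (2 * n + 1) ^ 2 - real (2 * Suc m) ^ 2)
        * (1 / (2 * cosh (real (2 * n + 1) * (s / 2))) * ((-1) ^ Suc m * (1 / (2 * cosh (real (Suc m) * s))))))
    = odd_dilog 1 (k / (1 + sqrt (1 - k\<^sup>2))) / 2"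
proof -
  define l r where "l = sqrt (1 - k\<^sup>2)" and "r = k / (1 + l)"
  have k: "0 < k" "k < 1" using modulus_bounds[OF s] by (auto simp: k_def)
  then have "k\<^sup>2 < 1" by (simp add: abs_square_less_1)
  then have l: "l > 0" "l\<^sup>2 = 1 - k\<^sup>2" by (simp_all add: l_def)
  have r: "0 \<le> r" "r < 1" using k l by (simp_all add: r_def)
  have "1 - r\<^sup>2 = 2 * l / (1 + l)"
  proof -
    have "1 - r\<^sup>2 = ((1 + l)\<^sup>2 - k\<^sup>2) / (1 + l)\<^sup>2" using l by (simp add: r_def power_divide diff_divide_distrib)
    also have "(1 + l)\<^sup>2 - k\<^sup>2 = 2 * l * (1 + l)" using l(2) by algebra
    finally show ?thesis using l by (simp add: power2_eq_square)
  qed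
  \<comment> \<open>\<open>r\<close> is the tangent of half of \<open>arcsin k\<close>, so this is
    the tangent of \<open>arcsin k\<close>, the slope occurring in
    \<open>arcsin_amp_flip\<close>.\<close>
  then have r2: "2 * r / (1 - r\<^sup>2) = k / l" using l by (simp add: r_def)
  have c: "continuous_on {0..pi/2} (\<lambda>x. arcsin (k * sin (amp s x)) * jac_D s (pi / 2 - x))"
    by (intro continuous_intros continuous_on_compose2[OF continuous_on_arcsin_sin[of k UNIV]]
        continuous_on_compose2[OF continuous_on_jac(1)[OF s, of UNIV]] DERIV_continuous_on[OF amp_deriv[OF s]])
      (use k in auto)
  have "integral {0..pi/2} (\<lambda>x. arcsin (k * sin (amp s x)) * jac_D s (pi / 2 - x))
      = integral {0..pi/2} (\<lambda>x. arcsin (k * sin (amp s (pi / 2 - x))) * jac_D s x)"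
    using integral_flip[OF _ c] by simp
  also have "\<dots> = integral {0..pi/2} (\<lambda>x. arctan (2 * r / (1 - r\<^sup>2) * cos (amp s x)) * jac_D s x)"
    by (rule integral_cong) (simp only: r2 l_def k_def arcsin_amp_flip[OF s])
  also have "\<dots> = integral {0..pi/2} (\<lambda>t. arctan (2 * r / (1 - r\<^sup>2) * cos t))"
    by (rule amp_substitution[OF s]) (intro continuous_intros)
  also have "\<dots> = 2 * odd_dilog 1 r" by (rule integral_arctan_cos[OF r])
  finally show ?thesis
    using double_sum_integral[OF summable_inverse_cosh(1)[of 1] summable_inverse_cosh(2)[of "-1"] arcsin_amp_series jac_D_flip_series]
    by (simp add: k_def r_def l_def)
qed

text \<open>The flip relation turns the quotient into
  \<open>jac_D s (x / 2) / jac_D s (pi / 4)\<close> and also evaluates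
  \<open>(jac_D s (pi / 4))\<^sup>2\<close>. The half-angle formula gives the square of the
  numerator; the final factor 1/2 undoes the squaring.\<close>

lemma ln_jac_D_flip:
  assumes x: "x \<in> {0..pi/2}"
  defines "k \<equiv> modulus s" and "t \<equiv> amp s x"
  shows "ln (jac_D s (pi / 4) / jac_D s ((pi / 2 - x) / 2 + pi / 4))
    = ln ((sqrt (1 - k\<^sup>2 * (sin t)\<^sup>2) + cos t) / (sqrt (1 - k\<^sup>2) * (1 + cos t))) / 2"
proof -
  define M l where "M = jac_D s 0" and "l = sqrt (1 - k\<^sup>2)"
  have M: "M > 0" using jac_D_0_pos[OF s] by (simp add: M_def)
  have k: "0 < k" "k < 1" using modulus_bounds[OF s] by (auto simp: k_def)
  have l: "l > 0" using k by (simp add: l_def abs_square_less_1)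
  note D = jac_D_pos[OF s]
  have flip: "jac_D s (pi / 2 - y) * jac_D s y = M\<^sup>2 * l" for y
    using D[of y] by (simp add: jac_D_flip[OF s] M_def l_def k_def)
  have 1: "(jac_D s (pi / 4))\<^sup>2 = M\<^sup>2 * l"
    using flip[of "pi / 4"] by (simp add: power2_eq_square)
  have "(pi / 2 - x) / 2 + pi / 4 = pi / 2 - x / 2" by (simp add: field_simps)
  then have "jac_D s ((pi / 2 - x) / 2 + pi / 4) = jac_D s (pi / 2 - x / 2)" by (rule arg_cong)
  moreover have "jac_D s (pi / 4) / jac_D s (pi / 2 - x / 2)
      = jac_D s (pi / 4) * jac_D s (x / 2) / (jac_D s (pi / 2 - x / 2) * jac_D s (x / 2))"
    using D[of "x / 2"] by simp
  ultimately have "jac_D s (pi / 4) / jac_D s ((pi / 2 - x) / 2 + pi / 4) = jac_D s (pi / 4) * jac_D s (x / 2) / (M\<^sup>2 * l)"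
    by (simp only: flip)
  also have "\<dots> = jac_D s (x / 2) / jac_D s (pi / 4)"
    unfolding 1[symmetric] using D[of "pi / 4"] by (simp add: power2_eq_square)
  finally have q: "jac_D s (pi / 4) / jac_D s ((pi / 2 - x) / 2 + pi / 4) = jac_D s (x / 2) / jac_D s (pi / 4)" .
  have c: "1 + cos t > 0" using amp_range[OF s x] cos_ge_zero[of t] by (auto simp: t_def)
  have "(jac_D s (x / 2))\<^sup>2 * (1 + cos t) = M\<^sup>2 * (sqrt (1 - k\<^sup>2 * (sin t)\<^sup>2) + cos t)"
    using jac_half_angle[OF s, of "x / 2"] x by (simp add: M_def k_def t_def)
  then have "(jac_D s (x / 2))\<^sup>2 = M\<^sup>2 * ((sqrt (1 - k\<^sup>2 * (sin t)\<^sup>2) + cos t) / (1 + cos t))"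
    using c by (simp add: field_simps)
  then have "(jac_D s (x / 2) / jac_D s (pi / 4))\<^sup>2 = (sqrt (1 - k\<^sup>2 * (sin t)\<^sup>2) + cos t) / (l * (1 + cos t))"
    unfolding power_divide 1 using M by (simp add: mult.commute)
  moreover have "ln ((jac_D s (x / 2) / jac_D s (pi / 4))\<^sup>2) = real 2 * ln (jac_D s (x / 2) / jac_D s (pi / 4))"
    by (rule ln_realpow)
  ultimately show ?thesis unfolding q l_def by simp
qed

text \<open>Reflection again leaves \<open>jac_D s x\<close> as the weight. The resulting function
  of the amplitude is half the logarithm in \<open>integral_ln_Delta_cos\<close>, and the further
  division by 4 yields the coefficients 1/4, 1/4 and \<open>pi / 16\<close>.\<close>

lemma nome_formula_3:
  defines "k \<equiv> modulus s"
  defines "p \<equiv> sqrt ((1 - k) / (1 + k))"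
  shows "(\<Sum>n. 1 / real (2 * n + 1) ^ 2 * ((-1) ^ n * (1 / (2 * sinh (real (2 * n + 1) * s)))))
    + 4 * (\<Sum>n. \<Sum>m. 1 / (real (2 * n + 1) ^ 2 - real (2 * Suc m) ^ 2)
        * ((-1) ^ n * (1 / (2 * sinh (real (2 * n + 1) * s))) * ((-1) ^ Suc m * (1 / (2 * cosh (real (Suc m) * s))))))
    = odd_dilog (-1) p / 4 - catalan_G / 4 - pi / 16 * ln p"
proof -
  have k: "0 \<le> k" "k < 1" using modulus_bounds[OF s] by (auto simp: k_def)
  define h where "h t = ln ((sqrt (1 - k\<^sup>2 * (sin t)\<^sup>2) + cos t) / (sqrt (1 - k\<^sup>2) * (1 + cos t))) / 2" for t
  have k1: "\<bar>k\<bar> < 1" using k by simp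
  have "k\<^sup>2 < 1" using k1 by (simp add: abs_square_less_1)
  have pos: "sqrt (1 - k\<^sup>2 * (sin t)\<^sup>2) + cos t > 0" "1 + cos t > 0" if "t \<in> {0..pi/2}" for t
    using Delta_plus_cos_pos[OF k1 that] cos_ge_zero[of t] that by auto
  have ch: "continuous_on {0..pi/2} h"
    unfolding h_def[abs_def]
  proof (intro continuous_intros ballI)
    fix t assume t: "t \<in> {0..pi/2}"
    have l: "sqrt (1 - k\<^sup>2) > 0" using \<open>k\<^sup>2 < 1\<close> by simp
    from l pos(2)[OF t] show 1: "sqrt (1 - k\<^sup>2) * (1 + cos t) \<noteq> 0" by (metis less_irrefl mult_pos_pos)
    from 1 pos(1)[OF t] show "(sqrt (1 - k\<^sup>2 * (sin t)\<^sup>2) + cos t) / (sqrt (1 - k\<^sup>2) * (1 + cos t)) \<noteq> 0"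
      by (metis divide_eq_0_iff less_irrefl)
  qed simp
  have c: "continuous_on {0..pi/2} (\<lambda>x. ln (jac_D s (pi / 4) / jac_D s (x / 2 + pi / 4)) * jac_D s (pi / 2 - x))"
    by (intro continuous_intros continuous_on_compose2[OF continuous_on_jac(1)[OF s, of UNIV]])
      (use jac_D_pos[OF s] in \<open>auto simp: less_imp_neq[symmetric]\<close>)
  have "integral {0..pi/2} (\<lambda>x. ln (jac_D s (pi / 4) / jac_D s (x / 2 + pi / 4)) * jac_D s (pi / 2 - x))
      = integral {0..pi/2} (\<lambda>x. ln (jac_D s (pi / 4) / jac_D s ((pi / 2 - x) / 2 + pi / 4)) * jac_D s x)"
    using integral_flip[OF _ c] by simp
  also have "\<dots> = integral {0..pi/2} (\<lambda>x. h (amp s x) * jac_D s x)"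
    by (rule integral_cong) (simp only: ln_jac_D_flip h_def k_def)
  also have "\<dots> = integral {0..pi/2} h" by (rule amp_substitution[OF s ch])
  also have "\<dots> = odd_dilog (-1) p - catalan_G - pi / 4 * ln p"
    using integral_ln_Delta_cos[OF k] unfolding h_def[abs_def] integral_divide p_def odd_dilog_catalan
    by (simp add: diff_divide_distrib)
  finally have "integral {0..pi/2} (\<lambda>x. ln (jac_D s (pi / 4) / jac_D s (x / 2 + pi / 4)) * jac_D s (pi / 2 - x))
    = odd_dilog (-1) p - catalan_G - pi / 4 * ln p" .
  with double_sum_integral[OF summable_inverse_sinh summable_inverse_cosh(2)[of "-1"] ln_jac_D_series jac_D_flip_series]
  show ?thesis by (simp add: diff_divide_distrib)
qed

end

section \<open>From hyperbolic quotients to powers of the nome\<close>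

lemma exp_minus_over_cosh: "exp (- y) / (1 + exp (- y) * exp (- y)) = 1 / (2 * cosh (y::real))"
proof -
  have c: "2 * cosh y = exp y + exp (- y)" by (simp add: cosh_field_def)
  have "2 * cosh y * exp (- y) = 1 + exp (- y) * exp (- y)"
    unfolding c distrib_right mult_exp_exp by simp
  moreover have "cosh y \<noteq> 0" by simp
  moreover have "1 + exp (- y) * exp (- y) \<noteq> 0" by (metis add_pos_pos exp_gt_zero less_irrefl mult_pos_pos zero_less_one)
  ultimately show ?thesis by (simp add: frac_eq_eq mult.commute)
qed

lemma exp_minus_over_sinh:
  assumes "y > 0" shows "exp (- y) / (1 - exp (- y) * exp (- y)) = 1 / (2 * sinh (y::real))"
proof -
  have c: "2 * sinh y = exp y - exp (- y)" by (simp add: sinh_field_def)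
  have "2 * sinh y * exp (- y) = 1 - exp (- y) * exp (- y)"
    unfolding c left_diff_distrib mult_exp_exp by simp
  from this[symmetric] show ?thesis by (simp only: nonzero_divide_mult_cancel_right exp_not_eq_zero not_False_eq_True)
qed

theorem corollary6p6:
  fixes k q p r :: real
  assumes "0 < k" and "k < 1"
    and "q = elliptic_nome k"
    and "p = sqrt ((1 - k) / (1 + k))"
    and "r = k / (1 + sqrt (1 - k\<^sup>2))"
  shows
    "((Li2 (of_real k) - Li2 (- of_real k)) / 8 =
       of_real ((\<Sum>n. 1 / real (2 * n + 1) ^ 2
                   * (q powr (real n + 1 / 2) / (1 + q ^ (2 * n + 1))))
         + 4 * (\<Sum>n. \<Sum>m'. let m = Suc m' in
                  1 / (real (2 * n + 1) ^ 2 - real (2 * m) ^ 2)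
                   * (q powr (real m + real n + 1 / 2)
                      / ((1 + q ^ (2 * m)) * (1 + q ^ (2 * n + 1))))))) \<and>
     ((Li2 (of_real r) - Li2 (- of_real r)) / 4 =
       of_real ((\<Sum>n. 1 / real (2 * n + 1) ^ 2
                   * (q powr (real n + 1 / 2) / (1 + q ^ (2 * n + 1))))
         + 4 * (\<Sum>n. \<Sum>m'. let m = Suc m' in
                  (-1) ^ m / (real (2 * n + 1) ^ 2 - real (2 * m) ^ 2)
                   * (q powr (real m + real n + 1 / 2)
                      / ((1 + q ^ (2 * m)) * (1 + q ^ (2 * n + 1))))))) \<and>
     ((Li2 (\<i> * of_real p) - Li2 (- (\<i> * of_real p))) / (8 * \<i>) =
       of_real (catalan_G / 4 + pi / 16 * ln p
         + (\<Sum>n. (-1) ^ n / real (2 * n + 1) ^ 2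
                   * (q ^ (2 * n + 1) / (1 - q ^ (4 * n + 2))))
         + 4 * (\<Sum>n. \<Sum>m'. let m = Suc m' in
                  (-1) ^ (n + m) / (real (2 * n + 1) ^ 2 - real (2 * m) ^ 2)
                   * (q ^ (m + 2 * n + 1)
                      / ((1 + q ^ (2 * m)) * (1 - q ^ (4 * n + 2)))))))"
proof -
  define s where "s = pi * elliptic_K (sqrt (1 - k\<^sup>2)) / elliptic_K k"
  have s: "s > 0" "modulus s = k" using modulus_eqI[OF assms(1,2) s_def] by auto
  have q: "q = exp (- s)" by (simp add: assms(3) elliptic_nome_def s_def)
  have qN: "q ^ j = exp (- (real j * s))" for j by (simp add: q exp_of_nat_mult[symmetric])
  have q2: "q ^ (2 * j) = exp (- (real j * s)) * exp (- (real j * s))" for j by (simp add: power_add mult_2 qN)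
  have qp: "q powr x = exp (- (x * s))" for x by (simp add: q powr_def)
  have cosh_m: "q ^ m / (1 + q ^ (2 * m)) = 1 / (2 * cosh (real m * s))" for m
    unfolding q2 qN[of m] by (rule exp_minus_over_cosh)
  have cosh_n: "q powr (real n + 1 / 2) / (1 + q ^ (2 * n + 1)) = 1 / (2 * cosh (real (2 * n + 1) * (s / 2)))" for n
  proof -
    have "(real n + 1 / 2) * s = real (2 * n + 1) * (s / 2)" by (simp add: algebra_simps)
    moreover have "q ^ (2 * n + 1) = exp (- (real (2 * n + 1) * (s / 2))) * exp (- (real (2 * n + 1) * (s / 2)))"
      unfolding qN mult_exp_exp by (simp add: algebra_simps)
    ultimately show ?thesis unfolding qp by (simp only: exp_minus_over_cosh)
  qed
  have sinh_n: "q ^ (2 * n + 1) / (1 - q ^ (4 * n + 2)) = 1 / (2 * sinh (real (2 * n + 1) * s))" for n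
  proof -
    have "4 * n + 2 = 2 * (2 * n + 1)" by simp
    then have "q ^ (4 * n + 2) = exp (- (real (2 * n + 1) * s)) * exp (- (real (2 * n + 1) * s))" by (simp only: q2)
    then show ?thesis unfolding qN[of "2 * n + 1"] using s by (simp only:) (rule exp_minus_over_sinh, simp)
  qed
  have prod1: "q powr (real m + real n + 1 / 2) / ((1 + q ^ (2 * m)) * (1 + q ^ (2 * n + 1)))
      = 1 / (2 * cosh (real (2 * n + 1) * (s / 2))) * (1 / (2 * cosh (real m * s)))" for m n
  proof -
    have "q powr (real m + real n + 1 / 2) = q powr (real n + 1 / 2) * q ^ m"
      unfolding qp qN mult_exp_exp by (simp add: algebra_simps)
    then show ?thesis unfolding cosh_n[symmetric] cosh_m[symmetric] by simp
  qed
  have prod2: "q ^ (m + 2 * n + 1) / ((1 + q ^ (2 * m)) * (1 - q ^ (4 * n + 2)))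
      = 1 / (2 * sinh (real (2 * n + 1) * s)) * (1 / (2 * cosh (real m * s)))" for m n
    unfolding sinh_n[symmetric] cosh_m[symmetric] by (simp add: power_add mult.commute)
  have k: "\<bar>k\<bar> \<le> 1" using assms by simp
  have "0 < sqrt (1 - k\<^sup>2)" using assms by (simp add: abs_square_less_1)
  moreover have "\<bar>k / (1 + l)\<bar> \<le> 1" if "0 < l" for l using that assms(1,2) by (simp add: divide_le_eq)
  ultimately have r: "\<bar>r\<bar> \<le> 1" by (simp only: assms(5))
  have p: "\<bar>p\<bar> \<le> 1" using assms by simp
  have 1: "(\<Sum>n. 1 / real (2 * n + 1) ^ 2 * (1 / (2 * cosh (real (2 * n + 1) * (s / 2)))))
      + 4 * (\<Sum>n. \<Sum>m. 1 / (real (2 * n + 1) ^ 2 - real (2 * Suc m) ^ 2)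
        * (1 / (2 * cosh (real (2 * n + 1) * (s / 2))) * (1 / (2 * cosh (real (Suc m) * s))))) = odd_dilog 1 k / 4"
    using nome_formula_1[OF s(1)] unfolding s(2) power_one mult_1_left .
  have 2: "(\<Sum>n. 1 / real (2 * n + 1) ^ 2 * (1 / (2 * cosh (real (2 * n + 1) * (s / 2)))))
      + 4 * (\<Sum>n. \<Sum>m. (-1) ^ Suc m / (real (2 * n + 1) ^ 2 - real (2 * Suc m) ^ 2)
        * (1 / (2 * cosh (real (2 * n + 1) * (s / 2))) * (1 / (2 * cosh (real (Suc m) * s))))) = odd_dilog 1 r / 2"
  proof -
    have e: "(-1) ^ Suc m / d * (a * b) = 1 / d * (a * ((-1) ^ Suc m * b))" for a b d :: real and m by simp
    show ?thesis using nome_formula_2[OF s(1)] unfolding s(2) assms(5)[symmetric] e .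
  qed
  have 3: "(\<Sum>n. (-1) ^ n / real (2 * n + 1) ^ 2 * (1 / (2 * sinh (real (2 * n + 1) * s))))
      + 4 * (\<Sum>n. \<Sum>m. (-1) ^ (n + Suc m) / (real (2 * n + 1) ^ 2 - real (2 * Suc m) ^ 2)
        * (1 / (2 * sinh (real (2 * n + 1) * s)) * (1 / (2 * cosh (real (Suc m) * s)))))
      = odd_dilog (-1) p / 4 - catalan_G / 4 - pi / 16 * ln p"
  proof -
    have e1: "(-1) ^ n / d * a = 1 / d * ((-1) ^ n * a)" for a d :: real and n by simp
    have e2: "(-1) ^ (n + m) / d * (a * b) = 1 / d * ((-1) ^ n * a * ((-1) ^ m * b))" for a b d :: real and n m
      by (simp add: power_add)
    show ?thesis using nome_formula_3[OF s(1)] unfolding s(2) assms(4)[symmetric] e2 unfolding e1 .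
  qed
  \<comment> \<open>\<open>X\<close> and \<open>Y\<close> stand for the single and the double sum.
    The constant and the logarithm change sides, so that the result rewrites the right-hand side of
    the goal.\<close>
  have "c / 4 + l + X + 4 * Y = z / 4" if "X + 4 * Y = z / 4 - c / 4 - l" for c l X Y z :: real
    using that by simp
  note 3 = this[OF 3]
  \<comment> \<open>The odd part of \<open>Li2\<close> is \<open>2 * odd_dilog\<close>, with a
    further factor \<open>\<i>\<close> on the imaginary axis; the divisors 8, 4 and
    \<open>8 * \<i>\<close> thus leave quotients by 4, 2 and 4.\<close>
  show ?thesis
    unfolding Let_def cosh_n sinh_n prod1 prod2 1 2 3
    by (simp add: Li2_odd_part_real[OF k] Li2_odd_part_real[OF r] Li2_odd_part_imaginary[OF p])
qed

end
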